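(* Let $n\ge 2$ and let $F$ be a field of characteristic zero or of characteristic larger than $2^{n}$. For every graph $G$ of order $n$, the analytic spread $\ell(J_G)$ equals the maximum of $|E(G')|$ over all subgraphs $G'$ of $G$ such that there exists an acyclic orientation of the edges of $G'$ that has no alternating closed trail. In particular, $\ell(J_G)=|E(G)|$ if and only if there exists an acyclic orientation of $E(G)$ that has no alternating closed trail.
   Context: Graphs are finite and simple with no isolated vertices; the order of a graph is its number of vertices, and $[n]=\{1,\dots,n\}$. Binomial edge ideal: for a graph $G$ on $[n]$, $J_G=(x_iy_j-x_jy_i\mid \{i,j\}\in E(G), i<j)\subset F[x_1,\dots,x_n,y_1,\dots,y_n]$. Analytic spread: for an ideal $I$ in a polynomial ring $S=F[t_1,\dots,t_r]$, $\ell(I)$ is the Krull dimension of the special fiber ring $\bigoplus_{k\ge0} I^k/(t_1,\dots,t_r)I^k$. An orientation of a graph is acyclic if it has no directed cycle. An alternating closed trail in a directed graph $D$ is a walk $w=(v_0,\dots,v_k)$ with $k\ge 1$ in the underlying undirected graph such that each edge of $D$ appears at most once in $w$, $v_k=v_0$, and adjacent edges along the closed walk $w$ (cyclically, so that the last edge and the first edge are also adjacent) have opposite orientations, i.e. of any two consecutive edges one is traversed along its direction and the other against its direction. *)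

theory Defs
  imports
    "HOL-Library.Poly_Mapping"
    "HOL-Library.Extended_Nat"
    "HOL-Algebra.QuotRing"
    "HOL-Algebra.Ideal_Product"
begin

type_synonym 'v graph = "'v set \<times> 'v set set"

abbreviation verts :: "'v graph \<Rightarrow> 'v set" where "verts \<equiv> fst"
abbreviation edges :: "'v graph \<Rightarrow> 'v set set" where "edges \<equiv> snd"

text \<open>Isolated vertices are excluded by convention, for subgraphs as well.\<close>

definition simple_graph :: "'v graph \<Rightarrow> bool" where
  "simple_graph G \<longleftrightarrow>
     finite (verts G) \<and>
     edges G \<subseteq> {e. e \<subseteq> verts G \<and> card e = 2} \<and>
     (\<forall>v \<in> verts G. \<exists>e \<in> edges G. v \<in> e)"

definition subgraph :: "'v graph \<Rightarrow> 'v graph \<Rightarrow> bool" where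
  "subgraph H G \<longleftrightarrow> simple_graph H \<and> verts H \<subseteq> verts G \<and> edges H \<subseteq> edges G"

text \<open>
  An orientation is a set of arcs, a pair \<open>(u, v)\<close> being directed from \<open>u\<close> to \<open>v\<close>;
  bijectivity says that every edge receives exactly one of its two directions.
\<close>

definition orientation :: "'v graph \<Rightarrow> ('v \<times> 'v) set \<Rightarrow> bool" where
  "orientation G D \<longleftrightarrow> bij_betw (\<lambda>(u, v). {u, v}) D (edges G)"

text \<open>
  The list \<open>w\<close> is \<open>v\<^sub>0, \<dots>, v\<^sub>k\<close> with \<open>k = length w - 1\<close>, and its edges are indexed by
  \<open>i < k\<close>; the successor of edge \<open>i\<close> on the closed walk is edge \<open>Suc i mod k\<close>.
\<close>

definition alternating_closed_trail :: "('v \<times> 'v) set \<Rightarrow> 'v list \<Rightarrow> bool" where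
  "alternating_closed_trail D w \<longleftrightarrow>
     (let k = length w - 1;
          forward = (\<lambda>i. (w ! i, w ! Suc i) \<in> D);
          backward = (\<lambda>i. (w ! Suc i, w ! i) \<in> D)
      in k \<ge> 1 \<and>
         (\<forall>i<k. forward i \<or> backward i) \<and>
         inj_on (\<lambda>i. {w ! i, w ! Suc i}) {..<k} \<and>
         w ! k = w ! 0 \<and>
         (\<forall>i<k. forward i \<and> backward (Suc i mod k) \<or> backward i \<and> forward (Suc i mod k)))"

text \<open>
  The zero ring, which has no prime ideals, gets dimension 0; this case does not arise for special
  fiber rings over a field \<open>F\<close>, whose component of degree 0 is \<open>F\<close>.
\<close>

definition krull_dim :: "('a, 'b) ring_scheme \<Rightarrow> enat" where
  "krull_dim R = Sup {enat d | d. \<exists>P :: nat \<Rightarrow> 'a set.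
     (\<forall>i\<le>d. primeideal (P i) R) \<and> (\<forall>i<d. P i \<subset> P (Suc i))}"

abbreviation ideal_power :: "('a, 'b) ring_scheme \<Rightarrow> 'a set \<Rightarrow> nat \<Rightarrow> 'a set" where
  "ideal_power R I k \<equiv> I [^]\<^bsub>ideals_set R\<^esub> k"

text \<open>
  The ring \<open>\<Oplus>\<^sub>k I\<^sup>k / \<mm>I\<^sup>k\<close>: an element is a finitely supported sequence of cosets of \<open>\<mm>I\<^sup>k\<close> in
  \<open>I\<^sup>k\<close>. For \<open>a \<in> I\<^sup>i\<close> and \<open>b \<in> I\<^sup>j\<close> the product of \<open>a + \<mm>I\<^sup>i\<close> and \<open>b + \<mm>I\<^sup>j\<close> is \<open>ab + \<mm>I\<^bsup>i+j\<^esup>\<close>, which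
  is what \<^const>\<open>rcoset_mult\<close> computes when taken modulo \<open>\<mm>I\<^bsup>i+j\<^esup>\<close>. The sum over \<open>i \<le> k\<close> of
  these cosets is formed in \<open>R/\<mm>I\<^sup>k\<close>, which contains \<open>I\<^sup>k/\<mm>I\<^sup>k\<close> as an additive subgroup.
\<close>

definition special_fiber :: "('a, 'b) ring_scheme \<Rightarrow> 'a set \<Rightarrow> 'a set \<Rightarrow> (nat \<Rightarrow> 'a set) ring" where
  "special_fiber R \<mm> I = (let Q = (\<lambda>k. ideal_prod R \<mm> (ideal_power R I k)) in
     \<lparr> carrier = {f. (\<forall>k. f k \<in> {Q k +>\<^bsub>R\<^esub> a | a. a \<in> ideal_power R I k}) \<and> finite {k. f k \<noteq> Q k}},
       mult = (\<lambda>f g k. \<Oplus>\<^bsub>R Quot Q k\<^esub>i\<in>{..k}. [mod Q k:] f i \<Otimes>\<^bsub>R\<^esub> g (k - i)),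
       one = (\<lambda>k. if k = 0 then Q 0 +>\<^bsub>R\<^esub> \<one>\<^bsub>R\<^esub> else Q k),
       zero = Q,
       add = (\<lambda>f g k. f k <+>\<^bsub>R\<^esub> g k) \<rparr>)"

type_synonym ('x, 'a) mpoly = "('x \<Rightarrow>\<^sub>0 nat) \<Rightarrow>\<^sub>0 'a"

definition mvar :: "'x \<Rightarrow> ('x, 'a::comm_ring_1) mpoly" where
  "mvar x = Poly_Mapping.single (Poly_Mapping.single x 1) 1"

definition mpoly_ring :: "'x set \<Rightarrow> ('x, 'a::comm_ring_1) mpoly ring" where
  "mpoly_ring T = \<lparr> carrier = {p. \<forall>m \<in> Poly_Mapping.keys p. Poly_Mapping.keys m \<subseteq> T},
     mult = (*), one = 1, zero = 0, add = (+) \<rparr>"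

definition analytic_spread :: "'x set \<Rightarrow> ('x, 'a::field) mpoly set \<Rightarrow> enat" where
  "analytic_spread T I =
     (let S = mpoly_ring T in krull_dim (special_fiber S (Idl\<^bsub>S\<^esub> (mvar ` T)) I))"

datatype xy_var = X nat | Y nat

definition xy_vars :: "nat \<Rightarrow> xy_var set" where
  "xy_vars n = X ` {1..n} \<union> Y ` {1..n}"

definition binomial_edge_ideal :: "nat \<Rightarrow> nat graph \<Rightarrow> (xy_var, 'a::field) mpoly set" where
  "binomial_edge_ideal n G = Idl\<^bsub>mpoly_ring (xy_vars n)\<^esub>
     {mvar (X i) * mvar (Y j) - mvar (X j) * mvar (Y i) | i j. {i, j} \<in> edges G \<and> i < j}"

end

theory Submission
  imports Defs "HOL-Computational_Algebra.Polynomial_Factorial"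
begin

text \<open>
  All generators \<open>f\<^sub>e = x\<^sub>i y\<^sub>j - x\<^sub>j y\<^sub>i\<close> of \<open>J\<^sub>G\<close> have degree 2, so the special fiber ring is
  \<open>F[f\<^sub>e : e \<in> E(G)]\<close>, and its dimension is the largest number of algebraically independent \<open>f\<^sub>e\<close>.

  Given an acyclic orientation, choose weights for which \<open>x\<^sub>u y\<^sub>v\<close> is the leading monomial of the binomial
  of each arc \<open>(u, v)\<close>. These monomials are the edges of a bipartite graph whose cycles are the
  alternating closed trails; without such trails the leading monomials, and hence the \<open>f\<^sub>e\<close>, are
  algebraically independent.

  Conversely, if the \<open>f\<^sub>e\<close> with \<open>e \<in> E'\<close> are algebraically independent, some valuation \<open>v\<close> of
  \<open>F(x, y)\<close> has linearly independent values \<open>v(f\<^sub>e)\<close>. With \<open>a\<^sub>i = y\<^sub>i/x\<^sub>i\<close> we have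
  \<open>v(f\<^sub>e) = v(x\<^sub>i) + v(x\<^sub>j) + v(a\<^sub>i - a\<^sub>j)\<close>, and the last term is an ultrametric: every set of vertices
  splits into two parts between which it is constant. Replace this constant \<open>c\<close> by a difference
  of weights \<open>\<plusminus>c/2\<close> of the two parts; in one of the two possible orders of the parts independence
  survives. Refining until all parts are single vertices gives a linear order of the vertices and
  independent values \<open>out\<^sub>i + in\<^sub>j\<close> for \<open>i\<close> before \<open>j\<close>, which excludes alternating closed trails.
\<close>

section \<open>Polynomials\<close>

text \<open>The algebra generated by the binomials is presented as a polynomial ring with one
  variable per edge modulo the kernel \<open>N\<close> of evaluation. No fraction field of this
  quotient is formed: independence of a set \<open>B\<close> of edge indices reads
  \<open>polys B \<inter> N = {0}\<close>, and Krull dimension is matched with the largest such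
  \<open>B\<close> by constructing prime chains in one direction and independent variables in the
  other. The value group of the valuation is never formed either: values are compared modulo units,
  and their independence is a statement about products with integer exponents.

  The obstacle in the converse is that a_i - a_j couples both endpoints, whereas excluding
  alternating trails needs values that split into a contribution of the tail and one of the head.
  Such a split is made one cluster at a time, and each time it disturbs the values of the edges that
  leave the cluster. Reversing the two parts inverts this disturbance, and a disturbance and its
  inverse cannot both create a relation.\<close>

abbreviation (input) "keys \<equiv> Poly_Mapping.keys"
abbreviation (input) "lookup \<equiv> Poly_Mapping.lookup"
abbreviation (input) "single \<equiv> Poly_Mapping.single"

lemma poly_mapping_eq_sum_single:
  "p = (\<Sum>m\<in>keys p. single m (lookup p m))"
  by (rule poly_mapping_eqI) (simp add: lookup_sum lookup_single when_def in_keys_iff)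

lemma poly_mapping_single_induct [case_names single add]:
  fixes p :: "'m \<Rightarrow>\<^sub>0 'a::comm_monoid_add"
  assumes single: "\<And>m c. P (single m c)" and add: "\<And>p q. P p \<Longrightarrow> P q \<Longrightarrow> P (p + q)"
  shows "P p"
proof -
  have "P (\<Sum>m\<in>M. single m (lookup p m))" if "finite M" for M
    using that by (induction M) (auto simp: assms single[of undefined 0, simplified])
  then show ?thesis
    by (subst poly_mapping_eq_sum_single) simp
qed

text \<open>Coefficient map and exponents are both parameters because three evaluations are needed:
  of polynomials at the binomials, of the same polynomials in a fraction field, and of Laurent
  polynomials.\<close>

definition lin_ext :: "('a::comm_ring_1 \<Rightarrow> 'r::comm_ring_1) \<Rightarrow> ('m \<Rightarrow> 'r) \<Rightarrow> ('m \<Rightarrow>\<^sub>0 'a) \<Rightarrow> 'r" where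
  "lin_ext h \<chi> p = (\<Sum>m\<in>keys p. h (lookup p m) * \<chi> m)"

locale character_ext =
  fixes h :: "'a::comm_ring_1 \<Rightarrow> 'r::comm_ring_1" and \<chi> :: "'m::comm_monoid_add \<Rightarrow> 'r"
  assumes h_zero: "h 0 = 0" and h_one: "h 1 = 1"
    and h_add: "h (a + b) = h a + h b" and h_mult: "h (a * b) = h a * h b"
    and char_zero: "\<chi> 0 = 1" and char_add: "\<chi> (m + m') = \<chi> m * \<chi> m'"
begin

abbreviation "ev \<equiv> lin_ext h \<chi>"

lemma ev_single: "ev (single m c) = h c * \<chi> m"
  by (simp add: lin_ext_def h_zero)

lemma ev_add: "ev (p + q) = ev p + ev q"
  unfolding lin_ext_def by (rule setsum_keys_plus_distrib) (simp_all add: h_zero h_add algebra_simps)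

lemma ev_zero: "ev 0 = 0"
  by (simp add: lin_ext_def)

lemma ev_one: "ev 1 = 1"
  using ev_single[of 0 1] by (simp add: h_one char_zero)

lemma ev_minus: "ev (- p) = - ev p"
  using ev_add[of p "- p"] by (simp add: ev_zero eq_neg_iff_add_eq_0 add.commute)

lemma ev_diff: "ev (p - q) = ev p - ev q"
  using ev_add[of p "- q"] by (simp add: ev_minus)

lemma ev_sum: "ev (\<Sum>i\<in>I. f i) = (\<Sum>i\<in>I. ev (f i))"
  by (induction I rule: infinite_finite_induct) (simp_all add: ev_zero ev_add)

lemma ev_mult: "ev (p * q) = ev p * ev q"
proof (induction p rule: poly_mapping_single_induct)
  case (single m c)
  show ?case
    by (induction q rule: poly_mapping_single_induct)
      (simp_all add: mult_single ev_single ev_add h_mult char_add algebra_simps)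
qed (simp add: ev_add algebra_simps)

end

definition monom_at :: "('v \<Rightarrow> 'r::comm_monoid_mult) \<Rightarrow> ('v \<Rightarrow>\<^sub>0 nat) \<Rightarrow> 'r" where
  "monom_at x m = (\<Prod>v\<in>keys m. x v ^ lookup m v)"

lemma monom_at_superset:
  assumes "finite B" "keys m \<subseteq> B"
  shows "monom_at x m = (\<Prod>v\<in>B. x v ^ lookup m v)"
  unfolding monom_at_def using assms by (intro prod.mono_neutral_left) (auto simp: in_keys_iff)

lemma monom_at_zero [simp]: "monom_at x 0 = 1"
  by (simp add: monom_at_def)

lemma monom_at_add: "monom_at x (m + m') = monom_at x m * monom_at x m'"
proof -
  let ?B = "keys m \<union> keys m'"
  have "keys (m + m') \<subseteq> ?B" by (rule keys_add)
  then show ?thesis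
    by (simp add: monom_at_superset[of ?B] lookup_add power_add prod.distrib)
qed

lemma monom_at_single [simp]: "monom_at x (single v k) = x v ^ k"
  by (cases "k = 0") (simp_all add: monom_at_def)

lemma single_zero_eq_iff: "single m (c::'a::zero) = 0 \<longleftrightarrow> c = 0"
  by (metis lookup_single_eq lookup_zero single_zero)

abbreviation const :: "'a::comm_ring_1 \<Rightarrow> ('v, 'a) mpoly" where
  "const \<equiv> single 0"

lemma mvar_power: "mvar v ^ k = single (single v k) (1::'a::comm_ring_1)"
  by (induction k) (simp_all add: mvar_def mult_single single_add[symmetric])

lemma monom_at_mvar: "monom_at mvar m = single m (1::'a::comm_ring_1)"
proof -
  have "(\<Prod>v\<in>B. mvar v ^ lookup m v) =
      single (\<Sum>v\<in>B. single v (lookup m v)) (1::'a)" if "finite B" for B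
    using that by (induction B) (simp_all add: mvar_power mult_single)
  then show ?thesis
    unfolding monom_at_def by (simp add: poly_mapping_eq_sum_single[symmetric])
qed

lemma single_eq_const_mult: "single m c = const c * single m (1::'a::comm_ring_1)"
  by (simp add: mult_single)

section \<open>Polynomials in a subset of the variables\<close>

definition polys :: "'v set \<Rightarrow> ('v, 'a::comm_ring_1) mpoly set" where
  "polys B = {p. \<forall>m \<in> keys p. keys m \<subseteq> B}"

lemma carrier_mpoly_ring: "carrier (mpoly_ring B) = polys B"
  by (simp add: mpoly_ring_def polys_def)

lemma polys_UNIV [simp]: "polys UNIV = UNIV"
  by (simp add: polys_def)

lemma polys_mono: "B \<subseteq> C \<Longrightarrow> polys B \<subseteq> polys C"
  by (auto simp: polys_def)

lemma polys_single: "keys m \<subseteq> B \<Longrightarrow> single m c \<in> polys B"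
  by (simp add: polys_def)

lemma polys_const [simp]: "const c \<in> polys B"
  by (simp add: polys_single)

lemma polys_zero [simp]: "0 \<in> polys B"
  by (simp add: polys_def)

lemma polys_one [simp]: "1 \<in> polys B"
  by (simp add: polys_def)

lemma polys_mvar: "v \<in> B \<Longrightarrow> mvar v \<in> polys B"
  by (simp add: mvar_def polys_single)

lemma polys_add: "p \<in> polys B \<Longrightarrow> q \<in> polys B \<Longrightarrow> p + q \<in> polys B"
  using keys_add[of p q] by (auto simp: polys_def)

lemma polys_uminus: "p \<in> polys B \<Longrightarrow> - p \<in> polys B"
  by (simp add: polys_def in_keys_iff)

lemma polys_diff: "p \<in> polys B \<Longrightarrow> q \<in> polys B \<Longrightarrow> p - q \<in> polys B"
  using polys_add[OF _ polys_uminus, of p B q] by simp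

lemma polys_mult: "p \<in> polys B \<Longrightarrow> q \<in> polys B \<Longrightarrow> p * q \<in> polys B"
  by (force simp: polys_def dest!: subsetD[OF keys_mult] subsetD[OF keys_add])

lemma polys_power: "p \<in> polys B \<Longrightarrow> p ^ k \<in> polys B"
  by (induction k) (simp_all add: polys_mult)

lemma polys_sum: "(\<And>i. i \<in> I \<Longrightarrow> f i \<in> polys B) \<Longrightarrow> (\<Sum>i\<in>I. f i) \<in> polys B"
  by (induction I rule: infinite_finite_induct) (simp_all add: polys_add)

lemma polys_induct [consumes 1, case_names single add]:
  assumes "p \<in> polys B"
    and single: "\<And>m c. keys m \<subseteq> B \<Longrightarrow> P (single m c)"
    and add: "\<And>p q. P p \<Longrightarrow> P q \<Longrightarrow> P (p + q)"
  shows "P p"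
proof -
  have "P (\<Sum>m\<in>M. single m (lookup p m))"
    if "finite M" "M \<subseteq> keys p" for M
    using that
  proof (induction M)
    case empty
    then show ?case using single[of 0 0] by simp
  next
    case (insert m M)
    have "P (single m (lookup p m))"
      using insert assms(1) by (intro single) (auto simp: polys_def)
    then show ?case using insert by (simp add: add)
  qed
  then show ?thesis
    by (subst poly_mapping_eq_sum_single) simp
qed

text \<open>Supplies univariate relations for \<open>mvar v\<close> over \<open>polys B\<close>, the
  form in which algebraic dependence is used below.\<close>

lemma polys_insert_decomp:
  assumes "p \<in> polys (insert v B)"
  obtains c k where "\<And>i. c i \<in> polys B" "p = (\<Sum>i<k. c i * mvar v ^ i)"
proof -
  have "\<exists>c k. (\<forall>i. c i \<in> polys B) \<and> p = (\<Sum>i<k. c i * mvar v ^ i)"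
    using assms
  proof (induction p rule: polys_induct)
    case (single m a)
    define e where "e = lookup m v"
    define m' where "m' = m - single v e"
    have m: "m = m' + single v e"
      by (rule poly_mapping_eqI)
        (auto simp: m'_def e_def lookup_add lookup_minus lookup_single when_def)
    have "keys m' \<subseteq> B"
    proof
      fix u assume u: "u \<in> keys m'"
      then have "u \<noteq> v" by (auto simp: m'_def e_def in_keys_iff lookup_minus)
      moreover from u have "u \<in> keys m"
        by (auto simp: m'_def e_def in_keys_iff lookup_minus)
      ultimately show "u \<in> B" using single by auto
    qed
    moreover have "single m a = single m' a * mvar v ^ e"
      by (subst m) (simp add: mvar_power mult_single)
    ultimately show ?case
      by (intro exI[of _ "\<lambda>i. if i = e then single m' a else 0"] exI[of _ "Suc e"])
        (auto simp: polys_single if_distrib[of "\<lambda>x. x * _"] cong: if_cong)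
  next
    case (add p q)
    then obtain c k c' k' where c: "\<forall>i. c i \<in> polys B" "p = (\<Sum>i<k. c i * mvar v ^ i)"
      "\<forall>i. c' i \<in> polys B" "q = (\<Sum>i<k'. c' i * mvar v ^ i)" by blast
    let ?c = "\<lambda>i. if i < k then c i else 0" and ?c' = "\<lambda>i. if i < k' then c' i else 0"
    have "p = (\<Sum>i<max k k'. ?c i * mvar v ^ i)" "q = (\<Sum>i<max k k'. ?c' i * mvar v ^ i)"
      unfolding c by (intro sum.mono_neutral_cong_left; auto)+
    then have "p + q = (\<Sum>i<max k k'. (?c i + ?c' i) * mvar v ^ i)"
      by (simp add: sum.distrib algebra_simps)
    moreover have "\<forall>i. ?c i + ?c' i \<in> polys B" using c by (auto intro: polys_add)
    ultimately show ?case
      by (intro exI[of _ "\<lambda>i. ?c i + ?c' i"] exI[of _ "max k k'"]) simp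
  qed
  then show thesis using that by blast
qed

section \<open>Leading exponents for the linear order of the exponents\<close>

definition lead :: "('m::linorder \<Rightarrow>\<^sub>0 'a::zero) \<Rightarrow> 'm" where
  "lead p = Max (keys p)"

lemma lead_in_keys: "p \<noteq> 0 \<Longrightarrow> lead p \<in> keys p"
  unfolding lead_def by (intro Max_in) auto

lemma lead_eqI: "m \<in> keys p \<Longrightarrow> (\<And>m'. m' \<in> keys p \<Longrightarrow> m' \<le> m) \<Longrightarrow> lead p = m"
  unfolding lead_def by (intro Max_eqI) auto

lemma lookup_mult_keys:
  "lookup (p * q) m =
     (\<Sum>a\<in>keys p. \<Sum>b\<in>keys q.
        if a + b = m then lookup p a * lookup q b else 0)"
proof -
  have "p * q = (\<Sum>a\<in>keys p. \<Sum>b\<in>keys q.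
      single (a + b) (lookup p a * lookup q b))"
    by (subst poly_mapping_eq_sum_single[of p], subst poly_mapping_eq_sum_single[of q])
      (simp add: sum_product mult_single)
  then show ?thesis
    by (simp add: lookup_sum lookup_single when_def)
qed

text \<open>Only the pair of leading exponents sums to \<open>lead p + lead q\<close>, and in a
  domain the product of its coefficients does not vanish.\<close>

lemma lead_mult:
  fixes p q :: "'m::{ordered_cancel_comm_monoid_add, linorder} \<Rightarrow>\<^sub>0 'a::idom"
  assumes "p \<noteq> 0" "q \<noteq> 0"
  shows "lead (p * q) = lead p + lead q"
proof (rule lead_eqI)
  have max: "a \<le> lead p" "b \<le> lead q"
    if "a \<in> keys p" "b \<in> keys q" for a b
    using that by (simp_all add: lead_def)
  have uniq: "a = lead p \<and> b = lead q"
    if "a \<in> keys p" "b \<in> keys q" "a + b = lead p + lead q" for a b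
    using max[OF that(1,2)] that(3) add_le_less_mono[of a "lead p" b "lead q"]
      add_less_le_mono[of a "lead p" b "lead q"] by (auto simp: order_less_le)
  have "lookup (p * q) (lead p + lead q) =
      (\<Sum>a\<in>keys p. \<Sum>b\<in>keys q.
        if a = lead p \<and> b = lead q then lookup p a * lookup q b else 0)"
    unfolding lookup_mult_keys using uniq by (intro sum.cong refl if_cong) auto
  also have "\<dots> = (\<Sum>a\<in>keys p. if a = lead p then
      \<Sum>b\<in>keys q. if b = lead q then lookup p a * lookup q b else 0 else 0)"
    by (intro sum.cong refl) auto
  also have "\<dots> = lookup p (lead p) * lookup q (lead q)"
    using lead_in_keys[OF assms(1)] lead_in_keys[OF assms(2)] by simp
  also have "\<dots> \<noteq> 0"
    using lead_in_keys[OF assms(1)] lead_in_keys[OF assms(2)] by (simp add: in_keys_iff)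
  finally show "lead p + lead q \<in> keys (p * q)"
    by (simp add: in_keys_iff)
  show "m \<le> lead p + lead q" if "m \<in> keys (p * q)" for m
    using that keys_mult[of p q] max by (auto intro!: add_mono)
qed

section \<open>Prime ideals and dimension\<close>

text \<open>Ideals as plain sets over the type class, so that computations need no carriers;
  \<open>krull_dim_of_surjection\<close> translates to the prime ideals of
  \<open>krull_dim\<close>.\<close>

locale ideal_set =
  fixes P :: "'r::comm_ring_1 set"
  assumes zero_mem: "0 \<in> P" and add_mem: "a \<in> P \<Longrightarrow> b \<in> P \<Longrightarrow> a + b \<in> P"
    and mult_mem: "a \<in> P \<Longrightarrow> r * a \<in> P"
begin

lemma mult_mem2: "a \<in> P \<Longrightarrow> a * r \<in> P"
  using mult_mem[of a r] by (simp add: mult.commute)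

lemma uminus_mem: "a \<in> P \<Longrightarrow> - a \<in> P"
  using mult_mem[of a "-1"] by simp

lemma diff_mem: "a \<in> P \<Longrightarrow> b \<in> P \<Longrightarrow> a - b \<in> P"
  using add_mem[OF _ uminus_mem, of a b] by simp

lemma sum_mem: "(\<And>i. i \<in> I \<Longrightarrow> f i \<in> P) \<Longrightarrow> sum f I \<in> P"
  by (induction I rule: infinite_finite_induct) (simp_all add: zero_mem add_mem)

lemma mem_of_diff: "a - b \<in> P \<Longrightarrow> b \<in> P \<Longrightarrow> a \<in> P"
  using add_mem[of "a - b" b] by simp

end

locale prime_set = ideal_set +
  assumes one_not_mem: "1 \<notin> P" and prime_mem: "a * b \<in> P \<Longrightarrow> a \<in> P \<or> b \<in> P"
begin

lemma power_mem: "a ^ k \<in> P \<Longrightarrow> a \<in> P"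
  by (induction k) (auto simp: one_not_mem dest: prime_mem)

end

text \<open>By Zorn there is an ideal maximal among those above \<open>J\<close> that avoid
  \<open>S\<close>. Two elements outside it each bring an element of \<open>S\<close> into a larger
  ideal; if their product were inside, so would be the product of these two elements of
  \<open>S\<close>.\<close>

lemma prime_avoiding:
  fixes J S :: "'r::comm_ring_1 set"
  assumes "ideal_set J" and S: "1 \<in> S" "\<And>a b. a \<in> S \<Longrightarrow> b \<in> S \<Longrightarrow> a * b \<in> S" and "J \<inter> S = {}"
  obtains P where "prime_set P" "J \<subseteq> P" "P \<inter> S = {}"
proof -
  define \<A> where "\<A> = {I. ideal_set I \<and> J \<subseteq> I \<and> I \<inter> S = {}}"
  have "J \<in> \<A>" using assms by (simp add: \<A>_def)
  moreover have "\<Union>\<C> \<in> \<A>" if "\<C> \<noteq> {}" "subset.chain \<A> \<C>" for \<C>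
  proof -
    have sub: "I \<in> \<C> \<Longrightarrow> ideal_set I \<and> J \<subseteq> I \<and> I \<inter> S = {}" for I
      using that(2) by (auto simp: subset.chain_def \<A>_def)
    have "ideal_set (\<Union>\<C>)"
    proof
      show "0 \<in> \<Union>\<C>" using that(1) sub ideal_set.zero_mem by blast
      show "r * a \<in> \<Union>\<C>" if "a \<in> \<Union>\<C>" for a r
        using that sub ideal_set.mult_mem by blast
      show "a + b \<in> \<Union>\<C>" if ab: "a \<in> \<Union>\<C>" "b \<in> \<Union>\<C>" for a b
      proof -
        obtain I I' where I: "I \<in> \<C>" "I' \<in> \<C>" "a \<in> I" "b \<in> I'" using ab by blast
        then have "I \<subseteq> I' \<or> I' \<subseteq> I"
          using \<open>subset.chain \<A> \<C>\<close> by (auto simp: subset.chain_def)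
        then show ?thesis using I sub ideal_set.add_mem by (metis UnionI subsetD)
      qed
    qed
    then show ?thesis using that(1) sub by (auto simp: \<A>_def)
  qed
  ultimately obtain P where P: "P \<in> \<A>" "\<And>I. I \<in> \<A> \<Longrightarrow> P \<subseteq> I \<Longrightarrow> I = P"
    using subset_Zorn_nonempty[of \<A>] by blast
  interpret ideal_set P using P(1) by (simp add: \<A>_def)
  have ext: "\<exists>s\<in>S. \<exists>p\<in>P. \<exists>r. s = p + r * a" if "a \<notin> P" for a
  proof (rule ccontr)
    assume neg: "\<not> ?thesis"
    let ?I = "{p + r * a | p r. p \<in> P}"
    have "ideal_set ?I"
    proof
      show "0 \<in> ?I" using zero_mem by (auto intro!: exI[of _ 0])
      show "x + y \<in> ?I" if xy: "x \<in> ?I" "y \<in> ?I" for x y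
      proof -
        obtain p r p' r' where "x = p + r * a" "y = p' + r' * a" "p \<in> P" "p' \<in> P" using xy by blast
        then have "x + y = (p + p') + (r + r') * a" "p + p' \<in> P"
          by (simp_all add: algebra_simps add_mem)
        then show ?thesis by blast
      qed
      show "t * x \<in> ?I" if x: "x \<in> ?I" for x t
      proof -
        obtain p r where "x = p + r * a" "p \<in> P" using x by blast
        then have "t * x = t * p + (t * r) * a" "t * p \<in> P"
          by (simp_all add: algebra_simps mult_mem2)
        then show ?thesis by blast
      qed
    qed
    moreover have "P \<subseteq> ?I" by (force intro: exI[of _ 0])
    ultimately have "?I \<in> \<A>" using P(1) neg by (auto simp: \<A>_def)
    then have "?I = P" using P(2) \<open>P \<subseteq> ?I\<close> by blast
    moreover have "a \<in> ?I" using zero_mem by (force intro: exI[of _ 0] exI[of _ 1])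
    ultimately show False using that by simp
  qed
  have "prime_set P"
  proof
    show "1 \<notin> P" using P(1) S(1) by (auto simp: \<A>_def)
    fix a b assume ab: "a * b \<in> P"
    show "a \<in> P \<or> b \<in> P"
    proof (rule ccontr)
      assume "\<not> (a \<in> P \<or> b \<in> P)"
      then obtain s p r s' p' r' where
        *: "s \<in> S" "p \<in> P" "s = p + r * a" "s' \<in> S" "p' \<in> P" "s' = p' + r' * b"
        using ext by metis
      have "s * s' = s' * p + (r * a) * p' + (r * r') * (a * b)"
        by (simp add: * algebra_simps)
      also have "\<dots> \<in> P" using * ab by (intro add_mem) (auto intro: mult_mem)
      finally show False using S(2)[of s s'] * P(1) by (auto simp: \<A>_def)
    qed
  qed
  then show thesis using that P(1) by (auto simp: \<A>_def)
qed

section \<open>Subrings and linear algebra without division\<close>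

locale subring_set =
  fixes D :: "'r::comm_ring_1 set"
  assumes zero_in: "0 \<in> D" and one_in: "1 \<in> D"
    and diff_in: "a \<in> D \<Longrightarrow> b \<in> D \<Longrightarrow> a - b \<in> D"
    and mult_in: "a \<in> D \<Longrightarrow> b \<in> D \<Longrightarrow> a * b \<in> D"
begin

lemma uminus_in: "a \<in> D \<Longrightarrow> - a \<in> D"
  using diff_in[of 0 a] zero_in by simp

lemma add_in: "a \<in> D \<Longrightarrow> b \<in> D \<Longrightarrow> a + b \<in> D"
  using diff_in[of a "- b"] uminus_in by simp

lemma power_in: "a \<in> D \<Longrightarrow> a ^ k \<in> D"
  by (induction k) (simp_all add: one_in mult_in)

lemma sum_in: "(\<And>i. i \<in> I \<Longrightarrow> f i \<in> D) \<Longrightarrow> sum f I \<in> D"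
  by (induction I rule: infinite_finite_induct) (simp_all add: zero_in add_in)

lemma prod_in: "(\<And>i. i \<in> I \<Longrightarrow> f i \<in> D) \<Longrightarrow> prod f I \<in> D"
  by (induction I rule: infinite_finite_induct) (simp_all add: one_in mult_in)

end

lemma subring_polys: "subring_set (polys B)"
  by unfold_locales (simp_all add: polys_diff polys_mult)

text \<open>Gaussian elimination by cross multiplication with a pivot, so that everything stays in
  the subring \<open>D\<close>.\<close>

lemma homogeneous_system_nontrivial:
  fixes a :: "'k \<Rightarrow> 'i \<Rightarrow> 'r::idom"
  assumes "subring_set D" "finite V" "finite I" "card V < card I"
    and "\<And>k i. k \<in> V \<Longrightarrow> i \<in> I \<Longrightarrow> a k i \<in> D"
  shows "\<exists>c. (\<forall>i\<in>I. c i \<in> D) \<and> (\<exists>i\<in>I. c i \<noteq> 0) \<and> (\<forall>k\<in>V. (\<Sum>i\<in>I. a k i * c i) = 0)"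
  using assms(2-5)
proof (induction V arbitrary: I a rule: finite_induct)
  case empty
  then obtain i where "i \<in> I" by fastforce
  then show ?case
    using subring_set.one_in[OF assms(1)] by (intro exI[of _ "\<lambda>_. 1"]) auto
next
  case (insert k V)
  interpret subring_set D by fact
  show ?case
  proof (cases "\<forall>i\<in>I. a k i = 0")
    case True
    obtain c where "\<forall>i\<in>I. c i \<in> D" "\<exists>i\<in>I. c i \<noteq> 0" "\<forall>k\<in>V. (\<Sum>i\<in>I. a k i * c i) = 0"
      using insert.IH[of I a] insert.prems insert.hyps by auto
    then show ?thesis using True by (intro exI[of _ c]) auto
  next
    case False
    then obtain j where j: "j \<in> I" "a k j \<noteq> 0" by blast
    let ?I = "I - {j}"
    define a' where "a' l i = a k j * a l i - a l j * a k i" for l i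
    have "card V < card ?I" using insert j by simp
    then obtain c where c: "\<forall>i\<in>?I. c i \<in> D" "\<exists>i\<in>?I. c i \<noteq> 0"
      "\<forall>l\<in>V. (\<Sum>i\<in>?I. a' l i * c i) = 0"
      using insert.IH[of ?I a'] insert.prems j by (auto simp: a'_def diff_in mult_in)
    \<comment> \<open>The solution of the reduced system is scaled by the pivot
      \<open>a k j\<close>, so that solving row \<open>k\<close> for the unknown \<open>j\<close>
      needs no division.\<close>
    define c' where "c' i = (if i = j then - (\<Sum>i\<in>?I. a k i * c i) else a k j * c i)" for i
    have split: "(\<Sum>i\<in>I. a l i * c' i) = a k j * (\<Sum>i\<in>?I. a l i * c i) - a l j * (\<Sum>i\<in>?I. a k i * c i)" for l
    proof -
      have "(\<Sum>i\<in>I. a l i * c' i) = a l j * c' j + (\<Sum>i\<in>?I. a l i * c' i)"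
        using insert.prems j by (subst sum.remove[of _ j]) auto
      also have "(\<Sum>i\<in>?I. a l i * c' i) = a k j * (\<Sum>i\<in>?I. a l i * c i)"
        by (simp add: c'_def sum_distrib_left algebra_simps)
      finally show ?thesis by (simp add: c'_def algebra_simps)
    qed
    have "(\<Sum>i\<in>I. a l i * c' i) = 0" if "l \<in> insert k V" for l
    proof (cases "l = k")
      case False
      then have "(\<Sum>i\<in>?I. a' l i * c i) = 0" using c that by auto
      then show ?thesis
        unfolding split by (simp add: a'_def sum_distrib_left sum_subtractf algebra_simps)
    qed (simp add: split)
    moreover have "c' i \<in> D" if "i \<in> I" for i
      using that c(1) insert.prems j by (auto simp: c'_def intro!: uminus_in sum_in mult_in)
    moreover obtain i where "i \<in> ?I" "c i \<noteq> 0" using c by blast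
    then have "i \<in> I" "c' i \<noteq> 0" using j by (auto simp: c'_def)
    ultimately show ?thesis by blast
  qed
qed

section \<open>Finitely generated modules over a subring, modulo a prime\<close>

text \<open>\<open>span_mod V\<close> is the \<open>D\<close>-module generated by \<open>V\<close>, modulo \<open>P\<close>; we think of \<open>D\<close> as a subring
  of the domain \<open>R/P\<close>.\<close>

locale transversal_subring = subring_set D + prime_set P for D P :: "'r::idom set" +
  assumes transversal: "D \<inter> P = {0}"
begin

lemma in_D_P: "a \<in> D \<Longrightarrow> a \<in> P \<Longrightarrow> a = 0"
  using transversal by blast

definition span_mod :: "'r set \<Rightarrow> 'r set" where
  "span_mod V = {x. \<exists>c. (\<forall>u\<in>V. c u \<in> D) \<and> x - (\<Sum>u\<in>V. c u * u) \<in> P}"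

lemma span_modI: "(\<And>u. u \<in> V \<Longrightarrow> c u \<in> D) \<Longrightarrow> x - (\<Sum>u\<in>V. c u * u) \<in> P \<Longrightarrow> x \<in> span_mod V"
  unfolding span_mod_def by blast

lemma span_mod_P: "x \<in> P \<Longrightarrow> x \<in> span_mod V"
  by (rule span_modI[of _ "\<lambda>_. 0"]) (simp_all add: zero_in)

lemma span_mod_base: "finite V \<Longrightarrow> u \<in> V \<Longrightarrow> u \<in> span_mod V"
  by (rule span_modI[of _ "\<lambda>w. if w = u then 1 else 0"])
    (auto simp: zero_in one_in zero_mem if_distrib[of "\<lambda>x. x * _"] cong: if_cong)

lemma span_mod_add: "x \<in> span_mod V \<Longrightarrow> y \<in> span_mod V \<Longrightarrow> x + y \<in> span_mod V"
proof -
  assume "x \<in> span_mod V" "y \<in> span_mod V"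
  then obtain c c' where c: "\<forall>u\<in>V. c u \<in> D" "x - (\<Sum>u\<in>V. c u * u) \<in> P"
    "\<forall>u\<in>V. c' u \<in> D" "y - (\<Sum>u\<in>V. c' u * u) \<in> P" unfolding span_mod_def by blast
  have "x + y - (\<Sum>u\<in>V. (c u + c' u) * u) = (x - (\<Sum>u\<in>V. c u * u)) + (y - (\<Sum>u\<in>V. c' u * u))"
    by (simp add: distrib_right sum.distrib)
  then have "x + y - (\<Sum>u\<in>V. (c u + c' u) * u) \<in> P"
    using add_mem[OF c(2,4)] by (simp only:)
  then show ?thesis
    using c by (intro span_modI[of V "\<lambda>u. c u + c' u"]) (auto intro: add_in)
qed

lemma span_mod_mult: "r \<in> D \<Longrightarrow> x \<in> span_mod V \<Longrightarrow> r * x \<in> span_mod V"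
proof -
  assume r: "r \<in> D" and "x \<in> span_mod V"
  then obtain c where c: "\<forall>u\<in>V. c u \<in> D" "x - (\<Sum>u\<in>V. c u * u) \<in> P"
    unfolding span_mod_def by blast
  have "r * x - (\<Sum>u\<in>V. (r * c u) * u) = r * (x - (\<Sum>u\<in>V. c u * u))"
    by (simp add: algebra_simps sum_distrib_left)
  then have "r * x - (\<Sum>u\<in>V. (r * c u) * u) \<in> P"
    using mult_mem[OF c(2)] by (simp only:)
  then show ?thesis
    using c r by (intro span_modI[of V "\<lambda>u. r * c u"]) (auto intro: mult_in)
qed

lemma span_mod_sum: "(\<And>i. i \<in> I \<Longrightarrow> f i \<in> span_mod V) \<Longrightarrow> sum f I \<in> span_mod V"
  by (induction I rule: infinite_finite_induct) (simp_all add: span_mod_P zero_mem span_mod_add)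

lemma span_mod_cong_P: "x \<in> span_mod V \<Longrightarrow> y - x \<in> P \<Longrightarrow> y \<in> span_mod V"
  using span_mod_add[OF span_mod_P[of "y - x" V]] by fastforce

lemma span_mod_trans:
  assumes "\<And>u. u \<in> V \<Longrightarrow> a * u \<in> span_mod V'" "x \<in> span_mod V"
  shows "a * x \<in> span_mod V'"
proof -
  obtain c where c: "\<forall>u\<in>V. c u \<in> D" "x - (\<Sum>u\<in>V. c u * u) \<in> P"
    using assms(2) unfolding span_mod_def by blast
  have 1: "(\<Sum>u\<in>V. c u * (a * u)) \<in> span_mod V'"
    using assms(1) c by (intro span_mod_sum) (auto intro: span_mod_mult)
  have "a * x - (\<Sum>u\<in>V. c u * (a * u)) = a * (x - (\<Sum>u\<in>V. c u * u))"
    by (simp add: algebra_simps sum_distrib_left)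
  then have "a * x - (\<Sum>u\<in>V. c u * (a * u)) \<in> P"
    using mult_mem[OF c(2)] by (simp only:)
  with 1 show ?thesis by (rule span_mod_cong_P)
qed

text \<open>Writing each \<open>y i\<close> in the generators gives one equation per generator and
  one unknown per \<open>y i\<close>, hence more unknowns than equations.\<close>

lemma span_mod_dependent:
  assumes "finite V" "finite I" "card V < card I" "\<And>i. i \<in> I \<Longrightarrow> y i \<in> span_mod V"
  shows "\<exists>c. (\<forall>i\<in>I. c i \<in> D) \<and> (\<exists>i\<in>I. c i \<noteq> 0) \<and> (\<Sum>i\<in>I. c i * y i) \<in> P"
proof -
  have "\<forall>i\<in>I. \<exists>c. (\<forall>u\<in>V. c u \<in> D) \<and> y i - (\<Sum>u\<in>V. c u * u) \<in> P"
    using assms(4) unfolding span_mod_def by blast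
  then obtain a where a: "\<And>i u. i \<in> I \<Longrightarrow> u \<in> V \<Longrightarrow> a i u \<in> D"
    "\<And>i. i \<in> I \<Longrightarrow> y i - (\<Sum>u\<in>V. a i u * u) \<in> P" by metis
  then obtain c where c: "\<forall>i\<in>I. c i \<in> D" "\<exists>i\<in>I. c i \<noteq> 0" "\<forall>u\<in>V. (\<Sum>i\<in>I. a i u * c i) = 0"
    using homogeneous_system_nontrivial[OF subring_set_axioms assms(1-3), of "\<lambda>u i. a i u"] by auto
  have "(\<Sum>i\<in>I. c i * (\<Sum>u\<in>V. a i u * u)) = (\<Sum>u\<in>V. (\<Sum>i\<in>I. a i u * c i) * u)"
    by (simp add: sum_distrib_left sum_distrib_right sum.swap[of _ I] algebra_simps)
  also have "\<dots> = 0" using c by simp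
  finally have "(\<Sum>i\<in>I. c i * y i) = (\<Sum>i\<in>I. c i * (y i - (\<Sum>u\<in>V. a i u * u)))"
    by (simp add: right_diff_distrib sum_subtractf)
  also have "\<dots> \<in> P" using a by (intro sum_mem mult_mem) auto
  finally show ?thesis using c by blast
qed

text \<open>Modulo \<open>P\<close>, the elements of \<open>W\<close> act on the module spanned by \<open>V\<close> after multiplication by \<open>d\<close>.\<close>

definition acts :: "'r \<Rightarrow> 'r set \<Rightarrow> 'r set \<Rightarrow> bool" where
  "acts d V W \<longleftrightarrow> d \<in> D \<and> d \<noteq> 0 \<and> finite V \<and> 1 \<in> V \<and> (\<forall>w\<in>W. \<forall>u\<in>V. d * w * u \<in> span_mod V)"

text \<open>The relation for \<open>w\<close> need not be monic. Multiplying by its leading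
  coefficient \<open>c e\<close> makes \<open>w ^ e\<close> expressible by lower powers, so the
  products \<open>u * w ^ i\<close> with \<open>i < e\<close> generate a module on which
  \<open>w\<close> acts too.\<close>

lemma acts_insert:
  assumes "acts d V W" and c: "\<And>i. c i \<in> D" "\<exists>i<k. c i \<noteq> 0" "(\<Sum>i<k. c i * w ^ i) \<in> P"
  shows "\<exists>d' V'. acts d' V' (insert w W)"
proof -
  define e where "e = Max {i. i < k \<and> c i \<noteq> 0}"
  have "e \<in> {i. i < k \<and> c i \<noteq> 0}" unfolding e_def using c(2) by (intro Max_in) auto
  then have e: "e < k" "c e \<noteq> 0" by auto
  have above: "c i = 0" if "e < i" "i < k" for i
  proof (rule ccontr)
    assume "c i \<noteq> 0"
    then have "i \<le> e" unfolding e_def using that by (intro Max_ge) auto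
    with that show False by simp
  qed
  have "(\<Sum>i<k. c i * w ^ i) = (\<Sum>i<Suc e. c i * w ^ i)"
    using e above by (intro sum.mono_neutral_right) auto
  then have rel: "c e * w ^ e + (\<Sum>i<e. c i * w ^ i) \<in> P"
    using c(3) by (simp add: add.commute)
  \<comment> \<open>A relation of degree 0 would be a nonzero element of \<open>D\<close> in
    \<open>P\<close>.\<close>
  have "e \<noteq> 0" using rel e in_D_P[OF c(1)] by (cases "e = 0") auto
  define V' where "V' = (\<lambda>(u, i). u * w ^ i) ` (V \<times> {..<e})"
  have V: "finite V" "1 \<in> V" "d \<in> D" "d \<noteq> 0"
    and act: "\<And>v u. v \<in> W \<Longrightarrow> u \<in> V \<Longrightarrow> d * v * u \<in> span_mod V"
    using assms(1) by (auto simp: acts_def)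
  have fin: "finite V'" using V by (simp add: V'_def)
  have base: "u * w ^ i \<in> span_mod V'" if "u \<in> V" "i < e" for u i
    using that fin by (intro span_mod_base) (auto simp: V'_def)
  have "d * c e * v * x \<in> span_mod V'" if v: "v \<in> insert w W" and x: "x \<in> V'" for v x
  proof -
    obtain u i where ui: "u \<in> V" "i < e" "x = u * w ^ i" using x by (auto simp: V'_def)
    show ?thesis
    proof (cases "v \<in> W")
      case True
      have "w ^ i * u' \<in> span_mod V'" if "u' \<in> V" for u'
        using base[OF that ui(2)] by (simp only: mult.commute)
      then have "w ^ i * (d * v * u) \<in> span_mod V'"
        using act[OF True ui(1)] by (rule span_mod_trans)
      then have "c e * (w ^ i * (d * v * u)) \<in> span_mod V'" by (rule span_mod_mult[OF c(1)])
      then show ?thesis by (simp add: ui algebra_simps)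
    next
      case False
      then have v: "v = w" using v by simp
      show ?thesis
      proof (cases "Suc i < e")
        case True
        have "(d * c e) * (u * w ^ Suc i) \<in> span_mod V'"
          using base[OF ui(1) True] V c by (intro span_mod_mult[of "d * c e"] mult_in)
        then show ?thesis by (simp add: ui v algebra_simps)
      next
        case False
        then have i: "Suc i = e" using ui by simp
        \<comment> \<open>At the top power the relation replaces \<open>c e * w ^ e\<close> by minus
          its lower terms.\<close>
        have "(\<Sum>j<e. (d * - c j) * (u * w ^ j)) \<in> span_mod V'"
          using base ui V c by (intro span_mod_sum span_mod_mult[of "d * - c _"] mult_in uminus_in) auto
        moreover have "d * c e * v * x - (\<Sum>j<e. (d * - c j) * (u * w ^ j)) =
            (d * u) * (c e * w ^ e + (\<Sum>j<e. c j * w ^ j))"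
          by (simp add: ui v sum_distrib_left sum_negf algebra_simps flip: i)
        then have "d * c e * v * x - (\<Sum>j<e. (d * - c j) * (u * w ^ j)) \<in> P"
          using mult_mem[OF rel] by (simp only:)
        ultimately show ?thesis by (rule span_mod_cong_P)
      qed
    qed
  qed
  moreover have "1 \<in> V'" using V \<open>e \<noteq> 0\<close> by (force simp: V'_def intro: image_eqI[of _ _ "(1, 0)"])
  ultimately have "acts (d * c e) V' (insert w W)"
    using V e c fin by (auto simp: acts_def mult_in)
  then show ?thesis by blast
qed

text \<open>Letting the power of \<open>d\<close> depend on \<open>f\<close> makes the multipliers a
  subring; whether it is everything can then be tested on ring generators.\<close>

lemma acts_ext:
  assumes "acts d V W"
  defines "A \<equiv> {f. \<exists>k. \<forall>x\<in>span_mod V. d ^ k * f * x \<in> span_mod V}"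
  shows "subring_set A" "D \<subseteq> A" "P \<subseteq> A" "W \<subseteq> A"
proof -
  have d: "d ^ k \<in> D" for k using assms(1) by (auto simp: acts_def power_in)
  show D: "D \<subseteq> A"
    unfolding A_def by (auto intro!: exI[of _ 0] simp: span_mod_mult)
  show "P \<subseteq> A"
  proof
    fix p assume "p \<in> P"
    then have "\<forall>x\<in>span_mod V. d ^ 0 * p * x \<in> span_mod V" by (simp add: span_mod_P mult_mem2)
    then show "p \<in> A" unfolding A_def by blast
  qed
  show "W \<subseteq> A"
  proof
    fix w assume "w \<in> W"
    then have "\<forall>x\<in>span_mod V. d ^ 1 * w * x \<in> span_mod V"
      using assms(1) by (auto simp: acts_def intro: span_mod_trans)
    then show "w \<in> A" unfolding A_def by blast
  qed
  show "subring_set A"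
  proof
    show "0 \<in> A" "1 \<in> A" using D zero_in one_in by auto
    fix a b assume "a \<in> A" "b \<in> A"
    then obtain k l where kl: "\<And>x. x \<in> span_mod V \<Longrightarrow> d ^ k * a * x \<in> span_mod V"
      "\<And>x. x \<in> span_mod V \<Longrightarrow> d ^ l * b * x \<in> span_mod V" by (auto simp: A_def)
    have "d ^ (k + l) * (a - b) * x \<in> span_mod V" if "x \<in> span_mod V" for x
    proof -
      have "d ^ l * (d ^ k * a * x) + (- (d ^ k)) * (d ^ l * b * x) \<in> span_mod V"
        using kl[OF that] d by (intro span_mod_add span_mod_mult[of "- _"] span_mod_mult[of "d ^ l"] uminus_in)
      then show ?thesis by (simp add: algebra_simps power_add)
    qed
    then show "a - b \<in> A" unfolding A_def by blast
    have "d ^ (k + l) * (a * b) * x \<in> span_mod V" if "x \<in> span_mod V" for x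
      using kl(1)[OF kl(2)[OF that]] by (simp add: algebra_simps power_add)
    then show "a * b \<in> A" unfolding A_def by blast
  qed
qed

text \<open>The module contains 1 and is stable under the multiplier, so it contains all its
  powers.\<close>

lemma acts_powers:
  assumes "acts d V W" "\<forall>x\<in>span_mod V. d ^ k * f * x \<in> span_mod V"
  shows "(d ^ k * f) ^ i \<in> span_mod V"
proof (induction i)
  case 0
  then show ?case using assms(1) by (auto simp: acts_def intro: span_mod_base)
qed (use assms(2) in simp)

text \<open>A maximal independent set of generators captures the whole module up to one common
  denominator \<open>c\<close>. Keeping 1 in \<open>U\<close> allows coefficients of 1 to be
  compared in \<open>prime_drop_variable\<close>.\<close>

lemma independent_generators:
  assumes "finite V" "1 \<in> V"
  obtains U c where "U \<subseteq> V" "1 \<in> U" "c \<in> D" "c \<noteq> 0" "\<forall>x\<in>span_mod V. c * x \<in> span_mod U"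
    "\<forall>b. (\<forall>u\<in>U. b u \<in> D) \<longrightarrow> (\<Sum>u\<in>U. b u * u) \<in> P \<longrightarrow> (\<forall>u\<in>U. b u = 0)"
proof -
  define indep where "indep U \<longleftrightarrow> (\<forall>b. (\<forall>u\<in>U. b u \<in> D) \<longrightarrow> (\<Sum>u\<in>U. b u * u) \<in> P \<longrightarrow> (\<forall>u\<in>U. b u = 0))" for U
  let ?F = "{U. U \<subseteq> V \<and> 1 \<in> U \<and> indep U}"
  have "{1} \<in> ?F" using assms in_D_P by (auto simp: indep_def)
  then obtain U where U: "U \<in> ?F" "\<And>U'. U' \<in> ?F \<Longrightarrow> U \<subseteq> U' \<Longrightarrow> U' = U"
    using finite_has_maximal[of ?F] assms(1) by (metis (no_types, lifting) empty_iff finite_Pow_iff finite_subset mem_Collect_eq PowI subsetI)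
  have finU: "finite U" using U assms finite_subset by auto
  have "\<exists>c. c \<in> D \<and> c \<noteq> 0 \<and> c * v \<in> span_mod U" if v: "v \<in> V" for v
  proof (cases "v \<in> U")
    case True
    then show ?thesis using span_mod_base[OF finU] one_in by (intro exI[of _ 1]) auto
  next
    case False
    then have "insert v U \<notin> ?F" using U by blast
    then obtain b where b: "\<forall>u\<in>insert v U. b u \<in> D" "(\<Sum>u\<in>insert v U. b u * u) \<in> P"
      "\<exists>u\<in>insert v U. b u \<noteq> 0" using U v unfolding indep_def by auto
    have sum: "b v * v + (\<Sum>u\<in>U. b u * u) \<in> P" using b(2) False finU by simp
    have "b v \<noteq> 0"
    proof
      assume "b v = 0"
      then have "\<forall>u\<in>U. b u = 0" using sum U b unfolding indep_def by auto
      then show False using b(3) \<open>b v = 0\<close> by auto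
    qed
    moreover have "b v * v \<in> span_mod U"
      using sum b by (intro span_modI[of _ "\<lambda>u. - b u"]) (auto simp: sum_negf intro: uminus_in)
    ultimately show ?thesis using b by blast
  qed
  then obtain c where c: "\<And>v. v \<in> V \<Longrightarrow> c v \<in> D \<and> c v \<noteq> 0 \<and> c v * v \<in> span_mod U" by metis
  have "(\<Prod>v\<in>V. c v) * u \<in> span_mod U" if "u \<in> V" for u
  proof -
    have "(\<Prod>v\<in>V. c v) = (\<Prod>v\<in>V - {u}. c v) * c u"
      using that assms(1) by (subst prod.remove[of V u]) (auto simp: algebra_simps)
    moreover have "(\<Prod>v\<in>V - {u}. c v) * (c u * u) \<in> span_mod U"
      using c that by (intro span_mod_mult[of "prod c _"] prod_in) auto
    ultimately show ?thesis by (simp only: mult.assoc)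
  qed
  then have "\<forall>x\<in>span_mod V. (\<Prod>v\<in>V. c v) * x \<in> span_mod U"
    using span_mod_trans by blast
  moreover have "(\<Prod>v\<in>V. c v) \<in> D" "(\<Prod>v\<in>V. c v) \<noteq> 0" using c assms(1) by (auto intro: prod_in)
  moreover have "U \<subseteq> V" "1 \<in> U" "indep U" using U(1) by auto
  ultimately show thesis using that[of U "\<Prod>v\<in>V. c v"] unfolding indep_def by blast
qed

end

section \<open>Transcendence bases consisting of variables, and prime chains\<close>

lemma prime_transversalI:
  "prime_set P \<Longrightarrow> polys B \<inter> P = {0} \<Longrightarrow> transversal_subring (polys B) P"
  by (intro transversal_subring.intro transversal_subring_axioms.intro subring_polys)

text \<open>\<open>B\<close> is a transcendence basis of the fraction field of the quotient by
  \<open>P\<close>, chosen among the variables, all but finitely many of which vanish modulo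
  \<open>P\<close>.\<close>

definition algebraic_mod :: "'v set \<Rightarrow> ('v::linorder, 'a::field) mpoly set \<Rightarrow> bool" where
  "algebraic_mod B P \<longleftrightarrow> finite {v. mvar v \<notin> P} \<and> polys B \<inter> P = {0} \<and> 
     (\<forall>v. v \<notin> B \<longrightarrow> polys (insert v B) \<inter> P \<noteq> {0})"

lemma algebraic_mod_acts:
  assumes "prime_set P" "algebraic_mod B P"
  obtains d V where "transversal_subring.acts (polys B) P d V {mvar v | v. v \<notin> B \<and> mvar v \<notin> P}"
proof -
  interpret transversal_subring "polys B" P
    using assms by (intro prime_transversalI) (auto simp: algebraic_mod_def)
  have "\<exists>d V. acts d V (mvar ` W)" if "finite W" "W \<inter> B = {}" for W
    using that
  proof (induction W)
    case empty
    show ?case by (intro exI[of _ 1] exI[of _ "{1}"]) (simp add: acts_def)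
  next
    case (insert w W)
    then obtain d V where dV: "acts d V (mvar ` W)" by blast
    have "polys (insert w B) \<inter> P \<noteq> {0}" using insert assms(2) by (auto simp: algebraic_mod_def)
    then obtain p where p: "p \<in> polys (insert w B)" "p \<in> P" "p \<noteq> 0" using zero_mem by auto
    obtain c k where c: "\<And>i. c i \<in> polys B" "p = (\<Sum>i<k. c i * mvar w ^ i)"
      using polys_insert_decomp[OF p(1)] by metis
    have "\<exists>i<k. c i \<noteq> 0"
    proof (rule ccontr)
      assume "\<not> ?thesis"
      then show False using p(3) c(2) by simp
    qed
    then show ?case using acts_insert[OF dV, of c k "mvar w"] c p by auto
  qed
  moreover have "finite {v. v \<notin> B \<and> mvar v \<notin> P}"
    using assms(2) by (auto simp: algebraic_mod_def)
  ultimately obtain d V where "acts d V (mvar ` {v. v \<notin> B \<and> mvar v \<notin> P})" by blast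
  then show thesis using that by (simp add: image_def setcompr_eq_image Collect_conj_eq)
qed

lemma subring_generated_by_variables:
  assumes "subring_set A" "range const \<subseteq> A" "range mvar \<subseteq> (A :: ('v, 'a::comm_ring_1) mpoly set)"
  shows "A = UNIV"
proof -
  interpret subring_set A by fact
  have "p \<in> A" for p
  proof (induction p rule: poly_mapping_single_induct)
    case (single m c)
    have "monom_at mvar m \<in> A" unfolding monom_at_def using assms(3) by (auto intro!: prod_in power_in)
    then show ?case using assms(2) by (subst single_eq_const_mult) (auto simp: monom_at_mvar intro!: mult_in)
  qed (rule add_in)
  then show ?thesis by blast
qed

text \<open>Modulo \<open>P\<close>, every polynomial becomes integral over \<open>polys B\<close>
  after multiplication by a power of one fixed \<open>d\<close>. The multipliers form a subring
  containing the constants and all variables: a variable lies in \<open>B\<close>, is zero modulo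
  \<open>P\<close>, or is algebraic over \<open>polys B\<close>.\<close>

lemma algebraic_mod_powers:
  assumes "prime_set P" "algebraic_mod B P"
  obtains d V where "d \<in> polys B" "d \<noteq> 0" "finite V" "1 \<in> V"
    "\<And>f. \<exists>k. \<forall>i. (d ^ k * f) ^ i \<in> transversal_subring.span_mod (polys B) P V"
proof -
  interpret transversal_subring "polys B" P
    using assms by (intro prime_transversalI) (auto simp: algebraic_mod_def)
  obtain d V where act: "acts d V {mvar v | v. v \<notin> B \<and> mvar v \<notin> P}"
    using algebraic_mod_acts[OF assms] by blast
  note ext = acts_ext[OF act]
  have mvarB: "mvar v \<in> polys B" if "v \<in> B" for v using that by (rule polys_mvar)
  have "{f. \<exists>k. \<forall>x\<in>span_mod V. d ^ k * f * x \<in> span_mod V} = UNIV"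
  proof (rule subring_generated_by_variables[OF ext(1)])
    show "range const \<subseteq> {f. \<exists>k. \<forall>x\<in>span_mod V. d ^ k * f * x \<in> span_mod V}"
      using ext(2) by (meson image_subsetI polys_const subsetD)
    show "range mvar \<subseteq> {f. \<exists>k. \<forall>x\<in>span_mod V. d ^ k * f * x \<in> span_mod V}"
      using subsetD[OF ext(2) mvarB] subsetD[OF ext(3)] subsetD[OF ext(4)] by fast
  qed
  then have "\<exists>k. \<forall>i. (d ^ k * f) ^ i \<in> span_mod V" for f
    using acts_powers[OF act] by blast
  then show thesis using that act unfolding acts_def by blast
qed

text \<open>An element of \<open>Q\<close> outside \<open>P\<close> is algebraic over
  \<open>polys B\<close> modulo \<open>P\<close>. Dividing its relation by the lowest occurring
  power leaves a nonzero constant term, which then lies in \<open>Q\<close>.\<close>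

lemma algebraic_mod_strict:
  assumes P: "prime_set P" and Q: "prime_set Q" "P \<subset> Q"
    and "algebraic_mod B P" "polys B \<inter> Q = {0}"
  shows False
proof -
  interpret P: transversal_subring "polys B" P
    using assms by (intro prime_transversalI) (auto simp: algebraic_mod_def)
  interpret Q: prime_set Q by fact
  obtain f where f: "f \<in> Q" "f \<notin> P" using Q by blast
  obtain d V k where d: "d \<in> polys B" "d \<noteq> 0" "finite V" "\<And>i. (d ^ k * f) ^ i \<in> P.span_mod V"
    using algebraic_mod_powers[OF P assms(4)] by metis
  define g where "g = d ^ k * f"
  have "d \<notin> P" using P.in_D_P d by blast
  then have g: "g \<in> Q" "g \<notin> P"
    using f P.prime_mem P.power_mem by (auto simp: g_def intro: Q.mult_mem)
  let ?n = "Suc (card V)"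
  obtain c where c: "\<forall>i\<in>{..<?n}. c i \<in> polys B" "\<exists>i\<in>{..<?n}. c i \<noteq> 0" "(\<Sum>i<?n. c i * g ^ i) \<in> P"
    using P.span_mod_dependent[of V "{..<?n}" "\<lambda>i. g ^ i"] d(3,4) by (auto simp: g_def)
  \<comment> \<open>The lowest index is taken because \<open>g ^ e\<close> is cancelled modulo
    \<open>P\<close>, which makes \<open>c e\<close> the constant term.\<close>
  define e where "e = (LEAST i. i < ?n \<and> c i \<noteq> 0)"
  have e: "e < ?n" "c e \<noteq> 0"
    unfolding e_def using LeastI_ex[of "\<lambda>i. i < ?n \<and> c i \<noteq> 0"] c(2) by auto
  have below: "c i = 0" if "i < e" for i
    using not_less_Least[of i "\<lambda>i. i < ?n \<and> c i \<noteq> 0"] that e by (auto simp: e_def)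
  define s where "s = (\<Sum>i\<in>{Suc e..<?n}. c i * g ^ (i - Suc e))"
  have "(\<Sum>i<?n. c i * g ^ i) = (\<Sum>i\<in>{e..<?n}. c i * g ^ i)"
    using below by (intro sum.mono_neutral_right) auto
  also have "\<dots> = c e * g ^ e + (\<Sum>i\<in>{Suc e..<?n}. c i * g ^ i)"
    using e by (subst sum.atLeast_Suc_lessThan) auto
  also have "(\<Sum>i\<in>{Suc e..<?n}. c i * g ^ i) = g ^ e * (g * s)"
    unfolding s_def sum_distrib_left by (intro sum.cong refl) (auto simp flip: power_add power_Suc simp: algebra_simps)
  finally have "g ^ e * (c e + g * s) \<in> P" using c(3) by (simp add: algebra_simps)
  then have "c e + g * s \<in> Q" using P.prime_mem P.power_mem g(2) Q(2) by blast
  then have "c e \<in> Q" using Q.mult_mem2[OF g(1)] Q.diff_mem[of "c e + g * s" "g * s"] by simp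
  then show False using assms(5) c e by auto
qed

lemma transversal_subset:
  assumes "prime_set P" "polys B \<inter> P = {0}" 
  shows "B \<subseteq> {v. mvar v \<notin> (P :: ('v, 'a::comm_ring_1) mpoly set)}"
proof
  fix v assume "v \<in> B"
  moreover have "mvar v \<noteq> (0 :: ('v, 'a) mpoly)" by (simp add: mvar_def single_zero_eq_iff)
  ultimately show "v \<in> {v. mvar v \<notin> P}" using assms(2) polys_mvar by fastforce
qed

text \<open>Induction from the upper end of the chain: variables independent modulo
  \<open>P 1\<close> cannot form a basis modulo the strictly smaller \<open>P 0\<close>, so one more
  variable can be added there.\<close>

theorem prime_chain_independent_variables:
  fixes P :: "nat \<Rightarrow> ('v::linorder, 'a::field) mpoly set"
  assumes "\<And>i. i \<le> d \<Longrightarrow> prime_set (P i)" "\<And>i. i < d \<Longrightarrow> P i \<subset> P (Suc i)"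
    and "finite {v. mvar v \<notin> P 0}"
  shows "\<exists>B. finite B \<and> d \<le> card B \<and> polys B \<inter> P 0 = {0}"
  using assms
proof (induction d arbitrary: P)
  case 0
  have "x = 0" if "x \<in> polys {}" "x \<in> P 0" for x
  proof (rule ccontr)
    assume "x \<noteq> 0"
    have keys: "keys x \<subseteq> {0}" using that(1) by (auto simp: polys_def)
    let ?c = "lookup x 0"
    have x: "x = const ?c"
      by (rule poly_mapping_eqI) (use keys in \<open>auto simp: lookup_single when_def in_keys_iff\<close>)
    then have "?c \<noteq> 0" using \<open>x \<noteq> 0\<close> by auto
    then have "const (inverse ?c) * x = 1" by (subst x) (simp add: mult_single)
    then show False
      using 0(1)[of 0] that(2) by (metis ideal_set.mult_mem le0 prime_set.axioms(1) prime_set.one_not_mem)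
  qed
  moreover have "0 \<in> P 0" using 0(1)[of 0] by (simp add: prime_set_def ideal_set.zero_mem)
  ultimately show ?case by (intro exI[of _ "{}"]) auto
next
  case (Suc d)
  have sub: "P 0 \<subset> P 1" using Suc.prems(2)[of 0] by simp
  have prime: "prime_set (P 0)" "prime_set (P 1)" using Suc.prems(1) by auto
  have "finite {v. mvar v \<notin> P 1}"
    by (rule finite_subset[OF _ Suc.prems(3)]) (use sub in auto)
  then obtain B where B: "finite B" "d \<le> card B" "polys B \<inter> P 1 = {0}"
    using Suc.IH[of "\<lambda>i. P (Suc i)"] Suc.prems(1,2) by auto
  have zero: "0 \<in> P 0" using prime(1) by (simp add: prime_set_def ideal_set.zero_mem)
  then have B0: "polys B \<inter> P 0 = {0}" using B(3) sub by auto
  have "\<not> algebraic_mod B (P 0)" using algebraic_mod_strict[OF prime sub] B(3) by blast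
  then obtain v where "v \<notin> B" "polys (insert v B) \<inter> P 0 = {0}"
    using B0 Suc.prems(3) by (auto simp: algebraic_mod_def)
  then show ?case using B by (intro exI[of _ "insert v B"]) auto
qed

text \<open>By the choice of \<open>q\<close> every \<open>y\<close> equals
  \<open>q * y - g * (d * y)\<close>, so a factor \<open>d\<close> can be cancelled from anything
  divisible by \<open>q\<close>; the powers follow by induction.\<close>

lemma dvd_power_of_coprime:
  fixes q :: "'r::idom"
  assumes "q = 1 + g * d" "q \<noteq> 0" "q ^ i dvd d ^ m * x"
  shows "q ^ i dvd x"
proof -
  have one: "q dvd y" if "q dvd d * y" for y
  proof -
    have "q dvd q * y - g * (d * y)" using dvd_mult[OF that, of g] by (intro dvd_diff) simp_all
    also have "q * y - g * (d * y) = y" by (simp add: assms(1) algebra_simps)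
    finally show ?thesis .
  qed
  have step: "q ^ i dvd y" if "q ^ i dvd d * y" for i y
    using that
  proof (induction i)
    case (Suc i)
    then have "q ^ i dvd y" by (auto intro: power_le_dvd)
    then obtain z where "y = q ^ i * z" by (elim dvdE)
    moreover from this Suc.prems have "q ^ i * q dvd q ^ i * (d * z)" by (simp add: algebra_simps)
    then have "q dvd d * z" using assms(2) by simp
    then have "q dvd z" by (rule one)
    ultimately show ?case by (simp add: mult_dvd_mono)
  qed simp
  show ?thesis using assms(3)
  proof (induction m)
    case (Suc m)
    have "q ^ i dvd d * (d ^ m * x)" using Suc.prems by (simp only: power_Suc mult.assoc)
    then show ?case by (rule Suc.IH[OF step])
  qed simp
qed

lemma lookup_lead_power:
  fixes p :: "('v::linorder, 'a::idom) mpoly"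
  assumes "p \<noteq> 0"
  shows "lookup (lead (p ^ k)) v = k * lookup (lead p) v"
proof (induction k)
  case 0
  have "lead (1 :: ('v, 'a) mpoly) = 0" by (rule lead_eqI) auto
  then show ?case by simp
qed (use assms in \<open>simp add: lead_mult lookup_add\<close>)

lemma zero_le_exponent: "(0 :: 'v::linorder \<Rightarrow>\<^sub>0 nat) \<le> m"
proof (rule leI)
  show "\<not> m < 0" by transfer (auto simp: less_fun_def)
qed

text \<open>
  Write \<open>D\<close> for \<open>polys B\<close> and work modulo \<open>N\<close>. Up to powers of \<open>d\<close>, all powers of a polynomial lie in one finitely generated
  \<open>D\<close>-module. If \<open>q = 1 + g d\<close> divided some \<open>s \<noteq> 0\<close> not involving \<open>g\<close>, then, as \<open>q\<close> and \<open>d\<close> are coprime,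
  \<open>q\<^sup>i\<close> would divide \<open>c s\<^sup>i\<close> in \<open>D\<close> for a fixed \<open>c\<close> and all \<open>i\<close>, which the degree in \<open>g\<close> forbids. So some
  prime ideal contains \<open>q\<close> and no such \<open>s\<close>.
\<close>

theorem prime_drop_variable:
  fixes N :: "('v::linorder, 'a::field) mpoly set"
  assumes N: "prime_set N" and alg: "algebraic_mod B N" and g: "g \<in> B"
  obtains P where "prime_set P" "N \<subset> P" "polys (B - {g}) \<inter> P = {0}"
proof -
  interpret transversal_subring "polys B" N
    using assms by (intro prime_transversalI) (auto simp: algebraic_mod_def)
  obtain d V where d: "d \<in> polys B" "d \<noteq> 0" and V: "finite V" "1 \<in> V"
    and pow: "\<And>f. \<exists>k. \<forall>i. (d ^ k * f) ^ i \<in> span_mod V"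
    using algebraic_mod_powers[OF N alg] by metis
  obtain U c where U: "U \<subseteq> V" "1 \<in> U" and c: "c \<in> polys B" "c \<noteq> 0"
    and span: "\<forall>x\<in>span_mod V. c * x \<in> span_mod U"
    and indep: "\<forall>b. (\<forall>u\<in>U. b u \<in> polys B) \<longrightarrow> (\<Sum>u\<in>U. b u * u) \<in> N \<longrightarrow> (\<forall>u\<in>U. b u = 0)"
    by (rule independent_generators[OF V])
  define q where "q = 1 + mvar g * d"
  have mg: "mvar g \<noteq> (0 :: ('v, 'a) mpoly)" by (simp add: mvar_def single_zero_eq_iff)
  have lead_mg: "lead (mvar g :: ('v, 'a) mpoly) = single g 1"
    by (rule lead_eqI) (auto simp: mvar_def)
  define l where "l = lead (mvar g * d)"
  have l: "l = single g 1 + lead d" unfolding l_def using mg d by (simp add: lead_mult lead_mg)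
  then have lg: "lookup l g \<ge> 1" by (simp add: lookup_add)
  have "lookup q l = lookup (mvar g * d) l"
  proof -
    have "l \<noteq> 0" using lg by auto
    then show ?thesis by (simp add: q_def lookup_add lookup_one when_def)
  qed
  also have "\<dots> \<noteq> 0"
    using lead_in_keys[of "mvar g * d"] mg d by (simp add: in_keys_iff l_def)
  finally have lq: "l \<in> keys q" by (simp add: in_keys_iff)
  then have q0: "q \<noteq> 0" by auto
  have lead_ge: "m \<le> lead p" if "m \<in> keys p" for m :: "'v \<Rightarrow>\<^sub>0 nat" and p :: "('v, 'a) mpoly"
    using that by (simp add: lead_def)
  have "lead q = l"
  proof (rule lead_eqI[OF lq])
    fix m assume "m \<in> keys q"
    then have "m \<in> keys (1 :: ('v, 'a) mpoly) \<or> m \<in> keys (mvar g * d)"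
      unfolding q_def using subsetD[OF keys_add] by (metis UnE)
    moreover have "0 \<le> l" by (rule zero_le_exponent)
    ultimately show "m \<le> l" unfolding l_def using lead_ge by auto
  qed
  have q: "q \<in> polys B" unfolding q_def using g d by (intro polys_add polys_mult polys_mvar) auto
  define S where "S = polys (B - {g}) - {0 :: ('v, 'a) mpoly}"
  define J where "J = {n + q * a | n a. n \<in> N}"
  have "ideal_set J"
  proof
    show "0 \<in> J" unfolding J_def using zero_mem by (force intro: exI[of _ 0])
    show "x + y \<in> J" if xy: "x \<in> J" "y \<in> J" for x y
    proof -
      obtain n a n' a' where "x = n + q * a" "n \<in> N" "y = n' + q * a'" "n' \<in> N"
        using xy by (auto simp: J_def)
      then have "x + y = (n + n') + q * (a + a')" "n + n' \<in> N" by (auto simp: algebra_simps add_mem)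
      then show ?thesis unfolding J_def by blast
    qed
    show "r * x \<in> J" if x: "x \<in> J" for x r
    proof -
      obtain n a where "x = n + q * a" "n \<in> N" using x by (auto simp: J_def)
      then have "r * x = r * n + q * (r * a)" "r * n \<in> N" by (auto simp: algebra_simps mult_mem2)
      then show ?thesis unfolding J_def by blast
    qed
  qed
  have "J \<inter> S = {}"
  proof (rule ccontr)
    assume "J \<inter> S \<noteq> {}"
    then obtain n a s where s: "s \<in> polys (B - {g})" "s \<noteq> 0" "s = n + q * a" "n \<in> N"
      by (auto simp: J_def S_def)
    have sB: "s \<in> polys B" using s(1) polys_mono[of "B - {g}" B] by blast
    obtain k where k: "\<And>i. (d ^ k * a) ^ i \<in> span_mod V" using pow by blast
    have dvd: "q ^ i dvd c * s ^ i" for i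
    proof -
      obtain b where b: "\<And>u. u \<in> U \<Longrightarrow> b u \<in> polys B" "c * (d ^ k * a) ^ i - (\<Sum>u\<in>U. b u * u) \<in> N"
        using bspec[OF span k[of i]] unfolding span_mod_def by blast
      have "s ^ i - (q * a) ^ i \<in> N"
      proof -
        have "s - q * a \<in> N" using s by simp
        moreover have "s - q * a dvd s ^ i - (q * a) ^ i"
          by (metis dvd_def power_diff_sumr2)
        ultimately show ?thesis using mult_mem2 by (elim dvdE) simp
      qed
      \<comment> \<open>Modulo \<open>N\<close>, \<open>c * (d ^ k) ^ i * s ^ i\<close> agrees with
        \<open>q ^ i\<close> times a combination of \<open>U\<close>. The difference is written as
        one combination of \<open>U\<close>, where the first term contributes to the coefficient of
        1; independence turns the congruence into an equality in \<open>polys B\<close>.\<close>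
      define b' where "b' u = (if u = 1 then c * (d ^ k) ^ i * s ^ i - q ^ i * b u else - (q ^ i * b u))" for u
      have finU: "finite U" using U V finite_subset by blast
      have "(\<Sum>u\<in>U. b' u * u) = c * (d ^ k) ^ i * s ^ i - q ^ i * (\<Sum>u\<in>U. b u * u)"
        using finU U by (subst (1 2) sum.remove[of U 1])
          (auto simp: b'_def algebra_simps sum_distrib_left sum_negf)
      also have "\<dots> = c * (d ^ k) ^ i * (s ^ i - (q * a) ^ i) + q ^ i * (c * (d ^ k * a) ^ i - (\<Sum>u\<in>U. b u * u))"
        by (simp add: algebra_simps power_mult_distrib)
      also have "\<dots> \<in> N" using b \<open>s ^ i - (q * a) ^ i \<in> N\<close> by (intro add_mem mult_mem)
      finally have "(\<Sum>u\<in>U. b' u * u) \<in> N" .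
      moreover have "b' u \<in> polys B" if "u \<in> U" for u
        using that b c d q sB by (auto simp: b'_def intro!: polys_diff polys_uminus polys_mult polys_power)
      ultimately have "b' 1 = 0" using indep U by blast
      then have "(d ^ k) ^ i * (c * s ^ i) = q ^ i * b 1" by (simp add: b'_def algebra_simps)
      then have "q ^ i dvd d ^ (k * i) * (c * s ^ i)" by (simp add: power_mult)
      then show ?thesis using dvd_power_of_coprime[OF q_def q0] by blast
    qed
    \<comment> \<open>One more than the exponent of \<open>g\<close> in \<open>lead c\<close>: the
      leading exponent of \<open>q ^ i * h\<close> has at least \<open>i\<close> at
      \<open>g\<close>, while \<open>s\<close> contributes nothing there.\<close>
    define i where "i = Suc (lookup (lead c) g)"
    obtain h where h: "c * s ^ i = q ^ i * h" using dvd[of i] by (elim dvdE)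
    have "h \<noteq> 0" using h c s by auto
    have "lookup (lead s) g = 0"
      using lead_in_keys[OF s(2)] s(1) by (force simp: polys_def in_keys_iff)
    then have "lookup (lead (c * s ^ i)) g = lookup (lead c) g"
      using c s by (simp add: lead_mult lookup_add lookup_lead_power)
    moreover have "lookup (lead (q ^ i * h)) g \<ge> i"
      using q0 \<open>h \<noteq> 0\<close> lg by (simp add: lead_mult lookup_add lookup_lead_power \<open>lead q = l\<close> trans_le_add1)
    ultimately show False using h by (simp add: i_def)
  qed
  moreover have "1 \<in> S" by (simp add: S_def)
  moreover have "x * y \<in> S" if "x \<in> S" "y \<in> S" for x y
    using that by (simp add: S_def polys_mult)
  ultimately obtain P where P: "prime_set P" "J \<subseteq> P" "P \<inter> S = {}"
    using prime_avoiding[OF \<open>ideal_set J\<close>, of S] by metis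
  have "N \<subseteq> J" unfolding J_def by (force intro: exI[of _ 0])
  moreover have "q \<in> J" unfolding J_def using zero_mem by (force intro: exI[of _ 0] exI[of _ 1])
  moreover have "q \<notin> N" using in_D_P q q0 by blast
  ultimately have "N \<subset> P" using P by blast
  moreover have "polys (B - {g}) \<inter> P = {0}"
    using P(3) \<open>N \<subset> P\<close> zero_mem by (auto simp: S_def)
  ultimately show thesis using that P by blast
qed

text \<open>\<open>prime_drop_variable\<close> needs a basis, so \<open>B\<close> is first enlarged
  to a maximal independent \<open>C\<close>. Dropping some \<open>g\<close> of \<open>B\<close> from
  \<open>C\<close> gives the next prime, modulo which \<open>B - {g}\<close> is still
  independent.\<close>

theorem independent_variables_prime_chain:
  fixes N :: "('v::linorder, 'a::field) mpoly set"
  assumes "prime_set N" "finite {v. mvar v \<notin> N}" "finite B" "polys B \<inter> N = {0}"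
  shows "\<exists>P. P 0 = N \<and> (\<forall>i. i \<le> card B \<longrightarrow> prime_set (P i)) \<and> (\<forall>i. i < card B \<longrightarrow> P i \<subset> P (Suc i))"
  using assms
proof (induction "card B" arbitrary: B N)
  case 0
  then show ?case by (intro exI[of _ "\<lambda>_. N"]) auto
next
  case (Suc k)
  let ?F = "{C. B \<subseteq> C \<and> polys C \<inter> N = {0}}"
  have fin: "finite ?F"
    by (rule finite_subset[of _ "Pow {v. mvar v \<notin> N}"])
      (use Suc.prems transversal_subset in auto)
  have "B \<in> ?F" using Suc.prems by simp
  then have "?F \<noteq> {}" by blast
  from finite_has_maximal[OF fin this]
  obtain C where "C \<in> ?F" "\<forall>C'\<in>?F. C \<subseteq> C' \<longrightarrow> C = C'" ..
  then have C: "C \<in> ?F" "\<And>C'. C' \<in> ?F \<Longrightarrow> C \<subseteq> C' \<Longrightarrow> C' = C" by blast+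
  have "algebraic_mod C N"
    unfolding algebraic_mod_def using C(1) C(2)[of "insert _ C"] Suc.prems by auto
  moreover obtain g where g: "g \<in> B" using Suc.hyps(2) by fastforce
  ultimately obtain P1 where P1: "prime_set P1" "N \<subset> P1" "polys (C - {g}) \<inter> P1 = {0}"
    using prime_drop_variable[OF Suc.prems(1)] C(1) by blast
  have "polys (B - {g}) \<subseteq> polys (C - {g})" using C by (intro polys_mono) auto
  then have "polys (B - {g}) \<inter> P1 = {0}" using P1(3) by force
  moreover have "finite {v. mvar v \<notin> P1}"
    using Suc.prems(2) P1 by (auto intro: finite_subset[of _ "{v. mvar v \<notin> N}"])
  moreover have "k = card (B - {g})" using Suc g by simp
  ultimately obtain P where P: "P 0 = P1" "\<forall>i\<le>k. prime_set (P i)" "\<forall>i<k. P i \<subset> P (Suc i)"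
    using Suc.hyps(1)[of "B - {g}" P1] P1(1) Suc.prems(3) by auto
  show ?case
    using P P1 Suc.prems(1) Suc.hyps(2)
    by (intro exI[of _ "case_nat N P"]) (auto simp: less_Suc_eq_0_disj le_Suc_eq split: nat.splits)
qed

section \<open>Valuation rings\<close>

text \<open>The valuation is carried by its ring alone: the value of a nonzero element is its class
  modulo units, and \<open>x\<close> has at least the value of \<open>y\<close> when
  \<open>x / y\<close> lies in the ring.\<close>

locale valuation_set = subring_set \<O> for \<O> :: "'k::field set" +
  assumes total: "x \<noteq> 0 \<Longrightarrow> x \<in> \<O> \<or> inverse x \<in> \<O>"
begin

definition unit :: "'k \<Rightarrow> bool" where
  "unit x \<longleftrightarrow> x \<noteq> 0 \<and> x \<in> \<O> \<and> inverse x \<in> \<O>"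

lemma unit_one: "unit 1"
  by (simp add: unit_def one_in)

lemma unit_nonzero: "unit x \<Longrightarrow> x \<noteq> 0"
  by (simp add: unit_def)

lemma unit_inverse: "unit x \<Longrightarrow> unit (inverse x)"
  by (simp add: unit_def)

lemma unit_mult: "unit x \<Longrightarrow> unit y \<Longrightarrow> unit (x * y)"
  by (simp add: unit_def mult_in)

lemma unit_power: "unit x \<Longrightarrow> unit (x ^ k)"
  by (induction k) (simp_all add: unit_one unit_mult)

lemma unit_powi: "unit x \<Longrightarrow> unit (x powi k)"
  by (cases "k \<ge> 0") (simp_all add: power_int_def unit_power unit_inverse)

lemma unit_prod: "(\<And>i. i \<in> I \<Longrightarrow> unit (f i)) \<Longrightarrow> unit (prod f I)"
  by (induction I rule: infinite_finite_induct) (simp_all add: unit_one unit_mult)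

lemma unit_mult_cancel: "unit x \<Longrightarrow> unit (x * y) \<longleftrightarrow> unit y"
proof
  assume x: "unit x" and "unit (x * y)"
  then have "unit (inverse x * (x * y))" by (intro unit_mult[of "inverse x"] unit_inverse)
  moreover have "inverse x * (x * y) = y" using unit_nonzero[OF x] by (simp flip: mult.assoc)
  ultimately show "unit y" by simp
qed (rule unit_mult)

lemma unit_factor:
  assumes "x \<in> \<O>" "y \<in> \<O>" "unit (x * y)"
  shows "unit x"
proof -
  have "y * inverse (x * y) \<in> \<O>" using assms by (simp add: unit_def mult_in)
  moreover have nz: "x \<noteq> 0" "y \<noteq> 0" using unit_nonzero[OF assms(3)] by auto
  moreover have "y * inverse (x * y) = inverse x" using nz by (simp add: field_simps)
  ultimately show ?thesis using assms(1) unfolding unit_def by metis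
qed

text \<open>A valuation ring is local: if \<open>x / y\<close> lies in the ring, then
  \<open>x - y\<close> is \<open>y\<close> times a ring element, so it is a unit only if
  \<open>y\<close> is.\<close>

lemma nonunit_diff:
  assumes "x \<in> \<O>" "y \<in> \<O>" "\<not> unit x" "\<not> unit y"
  shows "\<not> unit (x - y)"
proof
  assume u: "unit (x - y)"
  have aux: "unit b" if "a \<in> \<O>" "b \<in> \<O>" "b \<noteq> 0" "a / b \<in> \<O>" "unit (a - b)" for a b
  proof -
    have "a - b = b * (a / b - 1)" using that(3) by (simp add: algebra_simps)
    then show ?thesis using that by (intro unit_factor[of b "a / b - 1"]) (auto intro: diff_in one_in)
  qed
  show False
  proof (cases "x = 0 \<or> y = 0")
    case True
    have "unit (- 1)" using one_in uminus_in by (simp add: unit_def)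
    then show ?thesis using True u assms unit_mult[of "-1" "x - y"] by auto
  next
    case False
    then have "x / y \<in> \<O> \<or> y / x \<in> \<O>" using total[of "x / y"] by simp
    moreover have "unit (y - x)"
      using u uminus_in one_in unit_mult[of "-1" "x - y"] by (simp add: unit_def)
    ultimately show False using aux[of x y] aux[of y x] u assms False by auto
  qed
qed

lemma exists_least_value:
  assumes "finite Z" "Z \<noteq> {}" "0 \<notin> Z"
  shows "\<exists>z\<in>Z. \<forall>w\<in>Z. w / z \<in> \<O>"
  using assms
proof (induction Z rule: finite_ne_induct)
  case (singleton z)
  then show ?case by (simp add: one_in)
next
  case (insert y Z)
  then obtain z where z: "z \<in> Z" "\<forall>w\<in>Z. w / z \<in> \<O>" by auto
  show ?case
  proof (cases "y / z \<in> \<O>")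
    case True
    then show ?thesis using z by auto
  next
    case False
    have nz: "y \<noteq> 0" "z \<noteq> 0" using insert.prems z by auto
    then have "z / y \<in> \<O>" using total[of "y / z"] False by simp
    moreover have "w / y = (w / z) * (z / y)" for w using nz by simp
    ultimately have "\<forall>w\<in>Z. w / y \<in> \<O>" using z mult_in by metis
    then show ?thesis using nz one_in by (intro bexI[of _ y]) auto
  qed
qed

end

text \<open>The ideal generated by \<open>P\<close> in \<open>B\<close>, as finite sums, with the
  ring kept as a parameter because it grows along chains and by adjunction.\<close>

inductive_set pspan :: "'r::comm_ring_1 set \<Rightarrow> 'r set \<Rightarrow> 'r set" for B P where
  pspan_zero: "0 \<in> pspan B P"
| pspan_step: "b \<in> B \<Longrightarrow> p \<in> P \<Longrightarrow> s \<in> pspan B P \<Longrightarrow> b * p + s \<in> pspan B P"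

lemma pspan_add: "s \<in> pspan B P \<Longrightarrow> s' \<in> pspan B P \<Longrightarrow> s + s' \<in> pspan B P"
  by (induction rule: pspan.induct) (auto simp: add.assoc intro: pspan.intros)

lemma pspan_sum: "(\<And>i. i \<in> I \<Longrightarrow> f i \<in> pspan B P) \<Longrightarrow> sum f I \<in> pspan B P"
  by (induction I rule: infinite_finite_induct) (auto intro: pspan_add pspan_zero)

lemma pspan_subset:
  assumes "subring_set B" "P \<subseteq> B"
  shows "s \<in> pspan B P \<Longrightarrow> s \<in> B"
  by (induction rule: pspan.induct)
    (use assms in \<open>auto intro: subring_set.zero_in subring_set.add_in subring_set.mult_in\<close>)

lemma pspan_mult:
  assumes "subring_set B" "b \<in> B"
  shows "s \<in> pspan B P \<Longrightarrow> b * s \<in> pspan B P"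
proof (induction rule: pspan.induct)
  case (pspan_step c p s)
  then have "(b * c) * p + b * s \<in> pspan B P"
    using assms by (intro pspan.pspan_step) (auto intro: subring_set.mult_in)
  then show ?case by (simp add: algebra_simps)
qed (simp add: pspan_zero)

text \<open>A member involves only finitely many coefficients, all of which lie in one ring of the
  chain.\<close>

lemma pspan_chain:
  assumes "s \<in> pspan (\<Union>\<C>) P" "\<C> \<noteq> {}" "\<And>B B'. B \<in> \<C> \<Longrightarrow> B' \<in> \<C> \<Longrightarrow> B \<subseteq> B' \<or> B' \<subseteq> B"
  shows "\<exists>B\<in>\<C>. s \<in> pspan B P"
  using assms(1)
proof (induction rule: pspan.induct)
  case (pspan_step b p s)
  have mono: "t \<in> pspan B' P" if "t \<in> pspan B P" "B \<subseteq> B'" for t B B'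
    using that by (induction rule: pspan.induct) (auto intro: pspan.intros)
  obtain B B' where "B \<in> \<C>" "b \<in> B" "B' \<in> \<C>" "s \<in> pspan B' P" using pspan_step by blast
  then show ?case using assms(3)[of B B'] pspan_step(2) mono by (meson pspan.pspan_step subsetD)
qed (use assms(2) in \<open>auto intro: pspan_zero\<close>)

definition adjoin :: "'r::comm_ring_1 set \<Rightarrow> 'r \<Rightarrow> 'r set" where
  "adjoin B x = {poly f x | f. \<forall>i. coeff f i \<in> B}"

lemma subring_adjoin:
  assumes "subring_set B"
  shows "subring_set (adjoin B x)"
proof -
  interpret subring_set B by fact
  show ?thesis
  proof
    show "0 \<in> adjoin B x" unfolding adjoin_def by (force intro: exI[of _ 0] zero_in)
    show "1 \<in> adjoin B x" unfolding adjoin_def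
      by (auto simp: zero_in one_in coeff_1 intro!: exI[of _ 1])
    fix a b assume "a \<in> adjoin B x" "b \<in> adjoin B x"
    then obtain f g where fg: "a = poly f x" "\<forall>i. coeff f i \<in> B" "b = poly g x" "\<forall>i. coeff g i \<in> B"
      unfolding adjoin_def by blast
    show "a - b \<in> adjoin B x" unfolding adjoin_def
      using fg by (auto intro!: exI[of _ "f - g"] diff_in)
    show "a * b \<in> adjoin B x" unfolding adjoin_def
      using fg by (auto intro!: exI[of _ "f * g"] sum_in mult_in simp: coeff_mult)
  qed
qed

lemma adjoin_base: "subring_set B \<Longrightarrow> B \<subseteq> adjoin B x"
proof
  fix b assume B: "subring_set B" "b \<in> B"
  interpret subring_set B by fact
  have "\<forall>i. coeff [:b:] i \<in> B" using B by (auto simp: coeff_pCons zero_in split: nat.splits)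
  then show "b \<in> adjoin B x" unfolding adjoin_def by (auto intro!: exI[of _ "[:b:]"])
qed

lemma adjoin_gen: "subring_set B \<Longrightarrow> x \<in> adjoin B x"
proof -
  assume B: "subring_set B"
  interpret subring_set B by fact
  have "\<forall>i. coeff [:0, 1:] i \<in> B" by (auto simp: coeff_pCons zero_in one_in split: nat.splits)
  then show "x \<in> adjoin B x" unfolding adjoin_def by (auto intro!: exI[of _ "[:0, 1:]"])
qed

lemma pspan_adjoin:
  assumes "subring_set B"
  shows "s \<in> pspan (adjoin B x) P \<Longrightarrow> \<exists>f. (\<forall>i. coeff f i \<in> pspan B P) \<and> s = poly f x"
proof (induction rule: pspan.induct)
  case pspan_zero
  show ?case by (intro exI[of _ 0]) (simp add: pspan.pspan_zero)
next
  case (pspan_step b p s)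
  then obtain f g where "\<forall>i. coeff f i \<in> pspan B P" "s = poly f x" "\<forall>i. coeff g i \<in> B" "b = poly g x"
    unfolding adjoin_def by blast
  then show ?case using pspan_step(2)
    by (intro exI[of _ "smult p g + f"]) (auto simp: mult.commute[of p] intro: pspan.pspan_step)
qed

text \<open>A subring maximal among those in which the fixed set \<open>P\<close> does not generate the unit ideal is
  automatically local and a valuation ring.\<close>

theorem valuation_ring_exists:
  fixes A :: "'k::field set"
  assumes A: "subring_set A" "P \<subseteq> A" "1 \<notin> pspan A P"
  obtains V where "valuation_set V" "A \<subseteq> V" "\<And>p. p \<in> P \<Longrightarrow> p \<noteq> 0 \<Longrightarrow> inverse p \<notin> V"
proof -
  define \<A> where "\<A> = {B. subring_set B \<and> A \<subseteq> B \<and> 1 \<notin> pspan B P}"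
  have "A \<in> \<A>" using A by (simp add: \<A>_def)
  moreover have "\<Union>\<C> \<in> \<A>" if C: "\<C> \<noteq> {}" "subset.chain \<A> \<C>" for \<C>
  proof -
    have sub: "B \<in> \<C> \<Longrightarrow> subring_set B \<and> A \<subseteq> B \<and> 1 \<notin> pspan B P" for B
      using C(2) by (auto simp: subset.chain_def \<A>_def)
    have chain: "B \<in> \<C> \<Longrightarrow> B' \<in> \<C> \<Longrightarrow> B \<subseteq> B' \<or> B' \<subseteq> B" for B B'
      using C(2) by (auto simp: subset.chain_def)
    have "subring_set (\<Union>\<C>)"
    proof
      show "0 \<in> \<Union>\<C>" using C(1) sub subring_set.zero_in by blast
      show "1 \<in> \<Union>\<C>" using C(1) sub subring_set.one_in by blast
      fix a b assume "a \<in> \<Union>\<C>" "b \<in> \<Union>\<C>"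
      then obtain B where B: "B \<in> \<C>" "a \<in> B" "b \<in> B" using chain by blast
      then show "a - b \<in> \<Union>\<C>" "a * b \<in> \<Union>\<C>"
        using sub subring_set.diff_in subring_set.mult_in by blast+
    qed
    moreover have "1 \<notin> pspan (\<Union>\<C>) P"
    proof
      assume "1 \<in> pspan (\<Union>\<C>) P"
      from pspan_chain[OF this C(1) chain] show False using sub by blast
    qed
    ultimately show ?thesis using C(1) sub by (auto simp: \<A>_def)
  qed
  ultimately obtain V where V: "V \<in> \<A>" "\<And>B. B \<in> \<A> \<Longrightarrow> V \<subseteq> B \<Longrightarrow> B = V"
    using subset_Zorn_nonempty[of \<A>] by blast
  interpret subring_set V using V(1) by (simp add: \<A>_def)
  have PV: "P \<subseteq> V" using V(1) A(2) by (auto simp: \<A>_def)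
  define M where "M = pspan V P"
  have M: "1 \<notin> M" "M \<subseteq> V" using V(1) pspan_subset[OF subring_set_axioms PV] by (auto simp: \<A>_def M_def)
  have M_add: "a + b \<in> M" if "a \<in> M" "b \<in> M" for a b using that by (simp add: M_def pspan_add)
  have M_mult: "a * b \<in> M" if "a \<in> V" "b \<in> M" for a b
    using that by (simp add: M_def pspan_mult subring_set_axioms)
  have M_sum: "sum f I \<in> M" if "\<And>i. i \<in> I \<Longrightarrow> f i \<in> M" for f and I :: "nat set"
    using that by (simp add: M_def pspan_sum)
  have M_zero: "0 \<in> M" by (simp add: M_def pspan_zero)
  \<comment> \<open>By maximality, adjoining \<open>x\<close> makes \<open>P\<close> generate 1;
    sorted by powers of \<open>x\<close>, this is an equation for \<open>x\<close> with coefficients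
    in \<open>M\<close>.\<close>
  have ext: "\<exists>f. (\<forall>i. coeff f i \<in> M) \<and> 1 = poly f x" if "x \<notin> V" for x
  proof -
    have "adjoin V x \<noteq> V" using that adjoin_gen[OF subring_set_axioms] by blast
    then have "adjoin V x \<notin> \<A>" using V(2) adjoin_base[OF subring_set_axioms] by blast
    then have "1 \<in> pspan (adjoin V x) P"
      using subring_adjoin[OF subring_set_axioms] adjoin_base[OF subring_set_axioms, of x] V(1)
      by (auto simp: \<A>_def)
    from pspan_adjoin[OF subring_set_axioms this] show ?thesis by (auto simp: M_def)
  qed
  \<comment> \<open>Clearing denominators in the equation for the inverse puts a power of
    \<open>1 - u\<close> into \<open>M\<close>, but every such power is congruent to 1 modulo
    \<open>M\<close>.\<close>
  have local: "inverse (1 - u) \<in> V" if u: "u \<in> M" for u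
  proof (rule ccontr)
    let ?s = "1 - u"
    assume "inverse ?s \<notin> V"
    then obtain f where f: "\<forall>i. coeff f i \<in> M" "1 = poly f (inverse ?s)" using ext by blast
    have s: "?s \<noteq> 0" "?s \<in> V" using u M by (auto intro: diff_in one_in)
    let ?n = "Polynomial.degree f"
    have "?s ^ ?n = (\<Sum>i\<le>?n. coeff f i * inverse ?s ^ i) * ?s ^ ?n"
      using f(2) by (simp add: poly_altdef)
    also have "\<dots> = (\<Sum>i\<le>?n. ?s ^ (?n - i) * coeff f i)"
      unfolding sum_distrib_right using s(1)
      by (intro sum.cong refl) (simp add: power_diff field_simps power_inverse)
    also have "\<dots> \<in> M" using f s by (intro M_sum M_mult power_in) auto
    finally have "?s ^ ?n \<in> M" .
    moreover have "1 - ?s ^ k \<in> M" for k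
    proof (induction k)
      case (Suc k)
      have "1 - ?s ^ Suc k = ?s * (1 - ?s ^ k) + u" by (simp add: algebra_simps)
      also have "\<dots> \<in> M" using Suc u s by (intro M_add M_mult)
      finally show ?case .
    qed (simp add: M_zero)
    ultimately have "(1 - ?s ^ ?n) + ?s ^ ?n \<in> M" by (intro M_add)
    then show False using M(1) by simp
  qed
  \<comment> \<open>The equation for the inverse of \<open>x\<close> has constant term in
    \<open>M\<close>, so \<open>1 - coeff g 0\<close> is invertible in \<open>V\<close>. Multiplied
    by a power of \<open>x\<close>, the equation expresses the top power of \<open>x\<close> in
    \<open>f\<close> by lower ones, with coefficients in \<open>M\<close>.\<close>
  have reduce: "\<exists>f'. (\<forall>i. coeff f' i \<in> M) \<and> 1 = poly f' x \<and> Polynomial.degree f' < Polynomial.degree f"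
    if x: "x \<noteq> 0" and f: "\<forall>i. coeff f i \<in> M" "1 = poly f x"
      and g: "\<forall>i. coeff g i \<in> M" "1 = poly g (inverse x)"
      and le: "Polynomial.degree g \<le> Polynomial.degree f" for x f g
  proof -
    let ?n = "Polynomial.degree f" and ?m = "Polynomial.degree g"
    have n: "?n > 0"
    proof (rule ccontr)
      assume "\<not> ?n > 0"
      then have "poly f x = coeff f 0" by (simp add: poly_altdef)
      then show False using f M(1) by metis
    qed
    define s where "s = 1 - coeff g 0"
    have "coeff g 0 \<noteq> 1" using g(1) M(1) by metis
    then have s: "s \<noteq> 0" "inverse s \<in> V" using g(1) local by (auto simp: s_def)
    have "1 = coeff g 0 + (\<Sum>j=1..?m. coeff g j * inverse x ^ j)"
      using g(2) by (simp add: poly_altdef sum.atMost_shift atMost_atLeast0 sum.atLeast_Suc_atMost)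
    then have "s = (\<Sum>j=1..?m. coeff g j * inverse x ^ j)" unfolding s_def by (simp only: diff_eq_eq add.commute)
    then have "x ^ ?n * s = (\<Sum>j=1..?m. coeff g j * x ^ (?n - j))"
      using x le by (simp add: sum_distrib_left power_diff field_simps power_inverse)
    then have xn: "x ^ ?n = (\<Sum>j=1..?m. (inverse s * coeff g j) * x ^ (?n - j))"
      using s by (simp add: sum_distrib_left mult.assoc flip: sum_distrib_left) (simp add: field_simps)
    define h where "h = (\<Sum>j=1..?m. monom (inverse s * coeff g j) (?n - j))"
    have h: "poly h x = x ^ ?n" unfolding xn h_def by (simp add: poly_sum poly_monom)
    have hM: "coeff h i \<in> M" for i
      unfolding h_def coeff_sum using s g M_zero by (intro M_sum) (auto intro: M_mult)
    have "Polynomial.degree h \<le> ?n - 1"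
      unfolding h_def by (intro degree_sum_le) (auto intro: order_trans[OF degree_monom_le])
    then have hdeg: "Polynomial.degree h < ?n" using n by simp
    define f1 where "f1 = f - monom (coeff f ?n) ?n"
    have f1M: "coeff f1 i \<in> M" for i using f(1) M_zero by (simp add: f1_def)
    have f1deg: "Polynomial.degree f1 < ?n"
      using n by (intro degree_lessI) (auto simp: f1_def coeff_eq_0)
    let ?f' = "f1 + smult (coeff f ?n) h"
    have "poly ?f' x = poly f x" by (simp add: f1_def h poly_monom)
    moreover have "Polynomial.degree ?f' < ?n"
      using f1deg hdeg by (intro degree_add_less) (auto intro: le_less_trans[OF degree_smult_le])
    moreover have "coeff ?f' i \<in> M" for i
      using f1M hM f(1) M(2) by (auto intro!: M_add M_mult)
    ultimately show ?thesis using f(2) by metis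
  qed
  have "valuation_set V"
  proof
    fix x :: 'k assume x: "x \<noteq> 0"
    show "x \<in> V \<or> inverse x \<in> V"
    proof (rule ccontr)
      assume neg: "\<not> ?thesis"
      define good where "good y n \<longleftrightarrow> (\<exists>f. (\<forall>i. coeff f i \<in> M) \<and> 1 = poly f y \<and> Polynomial.degree f = n)" for y n
      have ex: "\<exists>n. good x n" "\<exists>n. good (inverse x) n"
        using ext[of x] ext[of "inverse x"] neg unfolding good_def by blast+
      \<comment> \<open>Both degrees are minimal, so whichever equation has the larger one
        contradicts \<open>reduce\<close>.\<close>
      define n m where "n = (LEAST n. good x n)" and "m = (LEAST n. good (inverse x) n)"
      obtain f where f: "\<forall>i. coeff f i \<in> M" "1 = poly f x" "Polynomial.degree f = n"
        using LeastI_ex[OF ex(1)] unfolding good_def n_def by blast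
      obtain g where g: "\<forall>i. coeff g i \<in> M" "1 = poly g (inverse x)" "Polynomial.degree g = m"
        using LeastI_ex[OF ex(2)] unfolding good_def m_def by blast
      have min: "n \<le> k" if "good x k" for k using that unfolding n_def by (rule Least_le)
      have min': "m \<le> k" if "good (inverse x) k" for k using that unfolding m_def by (rule Least_le)
      show False
      proof (cases "m \<le> n")
        case True
        then have "Polynomial.degree g \<le> Polynomial.degree f" by (simp add: f g)
        from reduce[OF x f(1,2) g(1,2) this] obtain f' where
          "\<forall>i. coeff f' i \<in> M" "1 = poly f' x" "Polynomial.degree f' < n" unfolding f(3) by metis
        then show False using min[of "Polynomial.degree f'"] unfolding good_def by force
      next
        case False
        have ix: "inverse x \<noteq> 0" "1 = poly f (inverse (inverse x))" using x f(2) by simp_all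
        have "Polynomial.degree f \<le> Polynomial.degree g" using False by (simp add: f g)
        from reduce[OF ix(1) g(1,2) f(1) ix(2) this] obtain f' where
          "\<forall>i. coeff f' i \<in> M" "1 = poly f' (inverse x)" "Polynomial.degree f' < m" unfolding g(3) by metis
        then show False using min'[of "Polynomial.degree f'"] unfolding good_def by force
      qed
    qed
  qed
  moreover have "inverse p \<notin> V" if "p \<in> P" "p \<noteq> 0" for p
  proof
    assume "inverse p \<in> V"
    then have "inverse p * p + 0 \<in> M" unfolding M_def by (intro pspan.intros that)
    then show False using M(1) that by simp
  qed
  ultimately show thesis using that V(1) by (auto simp: \<A>_def)
qed

section \<open>Laurent monomials and a valuation that separates them\<close>

definition laurent_at :: "('v \<Rightarrow> 'k::field) \<Rightarrow> ('v \<Rightarrow>\<^sub>0 int) \<Rightarrow> 'k" where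
  "laurent_at t m = (\<Prod>v\<in>keys m. t v powi lookup m v)"

lemma laurent_at_superset:
  assumes "finite B" "keys m \<subseteq> B"
  shows "laurent_at t m = (\<Prod>v\<in>B. t v powi lookup m v)"
  unfolding laurent_at_def using assms by (intro prod.mono_neutral_left) (auto simp: in_keys_iff)

lemma laurent_at_add:
  assumes "\<And>v. t v \<noteq> 0"
  shows "laurent_at t (m + m') = laurent_at t m * laurent_at t m'"
proof -
  let ?B = "keys m \<union> keys m'"
  have "keys (m + m') \<subseteq> ?B" by (rule keys_add)
  then show ?thesis
    by (simp add: laurent_at_superset[of ?B] lookup_add power_int_add assms prod.distrib)
qed

lemma laurent_at_zero [simp]: "laurent_at t 0 = 1"
  by (simp add: laurent_at_def)

lemma lookup_map_nat: "lookup (Poly_Mapping.map nat m) v = nat (lookup m v)"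
  by transfer (simp add: when_def)

text \<open>Multiplying by the monomial with exponents \<open>N\<close>, which dominate all absolute
  exponents in \<open>q\<close>, turns a Laurent relation into a polynomial one without identifying
  monomials.\<close>

lemma laurent_independent:
  fixes t :: "'v \<Rightarrow> 'k::field" and h :: "'a::field \<Rightarrow> 'k"
  assumes h: "h 0 = 0" and t: "\<And>v. t v \<noteq> 0"
    and indep: "\<And>p. p \<in> polys B \<Longrightarrow> lin_ext h (monom_at t) p = 0 \<Longrightarrow> p = 0"
    and hadd: "\<And>a b. h (a + b) = h a + h b"
    and q: "\<And>m. m \<in> keys q \<Longrightarrow> keys m \<subseteq> B" "lin_ext h (laurent_at t) q = 0"
  shows "q = 0"
proof -
  define M where "M = keys q"
  define N where "N = (\<Sum>m\<in>M. Poly_Mapping.map abs m)"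
  have lookup_abs: "lookup (Poly_Mapping.map abs m) v = \<bar>lookup m v\<bar>" for m :: "'v \<Rightarrow>\<^sub>0 int" and v
    by transfer (simp add: when_def)
  have finM: "finite M" by (simp add: M_def)
  have nonneg: "lookup (m + N) v \<ge> 0" if "m \<in> M" for m v
  proof -
    have "lookup N v = \<bar>lookup m v\<bar> + (\<Sum>m\<in>M - {m}. \<bar>lookup m v\<bar>)"
      unfolding N_def lookup_sum lookup_abs using that finM by (subst sum.remove[of M m]) auto
    moreover have "(\<Sum>m\<in>M - {m}. \<bar>lookup m v\<bar>) \<ge> 0" by (simp add: sum_nonneg)
    ultimately show ?thesis unfolding lookup_add by linarith
  qed
  have keysN: "keys N \<subseteq> B"
  proof
    fix v assume "v \<in> keys N"
    then have "\<exists>m\<in>M. \<bar>lookup m v\<bar> \<noteq> 0"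
      unfolding in_keys_iff N_def lookup_sum lookup_abs using sum.not_neutral_contains_not_neutral by blast
    then obtain m where "m \<in> M" "v \<in> keys m" by (auto simp: in_keys_iff)
    then show "v \<in> B" using q(1) by (auto simp: M_def)
  qed
  define n where "n m = Poly_Mapping.map nat (m + N)" for m
  have inj: "inj_on n M"
  proof
    fix m m' assume m: "m \<in> M" "m' \<in> M" "n m = n m'"
    have "lookup m v = lookup m' v" for v
    proof -
      have "nat (lookup (m + N) v) = nat (lookup (m' + N) v)"
        using m(3) unfolding n_def by (metis lookup_map_nat)
      then show ?thesis using nonneg[OF m(1), of v] nonneg[OF m(2), of v] by (simp add: lookup_add)
    qed
    then show "m = m'" by (rule poly_mapping_eqI)
  qed
  have mon: "monom_at t (n m) = laurent_at t m * laurent_at t N" if "m \<in> M" for m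
  proof -
    have keys: "keys (n m) = keys (m + N)"
    proof (intro equalityI subsetI)
      fix v assume "v \<in> keys (m + N)"
      then show "v \<in> keys (n m)"
        using nonneg[OF that, of v] by (simp add: n_def in_keys_iff lookup_map_nat)
    qed (auto simp: n_def in_keys_iff lookup_map_nat)
    have "monom_at t (n m) = laurent_at t (m + N)"
      unfolding monom_at_def laurent_at_def keys
      using nonneg[OF that] by (intro prod.cong refl) (simp add: n_def lookup_map_nat power_int_def)
    then show ?thesis using t by (simp add: laurent_at_add)
  qed
  define p where "p = (\<Sum>m\<in>M. single (n m) (lookup q m))"
  have lp: "lookup p (n m) = lookup q m" if "m \<in> M" for m
  proof -
    have "lookup p (n m) = (\<Sum>m'\<in>M. if m' = m then lookup q m' else 0)"
      unfolding p_def lookup_sum lookup_single when_def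
      using that inj by (intro sum.cong refl if_cong) (auto simp: inj_on_def)
    then show ?thesis using that finM by simp
  qed
  have keysp: "keys p = n ` M"
  proof
    show "keys p \<subseteq> n ` M"
    proof
      fix k assume "k \<in> keys p"
      then have "\<exists>m\<in>M. (if n m = k then lookup q m else 0) \<noteq> 0"
        unfolding in_keys_iff p_def lookup_sum lookup_single when_def
        using sum.not_neutral_contains_not_neutral by blast
      then show "k \<in> n ` M" by (auto split: if_splits)
    qed
    show "n ` M \<subseteq> keys p" using lp by (auto simp: in_keys_iff M_def)
  qed
  have "keys (n m) \<subseteq> B" if "m \<in> M" for m
  proof -
    have "keys (n m) \<subseteq> keys (m + N)"
      unfolding n_def by (auto simp: in_keys_iff lookup_map_nat)
    then show ?thesis using keys_add[of m N] keysN q(1)[of m] that by (auto simp: M_def)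
  qed
  then have "p \<in> polys B" by (auto simp: polys_def keysp)
  moreover have "lin_ext h (monom_at t) p = (\<Sum>m\<in>M. h (lookup q m) * monom_at t (n m))"
    unfolding lin_ext_def keysp using inj lp by (simp add: sum.reindex)
  then have "lin_ext h (monom_at t) p = lin_ext h (laurent_at t) q * laurent_at t N"
    by (simp add: lin_ext_def M_def[symmetric] mon sum_distrib_right mult.assoc)
  ultimately have "p = 0" using indep q(2) by simp
  then have "n ` M = {}" using keysp by simp
  then show ?thesis by (simp add: M_def)
qed

text \<open>Order the Laurent monomials lexicographically and let \<open>P\<close> consist of the positive ones.\<close>

theorem independent_valuation:
  fixes t :: "'v::linorder \<Rightarrow> 'k::field" and h :: "'a::field \<Rightarrow> 'k"
  assumes h: "h 0 = 0" "h 1 = 1" "\<And>a b. h (a + b) = h a + h b" "\<And>a b. h (a * b) = h a * h b"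
    and t: "\<And>v. t v \<noteq> 0"
    and indep: "\<And>p. p \<in> polys B \<Longrightarrow> lin_ext h (monom_at t) p = 0 \<Longrightarrow> p = 0"
  obtains V where "valuation_set V"
    "\<And>m. keys m \<subseteq> B \<Longrightarrow> m \<noteq> 0 \<Longrightarrow> \<not> valuation_set.unit V (laurent_at t m)"
proof -
  interpret character_ext h "laurent_at t"
    by unfold_locales (simp_all add: h laurent_at_add t)
  \<comment> \<open>Restricting the support to nonnegative exponents gives the ring
    \<open>A\<close>; restricting it to positive ones gives a set whose image contains the ideal
    generated by \<open>P\<close>.\<close>
  define L where "L X = {p :: ('v \<Rightarrow>\<^sub>0 int) \<Rightarrow>\<^sub>0 'a. \<forall>m\<in>keys p. keys m \<subseteq> B \<and> m \<in> X}" for X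
  have L_add: "p + q \<in> L X" if "p \<in> L X" "q \<in> L X" for p q X
    using that keys_add[of p q] by (auto simp: L_def)
  have L_mult: "p * q \<in> L Z" if p: "p \<in> L X" and q: "q \<in> L Y"
    and XY: "\<And>x y. x \<in> X \<Longrightarrow> y \<in> Y \<Longrightarrow> x + y \<in> Z" for p q X Y Z
  proof -
    have "keys m \<subseteq> B \<and> m \<in> Z" if m: "m \<in> keys (p * q)" for m
    proof -
      obtain a b where ab: "a \<in> keys p" "b \<in> keys q" "m = a + b"
        using m keys_mult[of p q] by blast
      then have "keys a \<subseteq> B" "keys b \<subseteq> B" "m \<in> Z"
        using p q XY by (auto simp: L_def)
      then show ?thesis using keys_add[of a b] ab(3) by auto
    qed
    then show ?thesis by (simp add: L_def)
  qed
  define A P where "A = ev ` L {0..}" and "P = {laurent_at t m | m. keys m \<subseteq> B \<and> m > 0}"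
  have "subring_set A"
  proof
    show "0 \<in> A" unfolding A_def by (rule image_eqI[of _ _ 0]) (simp_all add: ev_zero L_def)
    show "1 \<in> A" unfolding A_def by (rule image_eqI[of _ _ 1]) (simp_all add: ev_one L_def)
    fix a b assume "a \<in> A" "b \<in> A"
    then obtain p q where pq: "a = ev p" "b = ev q" "p \<in> L {0..}" "q \<in> L {0..}" by (auto simp: A_def)
    have "- q \<in> L {0..}" using pq(4) by (simp add: L_def in_keys_iff)
    then have "p - q \<in> L {0..}" using L_add[OF pq(3), of "- q"] by simp
    then show "a - b \<in> A" by (auto simp: A_def pq(1,2) ev_diff[symmetric])
    have "p * q \<in> L {0..}" using pq by (intro L_mult) auto
    then show "a * b \<in> A" by (auto simp: A_def pq(1,2) ev_mult[symmetric])
  qed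
  moreover have single: "single m 1 \<in> L X" if "keys m \<subseteq> B" "m \<in> X" for m X
    using that by (simp add: L_def)
  have "P \<subseteq> A"
  proof
    fix x assume "x \<in> P"
    then obtain m where "x = laurent_at t m" "keys m \<subseteq> B" "m > 0" by (auto simp: P_def)
    then have "x = ev (single m 1)" "single m 1 \<in> L {0..}"
      using single[of m "{0..}"] by (simp_all add: ev_single h)
    then show "x \<in> A" by (simp add: A_def)
  qed
  moreover have "s \<in> ev ` L {0<..}" if "s \<in> pspan A P" for s
    using that
  proof (induction rule: pspan.induct)
    case pspan_zero
    show ?case by (rule image_eqI[of _ _ 0]) (simp_all add: ev_zero L_def)
  next
    case (pspan_step b x s)
    then obtain p q m where *: "b = ev p" "p \<in> L {0..}" "s = ev q" "q \<in> L {0<..}"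
      "x = laurent_at t m" "keys m \<subseteq> B" "m > 0" by (auto simp: A_def P_def)
    have "p * single m 1 \<in> L {0<..}"
      using * single[of m "{0<..}"] by (intro L_mult[of p "{0..}" _ "{0<..}"]) (auto intro: add_nonneg_pos)
    then have "p * single m 1 + q \<in> L {0<..}" using * by (intro L_add)
    moreover have "b * x + s = ev (p * single m 1 + q)"
      by (simp add: * ev_add ev_mult ev_single h)
    ultimately show ?case by blast
  qed
  moreover have "1 \<notin> ev ` L {0<..}"
  proof
    assume "1 \<in> ev ` L {0<..}"
    then obtain p where p: "p \<in> L {0<..}" "ev p = 1" by auto
    \<comment> \<open>\<open>1 - p\<close> is a Laurent relation, so independence forces
      \<open>p = 1\<close>, whose exponent 0 is not positive.\<close>
    have "1 - p = 0"
    proof (rule laurent_independent[of h t B])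
      show "ev (1 - p) = 0" by (simp add: ev_diff ev_one p)
      show "keys m \<subseteq> B" if "m \<in> keys (1 - p)" for m
      proof -
        have "m = 0 \<or> m \<in> keys p" using that keys_diff[of 1 p] by auto
        then show ?thesis using p(1) by (auto simp: L_def)
      qed
    qed (use h t indep in auto)
    then have "p = 1" by simp
    then show False using p(1) by (auto simp: L_def)
  qed
  ultimately obtain V where V: "valuation_set V" "A \<subseteq> V" "\<And>p. p \<in> P \<Longrightarrow> p \<noteq> 0 \<Longrightarrow> inverse p \<notin> V"
    using valuation_ring_exists[of A P] by blast
  interpret V: valuation_set V by fact
  have pos: "\<not> V.unit (laurent_at t m)" if "keys m \<subseteq> B" "m > 0" for m
    using V(3)[of "laurent_at t m"] that by (auto simp: P_def V.unit_def)
  have "\<not> V.unit (laurent_at t m)" if m: "keys m \<subseteq> B" "m \<noteq> 0" for m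
  proof (cases "m > 0")
    case False
    then have "- m > 0" using m by simp
    then have "\<not> V.unit (laurent_at t (- m))" using m by (intro pos) simp_all
    moreover have "laurent_at t m * laurent_at t (- m) = 1"
      using laurent_at_add[of t m "- m"] t by simp
    then have "laurent_at t (- m) = inverse (laurent_at t m)" by (simp add: inverse_unique)
    ultimately show ?thesis using V.unit_inverse by auto
  qed (use pos m in auto)
  then show thesis using that V(1) by blast
qed

section \<open>Multiplicative independence modulo units\<close>

context valuation_set
begin

text \<open>Linear independence of the values of the \<open>r e\<close> over the integers, written
  multiplicatively.\<close>

definition independent :: "'e set \<Rightarrow> ('e \<Rightarrow> 'k) \<Rightarrow> bool" where
  "independent E r \<longleftrightarrow> finite E \<and> (\<forall>e\<in>E. r e \<noteq> 0) \<and>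
     (\<forall>a :: 'e \<Rightarrow> int. unit (\<Prod>e\<in>E. r e powi a e) \<longrightarrow> (\<forall>e\<in>E. a e = 0))"

lemma independentD: "independent E r \<Longrightarrow> unit (\<Prod>e\<in>E. r e powi a e) \<Longrightarrow> \<forall>e\<in>E. a e = 0"
  by (simp add: independent_def)

lemma independent_unit_factor:
  assumes "independent E r" "\<And>e. e \<in> E \<Longrightarrow> unit (w e)" "\<And>e. e \<in> E \<Longrightarrow> r' e = w e * r e"
  shows "independent E r'"
proof -
  have "\<forall>e\<in>E. a e = 0" if "unit (\<Prod>e\<in>E. r' e powi a e)" for a :: "'a \<Rightarrow> int"
  proof -
    have "(\<Prod>e\<in>E. r' e powi a e) = (\<Prod>e\<in>E. w e powi a e) * (\<Prod>e\<in>E. r e powi a e)"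
      using assms(3) by (simp add: power_int_mult_distrib prod.distrib)
    moreover have "unit (\<Prod>e\<in>E. w e powi a e)" using assms(2) by (intro unit_prod unit_powi)
    ultimately have "unit (\<Prod>e\<in>E. r e powi a e)" using that by (simp add: unit_mult_cancel)
    then show ?thesis by (rule independentD[OF assms(1)])
  qed
  then show ?thesis using assms unit_nonzero by (auto simp: independent_def)
qed

lemma independent_reindex:
  assumes "independent E (r \<circ> f)" "inj_on f E"
  shows "independent (f ` E) r"
proof -
  have "\<forall>e\<in>f ` E. a e = 0" if "unit (\<Prod>e\<in>f ` E. r e powi a e)" for a :: "'b \<Rightarrow> int"
  proof -
    have "unit (\<Prod>e\<in>E. (r \<circ> f) e powi (a \<circ> f) e)"
      using that assms(2) by (simp add: prod.reindex)
    then have "\<forall>e\<in>E. (a \<circ> f) e = 0" by (rule independentD[OF assms(1)])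
    then show ?thesis by auto
  qed
  then show ?thesis using assms(1) by (auto simp: independent_def)
qed

lemma independent_square:
  assumes "independent E r"
  shows "independent E (\<lambda>e. r e ^ 2)"
proof -
  have "\<forall>e\<in>E. a e = 0" if "unit (\<Prod>e\<in>E. (r e ^ 2) powi a e)" for a :: "'a \<Rightarrow> int"
  proof -
    have "(\<Prod>e\<in>E. (r e ^ 2) powi a e) = (\<Prod>e\<in>E. r e powi (2 * a e))"
      by (simp add: power_int_mult)
    then have "\<forall>e\<in>E. 2 * a e = 0" using that by (intro independentD[OF assms]) simp
    then show ?thesis by simp
  qed
  then show ?thesis using assms by (auto simp: independent_def)
qed

text \<open>If both families had a relation, a combination of the two would cancel \<open>z\<close>, hence be trivial;
  comparing exponents shows that then one of the two relations does not involve \<open>z\<close> at all.\<close>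

lemma independent_twist:
  fixes k :: "'e \<Rightarrow> int"
  assumes r: "independent E r" and z: "z \<noteq> 0"
  shows "independent E (\<lambda>e. r e * z powi k e) \<or> independent E (\<lambda>e. r e * z powi (- k e))"
proof (rule ccontr)
  assume neg: "\<not> ?thesis"
  have r0: "e \<in> E \<Longrightarrow> r e \<noteq> 0" and fin: "finite E" for e using r by (auto simp: independent_def)
  have eq: "(\<Prod>e\<in>E. (r e * z powi l e) powi a e) = (\<Prod>e\<in>E. r e powi a e) * z powi (\<Sum>e\<in>E. l e * a e)"
    for l a :: "'e \<Rightarrow> int"
  proof -
    have "(\<Prod>e\<in>E. z powi (l e * a e)) = z powi (\<Sum>e\<in>E. l e * a e)"
      using fin z by (induction E) (simp_all add: power_int_add)
    then show ?thesis by (simp add: power_int_mult_distrib prod.distrib power_int_mult)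
  qed
  obtain a where a: "unit (\<Prod>e\<in>E. (r e * z powi k e) powi a e)" "\<exists>e\<in>E. a e \<noteq> 0"
    using neg fin r0 z unfolding independent_def by auto
  obtain b where b: "unit (\<Prod>e\<in>E. (r e * z powi (- k e)) powi b e)" "\<exists>e\<in>E. b e \<noteq> 0"
    using neg fin r0 z unfolding independent_def by auto
  define \<alpha> \<beta> where "\<alpha> = (\<Sum>e\<in>E. k e * a e)" and "\<beta> = (\<Sum>e\<in>E. k e * b e)"
  have ua: "unit ((\<Prod>e\<in>E. r e powi a e) * z powi \<alpha>)"
    using a(1) unfolding eq \<alpha>_def .
  have ub: "unit ((\<Prod>e\<in>E. r e powi b e) * z powi (- \<beta>))"
    using b(1) unfolding eq[of "\<lambda>e. - k e"] \<beta>_def by (simp add: sum_negf)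
  have "unit (((\<Prod>e\<in>E. r e powi a e) * z powi \<alpha>) powi \<beta> * ((\<Prod>e\<in>E. r e powi b e) * z powi (- \<beta>)) powi \<alpha>)"
    by (rule unit_mult[OF unit_powi[OF ua] unit_powi[OF ub]])
  also have "((\<Prod>e\<in>E. r e powi a e) * z powi \<alpha>) powi \<beta> * ((\<Prod>e\<in>E. r e powi b e) * z powi (- \<beta>)) powi \<alpha> =
      ((\<Prod>e\<in>E. r e powi a e) powi \<beta> * (\<Prod>e\<in>E. r e powi b e) powi \<alpha>) * (z powi (\<alpha> * \<beta>) * z powi (- \<beta> * \<alpha>))"
    by (simp only: power_int_mult_distrib power_int_mult mult.assoc mult.left_commute)
  also have "z powi (\<alpha> * \<beta>) * z powi (- \<beta> * \<alpha>) = 1"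
    using z power_int_add[of z "\<alpha> * \<beta>" "- \<beta> * \<alpha>"] by (simp add: mult.commute)
  also have "(\<Prod>e\<in>E. r e powi a e) powi \<beta> * (\<Prod>e\<in>E. r e powi b e) powi \<alpha> * 1 =
      (\<Prod>e\<in>E. r e powi (a e * \<beta> + b e * \<alpha>))"
  proof -
    have pw: "(\<Prod>e\<in>E. r e powi c e) powi \<gamma> = (\<Prod>e\<in>E. r e powi (c e * \<gamma>))" for c :: "'e \<Rightarrow> int" and \<gamma> :: int
      using fin by (induction E) (simp_all add: power_int_mult_distrib power_int_mult)
    show ?thesis using r0 by (simp add: pw power_int_add prod.distrib)
  qed
  finally have "\<forall>e\<in>E. a e * \<beta> + b e * \<alpha> = 0" by (rule independentD[OF r])
  \<comment> \<open>Pairing the exponents with \<open>k\<close> gives twice the product of \<alpha>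
    and \<beta>.\<close>
  then have "(\<Sum>e\<in>E. k e * (a e * \<beta> + b e * \<alpha>)) = 0" by simp
  also have "(\<Sum>e\<in>E. k e * (a e * \<beta> + b e * \<alpha>)) = \<alpha> * \<beta> + \<beta> * \<alpha>"
    by (simp add: \<alpha>_def \<beta>_def distrib_left sum.distrib sum_distrib_right mult.assoc)
  finally have "\<alpha> = 0 \<or> \<beta> = 0" by auto
  then show False
  proof
    assume "\<alpha> = 0"
    then show False using ua a(2) independentD[OF r, of a] by simp
  next
    assume "\<beta> = 0"
    then show False using ub b(2) independentD[OF r, of b] by simp
  qed
qed

text \<open>Let \<open>z\<close> be a difference of least value. Having a difference that is a
  nonunit multiple of \<open>z\<close> is an equivalence relation by \<open>nonunit_diff\<close>;
  \<open>L\<close> is the class of one end of \<open>z\<close>, and the other end lies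
  outside.\<close>

lemma split_cluster:
  fixes a :: "'i \<Rightarrow> 'k"
  assumes S: "finite S" "inj_on a S" "i \<in> S" "j \<in> S" "i \<noteq> j"
  obtains L R z where "L \<union> R = S" "L \<inter> R = {}" "L \<noteq> {}" "R \<noteq> {}" "z \<noteq> 0"
    "\<And>i j. i \<in> L \<Longrightarrow> j \<in> R \<Longrightarrow> unit ((a i - a j) / z)"
proof -
  define Z where "Z = (\<lambda>(i, j). a i - a j) ` {(i, j). i \<in> S \<and> j \<in> S \<and> i \<noteq> j}"
  have "finite {(i, j). i \<in> S \<and> j \<in> S \<and> i \<noteq> j}"
    by (rule finite_subset[of _ "S \<times> S"]) (use S in auto)
  then have "finite Z" by (simp add: Z_def)
  moreover have "Z \<noteq> {}" using S by (auto simp: Z_def)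
  moreover have "0 \<notin> Z" using inj_onD[OF S(2)] by (fastforce simp: Z_def)
  ultimately obtain z where z: "z \<in> Z" "\<forall>w\<in>Z. w / z \<in> \<O>"
    by (rule exists_least_value[THEN bexE])
  with \<open>0 \<notin> Z\<close> have "z \<noteq> 0" by blast
  note z = z this
  then obtain p q where pq: "p \<in> S" "q \<in> S" "p \<noteq> q" "z = a p - a q" by (auto simp: Z_def)
  have mem: "(a i - a j) / z \<in> \<O>" if "i \<in> S" "j \<in> S" for i j
    using that z by (cases "i = j") (auto simp: Z_def zero_in)
  define L where "L = {i \<in> S. \<not> unit ((a i - a p) / z)}"
  have "p \<in> L" using pq by (simp add: L_def unit_def)
  have "q \<in> S - L"
  proof -
    have "(a q - a p) / z = - 1" using z(3) by (simp add: pq(4) field_simps)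
    moreover have "unit (- 1)" using one_in uminus_in by (simp add: unit_def)
    ultimately show ?thesis using pq by (simp add: L_def)
  qed
  have units: "unit ((a i - a j) / z)" if "i \<in> L" "j \<in> S - L" for i j
  proof (rule ccontr)
    assume "\<not> ?thesis"
    then have "\<not> unit ((a i - a p) / z - (a i - a j) / z)"
      using that pq mem by (intro nonunit_diff) (auto simp: L_def)
    moreover have "(a i - a p) / z - (a i - a j) / z = (a j - a p) / z"
      by (simp add: diff_divide_distrib)
    ultimately show False using that by (simp add: L_def)
  qed
  show thesis
  proof (rule that[OF _ _ _ _ z(3) units])
    show "L \<union> (S - L) = S" by (auto simp: L_def)
    show "L \<noteq> {}" "S - L \<noteq> {}" using \<open>p \<in> L\<close> \<open>q \<in> S - L\<close> by blast+
  qed auto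
qed

text \<open>
  A state of the refinement process is an ordered partition of the vertices, given by the position
  \<open>c i\<close> of the cluster of \<open>i\<close>, together with a weight \<open>u i\<close> that is constant on clusters. Up to units
  this interpolates between \<open>(x i * x j * (a i - a j))\<^sup>2\<close> (a single cluster) and
  \<open>(x i\<^sup>2 * u i) * (x j\<^sup>2 / u j)\<close> (all clusters singletons). The squares avoid
  square roots of the factors by which the weights change.
\<close>

definition state_weight :: "('i \<Rightarrow> 'k) \<Rightarrow> ('i \<Rightarrow> 'k) \<Rightarrow> ('i \<Rightarrow> nat) \<Rightarrow> ('i \<Rightarrow> 'k) \<Rightarrow> 'i \<times> 'i \<Rightarrow> 'k" where
  "state_weight x a c u = (\<lambda>(i, j). x i ^ 2 * x j ^ 2 *
     (if c i = c j then (a i - a j) ^ 2 else if c i < c j then u i / u j else u j / u i))"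

text \<open>Squared differences between \<open>L\<close> and \<open>R\<close> equal
  \<open>z ^ 2\<close> up to units, and factors \<open>z\<close> and \<open>1 / z\<close> on the
  weights of the two parts produce exactly this quotient. Edges between clusters pick up
  \<open>z\<close> with exponent \<open>k\<close>, or \<open>- k\<close> if the parts are placed in
  reverse order; \<open>independent_twist\<close> selects the order.\<close>

lemma refine_cluster:
  fixes E :: "('i \<times> 'i) set"
  assumes V: "finite V" "inj_on a V" "E \<subseteq> V \<times> V"
    and u: "\<And>i j. i \<in> V \<Longrightarrow> j \<in> V \<Longrightarrow> c i = c j \<Longrightarrow> u i = u j" "\<And>i. u i \<noteq> 0"
    and ind: "independent E (state_weight x a c u)"
    and not_inj: "\<not> inj_on c V"
  obtains c' u' where "\<forall>i\<in>V. \<forall>j\<in>V. c' i = c' j \<longrightarrow> u' i = u' j" "\<forall>i. u' i \<noteq> 0"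
    "independent E (state_weight x a c' u')"
    "{(i, j). i \<in> V \<and> j \<in> V \<and> i \<noteq> j \<and> c' i = c' j} \<subset> {(i, j). i \<in> V \<and> j \<in> V \<and> i \<noteq> j \<and> c i = c j}"
proof -
  obtain p q where pq: "p \<in> V" "q \<in> V" "p \<noteq> q" "c p = c q" using not_inj by (auto simp: inj_on_def)
  define S where "S = {i \<in> V. c i = c p}"
  have "finite S" "inj_on a S" "p \<in> S" "q \<in> S"
    using V pq by (auto simp: S_def inj_on_def)
  from split_cluster[OF this pq(3)] obtain L R z where LR: "L \<union> R = S" "L \<inter> R = {}" "L \<noteq> {}" "R \<noteq> {}" "z \<noteq> 0"
    and unitLR: "\<And>i j. i \<in> L \<Longrightarrow> j \<in> R \<Longrightarrow> unit ((a i - a j) / z)" by metis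
  define \<epsilon> :: "'i \<Rightarrow> int" where "\<epsilon> i = (if i \<in> L then 1 else if i \<in> R then - 1 else 0)" for i
  define k :: "'i \<times> 'i \<Rightarrow> int" where
    "k = (\<lambda>(i, j). if c i = c j then 0 else if c i < c j then \<epsilon> i - \<epsilon> j else \<epsilon> j - \<epsilon> i)"
  \<comment> \<open>Doubling the positions makes room to place the part \<open>T\<close> right after
    the other part, with the order between different clusters unchanged.\<close>
  define c1 where "c1 T i = (if i \<in> V \<and> i \<in> T then 2 * c i + 1 else 2 * c i)" for T i
  define u1 where "u1 s i = u i * z powi (s * \<epsilon> i)" for s i
  have inV: "i \<in> L \<Longrightarrow> i \<in> V \<and> c i = c p" "i \<in> R \<Longrightarrow> i \<in> V \<and> c i = c p" for i using LR(1) by (auto simp: S_def)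
  have eps_L: "\<epsilon> i = 1" if "i \<in> L" for i using that by (simp add: \<epsilon>_def)
  have eps_R: "\<epsilon> i = - 1" if "i \<in> R" for i using that LR(2) by (auto simp: \<epsilon>_def)
  note result = that
  have main: thesis if T: "T = L \<and> s = - 1 \<or> T = R \<and> s = 1"
    and indT: "independent E (\<lambda>e. state_weight x a c u e * z powi (s * k e))" for T and s :: int
  proof (rule result[of "c1 T" "u1 s"])
    have c1_less: "c1 T i < c1 T j" if "c i < c j" for i j using that by (simp add: c1_def)
    have c1_eq: "c i = c j" if "c1 T i = c1 T j" for i j
      using c1_less[of i j] c1_less[of j i] that by (metis less_irrefl linorder_neqE_nat)
    have mixed: "i \<in> L \<and> j \<in> R \<or> i \<in> R \<and> j \<in> L"
      if "i \<in> V" "j \<in> V" "c i = c j" "c1 T i \<noteq> c1 T j" for i j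
    proof -
      have "i \<in> T \<longleftrightarrow> j \<notin> T" using that by (auto simp: c1_def split: if_splits)
      moreover from this have "i \<in> S \<and> j \<in> S" using that T LR(1) inV by (auto simp: S_def)
      ultimately show ?thesis using T LR(1) by blast
    qed
    show "\<forall>i. u1 s i \<noteq> 0" using u(2) LR(5) by (simp add: u1_def)
    have "u1 s i = u1 s j" if ij: "i \<in> V" "j \<in> V" "c1 T i = c1 T j" for i j
    proof -
      have c: "c i = c j" using c1_eq ij by blast
      then have "i \<in> T \<longleftrightarrow> j \<in> T" using ij by (cases "i \<in> T"; cases "j \<in> T") (simp_all add: c1_def)
      moreover have "i \<in> S \<longleftrightarrow> j \<in> S" using ij c by (simp add: S_def)
      ultimately have "\<epsilon> i = \<epsilon> j" unfolding \<epsilon>_def using T LR(1,2) by auto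
      then show ?thesis using u(1)[OF ij(1,2) c] by (simp add: u1_def)
    qed
    then show "\<forall>i\<in>V. \<forall>j\<in>V. c1 T i = c1 T j \<longrightarrow> u1 s i = u1 s j" by blast
    have c1_LR: "c1 T i \<noteq> c1 T j" if "i \<in> L" "j \<in> R" for i j
      using that T LR(2) inV[of i] inV[of j] by (auto simp: c1_def)
    show "{(i, j). i \<in> V \<and> j \<in> V \<and> i \<noteq> j \<and> c1 T i = c1 T j} \<subset> {(i, j). i \<in> V \<and> j \<in> V \<and> i \<noteq> j \<and> c i = c j}"
    proof -
      obtain i j where ij: "i \<in> L" "j \<in> R" using LR(3,4) by blast
      then have "c1 T i \<noteq> c1 T j" "i \<in> V" "j \<in> V" "c i = c j" "i \<noteq> j"
        using c1_LR inV LR(2) by auto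
      then show ?thesis using c1_eq by blast
    qed
    have weight_LR: "state_weight x a (c1 T) (u1 s) (i, j) = x i ^ 2 * x j ^ 2 * z ^ 2"
      "state_weight x a (c1 T) (u1 s) (j, i) = x i ^ 2 * x j ^ 2 * z ^ 2"
      if ij: "i \<in> L" "j \<in> R" for i j
    proof -
      have V: "i \<in> V" "j \<in> V" "c i = c j" using inV ij by auto
      have uij: "u i = u j" using u(1) V by blast
      have nz: "u j \<noteq> 0" using u(2) by blast
      consider "T = R" "s = 1" "i \<notin> T" "j \<in> T" | "T = L" "s = -1" "i \<in> T" "j \<notin> T"
        using T LR(2) ij by blast
      then show "state_weight x a (c1 T) (u1 s) (i, j) = x i ^ 2 * x j ^ 2 * z ^ 2"
        "state_weight x a (c1 T) (u1 s) (j, i) = x i ^ 2 * x j ^ 2 * z ^ 2"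
        using V nz LR(5)
        by (cases; simp add: state_weight_def c1_def u1_def eps_L[OF ij(1)] eps_R[OF ij(2)] uij
            power_int_minus field_simps power2_eq_square)+
    qed
    \<comment> \<open>The unit by which the new weight differs, on the pairs just separated, from
      the old squared difference.\<close>
    define w where "w e = (let (i, j) = e in
      if c i = c j \<and> c1 T i \<noteq> c1 T j then (z / (a i - a j)) ^ 2 else 1)" for e
    show "independent E (state_weight x a (c1 T) (u1 s))"
    proof (rule independent_unit_factor[OF indT, of w])
      fix e assume "e \<in> E"
      then obtain i j where e: "e = (i, j)" and ij: "i \<in> V" "j \<in> V" using V(3) by auto
      have unit': "unit ((z / (a i - a j)) ^ 2)" if "i \<in> L \<and> j \<in> R \<or> i \<in> R \<and> j \<in> L"
      proof -
        have "unit (inverse ((a i - a j) / z)) \<or> unit (inverse ((a j - a i) / z))"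
          using that unitLR unit_inverse by blast
        then have "unit (z / (a i - a j)) \<or> unit (z / (a j - a i))" by simp
        moreover have "(z / (a j - a i)) ^ 2 = (z / (a i - a j)) ^ 2"
          by (simp add: power_divide power2_commute)
        ultimately show ?thesis using unit_power by metis
      qed
      show "unit (w e)"
        using mixed[OF ij] unit' by (auto simp: w_def e unit_one)
      show "state_weight x a (c1 T) (u1 s) e = w e * (state_weight x a c u e * z powi (s * k e))"
      proof (cases "c i = c j")
        case True
        show ?thesis
        proof (cases "c1 T i = c1 T j")
          case True
          then show ?thesis using \<open>c i = c j\<close> by (simp add: w_def e state_weight_def k_def)
        next
          case False
          from mixed[OF ij True False] have LRij: "i \<in> L \<and> j \<in> R \<or> i \<in> R \<and> j \<in> L" .
          then have "state_weight x a (c1 T) (u1 s) e = x i ^ 2 * x j ^ 2 * z ^ 2"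
            using weight_LR[of i j] weight_LR[of j i] by (auto simp: e mult.commute)
          moreover have "a i \<noteq> a j" using unit_nonzero[OF unit'[OF LRij]] by auto
          ultimately show ?thesis using True False
            by (simp add: w_def e state_weight_def k_def field_simps)
        qed
      next
        case False
        have wt: "state_weight x a (c1 T) (u1 s) (i, j) = state_weight x a c u (i, j) * z powi (s * k (i, j))"
        proof (cases "c i < c j")
          case True
          have "u1 s i / u1 s j = (u i / u j) * z powi (s * (\<epsilon> i - \<epsilon> j))"
            using LR(5) by (simp add: u1_def right_diff_distrib power_int_diff)
          then show ?thesis using True c1_less[OF True] False by (simp add: state_weight_def k_def)
        next
          case False
          then have lt: "c j < c i" using \<open>c i \<noteq> c j\<close> by simp
          have "u1 s j / u1 s i = (u j / u i) * z powi (s * (\<epsilon> j - \<epsilon> i))"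
            using LR(5) by (simp add: u1_def right_diff_distrib power_int_diff)
          then show ?thesis using lt c1_less[OF lt] by (simp add: state_weight_def k_def)
        qed
        then show ?thesis using False by (simp add: e w_def)
      qed
    qed
  qed
  from independent_twist[OF ind LR(5), of k] show thesis
    using main[of R 1] main[of L "-1"] by auto
qed

text \<open>Each refinement separates some pair of vertices, so the number of pairs sharing a
  cluster drops.\<close>

lemma refine_to_order:
  fixes E :: "('i \<times> 'i) set"
  assumes V: "finite V" "inj_on a V" "E \<subseteq> V \<times> V"
    and "\<And>i j. i \<in> V \<Longrightarrow> j \<in> V \<Longrightarrow> c i = c j \<Longrightarrow> u i = u j" "\<And>i. u i \<noteq> 0"
    and "independent E (state_weight x a c u)"
  shows "\<exists>c' u'. (inj_on c' V) \<and> (\<forall>i. u' i \<noteq> 0) \<and> independent E (state_weight x a c' u')"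
  using assms(4-)
proof (induction "card {(i, j). i \<in> V \<and> j \<in> V \<and> i \<noteq> j \<and> c i = c j}" arbitrary: c u rule: less_induct)
  case less
  show ?case
  proof (cases "inj_on c V")
    case False
    obtain c' u' where c': "\<forall>i\<in>V. \<forall>j\<in>V. c' i = c' j \<longrightarrow> u' i = u' j" "\<forall>i. u' i \<noteq> 0"
      "independent E (state_weight x a c' u')"
      "{(i, j). i \<in> V \<and> j \<in> V \<and> i \<noteq> j \<and> c' i = c' j} \<subset> {(i, j). i \<in> V \<and> j \<in> V \<and> i \<noteq> j \<and> c i = c j}"
      by (rule refine_cluster[OF V less.prems False])
    have fin: "finite {(i, j). i \<in> V \<and> j \<in> V \<and> i \<noteq> j \<and> c i = c j}"
      by (rule finite_subset[of _ "V \<times> V"]) (use V in auto)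
    show ?thesis
      by (rule less.hyps[OF psubset_card_mono[OF fin c'(4)] _ _ c'(3)]) (use c'(1,2) in blast)+
  qed (use less in blast)
qed

text \<open>Consecutive arcs of the trail share a head or a tail and get opposite exponents, so the
  product of the arc values telescopes around the trail to 1, which is a unit.\<close>

lemma independent_no_alternating_trail:
  assumes ind: "independent D (\<lambda>(i, j). f i * g j)"
    and D: "inj_on (\<lambda>(u, v). {u, v}) D" "\<And>u v. (u, v) \<in> D \<Longrightarrow> u \<noteq> v"
  shows "\<not> alternating_closed_trail D w"
proof
  assume w: "alternating_closed_trail D w"
  define k where "k = length w - 1"
  define fw where "fw i \<longleftrightarrow> (w ! i, w ! Suc i) \<in> D" for i
  define bw where "bw i \<longleftrightarrow> (w ! Suc i, w ! i) \<in> D" for i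
  have *: "k \<ge> 1 \<and> (\<forall>i<k. fw i \<or> bw i) \<and> inj_on (\<lambda>i. {w ! i, w ! Suc i}) {..<k} \<and> w ! k = w ! 0 \<and>
      (\<forall>i<k. fw i \<and> bw (Suc i mod k) \<or> bw i \<and> fw (Suc i mod k))"
    using w unfolding alternating_closed_trail_def Let_def k_def[symmetric] fw_def bw_def .
  then have k: "k \<ge> 1" and inj: "inj_on (\<lambda>i. {w ! i, w ! Suc i}) {..<k}" and closed: "w ! k = w ! 0"
    by simp_all
  have step: "fw i \<or> bw i" and alt: "fw i \<and> bw (Suc i mod k) \<or> bw i \<and> fw (Suc i mod k)" if "i < k" for i
    using * that by blast+
  have asym: "\<not> (fw i \<and> bw i)" for i
  proof
    assume *: "fw i \<and> bw i"
    have "(\<lambda>(u, v). {u, v}) (w ! i, w ! Suc i) = (\<lambda>(u, v). {u, v}) (w ! Suc i, w ! i)"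
      by (simp add: insert_commute)
    then have "(w ! i, w ! Suc i) = (w ! Suc i, w ! i)"
      by (rule inj_onD[OF D(1)]) (use * in \<open>simp_all add: fw_def bw_def\<close>)
    then have "w ! i = w ! Suc i" by (rule Pair_inject)
    then show False using D(2)[of "w ! i" "w ! Suc i"] * unfolding fw_def by blast
  qed
  define arc where "arc i = (if fw i then (w ! i, w ! Suc i) else (w ! Suc i, w ! i))" for i
  define s :: "nat \<Rightarrow> int" where "s i = (if fw i then 1 else - 1)" for i
  have arcD: "arc i \<in> D" if "i < k" for i using step[OF that] by (auto simp: arc_def fw_def bw_def)
  have inj_arc: "inj_on arc {..<k}"
  proof
    fix i j assume ij: "i \<in> {..<k}" "j \<in> {..<k}" "arc i = arc j"
    have "{fst (arc i), snd (arc i)} = {w ! i, w ! Suc i}" for i by (auto simp: arc_def)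
    then show "i = j" using inj_onD[OF inj, of i j] ij by metis
  qed
  \<comment> \<open>The trail repeats no edge, so each of its arcs has a single position and gets
    exponent 1 or -1; the other arcs get 0.\<close>
  define a where "a d = (if d \<in> arc ` {..<k} then s (the_inv_into {..<k} arc d) else 0)" for d
  have a_arc: "a (arc i) = s i" if "i < k" for i
    using that inj_arc by (simp add: a_def the_inv_into_f_f)
  let ?r = "\<lambda>(i, j). f i * g j"
  have nz: "d \<in> D \<Longrightarrow> ?r d \<noteq> 0" and finD: "finite D" for d using ind by (auto simp: independent_def)
  \<comment> \<open>Chosen so that each signed arc value is \<open>\<phi> i / \<phi> (nx i)\<close>:
    the factor at the start of the step, a tail if forward and a head if backward.\<close>
  define \<phi> where "\<phi> i = (if fw i then f (w ! i) else inverse (g (w ! i)))" for i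
  define nx where "nx i = Suc i mod k" for i
  have w_nx: "w ! nx i = w ! Suc i" if "i < k" for i
    using that closed k by (cases "Suc i = k") (auto simp: nx_def)
  have factor: "?r (arc i) powi s i = \<phi> i / \<phi> (nx i)" and phi0: "\<phi> i \<noteq> 0" if i: "i < k" for i
  proof -
    have rnz: "?r (arc i) \<noteq> 0" using nz arcD i by blast
    show "\<phi> i \<noteq> 0" using rnz by (auto simp: \<phi>_def arc_def split: if_splits)
    consider "fw i" "\<not> fw (nx i)" | "\<not> fw i" "fw (nx i)"
      using alt[OF i] asym[of i] asym[of "nx i"] unfolding nx_def by blast
    then show "?r (arc i) powi s i = \<phi> i / \<phi> (nx i)"
      by cases (simp_all add: arc_def s_def \<phi>_def w_nx[OF i] field_simps)
  qed
  have "(\<Prod>d\<in>D. ?r d powi a d) = (\<Prod>d\<in>arc ` {..<k}. ?r d powi a d)"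
    using finD arcD by (intro prod.mono_neutral_right) (auto simp: a_def)
  also have "\<dots> = (\<Prod>i<k. ?r (arc i) powi a (arc i))"
    by (simp add: prod.reindex[OF inj_arc])
  also have "\<dots> = (\<Prod>i<k. \<phi> i / \<phi> (nx i))"
    using a_arc factor by (intro prod.cong) auto
  also have "\<dots> = (\<Prod>i<k. \<phi> i) / (\<Prod>i<k. \<phi> (nx i))" by (simp add: prod_dividef)
  also have "(\<Prod>i<k. \<phi> (nx i)) = (\<Prod>i<k. \<phi> i)"
  proof (rule prod.reindex_bij_betw)
    have "inj_on nx {..<k}"
    proof
      fix i j assume "i \<in> {..<k}" "j \<in> {..<k}" "nx i = nx j"
      then show "i = j" by (cases "Suc i = k"; cases "Suc j = k") (auto simp: nx_def)
    qed
    moreover have "nx ` {..<k} \<subseteq> {..<k}" using k by (auto simp: nx_def)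
    ultimately show "bij_betw nx {..<k} {..<k}"
      by (simp add: bij_betw_def endo_inj_surj)
  qed
  also have "(\<Prod>i<k. \<phi> i) / (\<Prod>i<k. \<phi> i) = 1" using phi0 by simp
  finally have "unit (\<Prod>d\<in>D. ?r d powi a d)" by (simp add: unit_one)
  then have "a (arc 0) = 0" using ind arcD[of 0] k unfolding independent_def by auto
  then show False using a_arc[of 0] k by (auto simp: s_def split: if_splits)
qed

theorem independent_differences_orientation:
  fixes E :: "('i \<times> 'i) set" and x a :: "'i \<Rightarrow> 'k"
  assumes V: "finite V" "inj_on a V" "E \<subseteq> V \<times> V"
    and E: "inj_on (\<lambda>(u, v). {u, v}) E"
    and ind: "independent E (\<lambda>(i, j). x i * x j * (a i - a j))"
  shows "\<exists>D. bij_betw (\<lambda>(u, v). {u, v}) D ((\<lambda>(u, v). {u, v}) ` E) \<and> acyclic D \<and>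
    \<not> (\<exists>w. alternating_closed_trail D w)"
proof -
  \<comment> \<open>With one cluster and weight 1 the state weight is the square of the given
    value.\<close>
  have "independent E (state_weight x a (\<lambda>_. 0) (\<lambda>_. 1))"
    using independent_square[OF ind]
    by (rule independent_unit_factor[where w = "\<lambda>_. 1"])
      (auto simp: state_weight_def unit_one power_mult_distrib split: prod.splits)
  from refine_to_order[OF V _ _ this] obtain c u where c: "inj_on c V" "\<And>i. u i \<noteq> 0"
    and indc: "independent E (state_weight x a c u)" by auto
  have neq: "i \<noteq> j" if "(i, j) \<in> E" for i j
    using ind that unfolding independent_def by fastforce
  define \<rho> where "\<rho> = (\<lambda>(i, j). if c i < c j then (i, j) else (j, i))"
  define D where "D = \<rho> ` E"
  have edge: "(\<lambda>(u, v). {u, v}) (\<rho> e) = (\<lambda>(u, v). {u, v}) e" for e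
    by (auto simp: \<rho>_def split: prod.splits)
  have inj: "inj_on \<rho> E"
  proof
    fix e e' assume "e \<in> E" "e' \<in> E" "\<rho> e = \<rho> e'"
    then show "e = e'" using inj_onD[OF E, of e e'] edge by metis
  qed
  have injD: "inj_on (\<lambda>(u, v). {u, v}) D"
    unfolding D_def using E edge by (force simp: inj_on_def)
  have less: "c i < c j" if ij: "(i, j) \<in> D" for i j
  proof -
    obtain e where "e \<in> E" "(i, j) = \<rho> e" using ij unfolding D_def by blast
    then obtain p q where "(p, q) \<in> E" "(i, j) = \<rho> (p, q)" by (cases e) auto
    moreover from this have "c p \<noteq> c q" using neq V(3) inj_onD[OF c(1)] by blast
    ultimately show ?thesis by (auto simp: \<rho>_def split: if_splits)
  qed
  \<comment> \<open>All clusters are singletons now, so the weight is a factor of the tail times a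
    factor of the head.\<close>
  have "independent D (\<lambda>(i, j). (x i ^ 2 * u i) * (x j ^ 2 / u j))"
    unfolding D_def
  proof (rule independent_reindex[OF _ inj])
    show "independent E ((\<lambda>(i, j). (x i ^ 2 * u i) * (x j ^ 2 / u j)) \<circ> \<rho>)"
    proof (rule independent_unit_factor[OF indc, where w = "\<lambda>_. 1"])
      fix e assume "e \<in> E"
      then obtain i j where e: "e = (i, j)" "(i, j) \<in> E" by (cases e) auto
      then have "c i \<noteq> c j" using neq V(3) inj_onD[OF c(1)] by blast
      then show "((\<lambda>(i, j). (x i ^ 2 * u i) * (x j ^ 2 / u j)) \<circ> \<rho>) e = 1 * state_weight x a c u e"
        by (simp add: e \<rho>_def state_weight_def)
    qed (rule unit_one)
  qed
  then have "\<not> alternating_closed_trail D w" for w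
    by (rule independent_no_alternating_trail[OF _ injD]) (use less in fastforce)
  moreover have "acyclic D"
  proof -
    have "(i, j) \<in> D\<^sup>+ \<Longrightarrow> c i < c j" for i j
      by (induction rule: trancl_induct) (auto dest: less)
    then show ?thesis unfolding acyclic_def by blast
  qed
  moreover have "bij_betw (\<lambda>(u, v). {u, v}) D ((\<lambda>(u, v). {u, v}) ` E)"
  proof -
    have "(\<lambda>(u, v). {u, v}) ` D = (\<lambda>(u, v). {u, v}) ` E"
      unfolding D_def image_image by (simp only: edge)
    then show ?thesis using injD by (simp add: bij_betw_def)
  qed
  ultimately show ?thesis by blast
qed

end

section \<open>Leading monomials of the binomials\<close>

text \<open>Every arc with nonzero coefficient shares its tail with another such arc, and likewise
  its head, since otherwise one of the sums would be a single nonzero term. Changing arcs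
  alternately at heads and tails gives an endless walk, and its first repetition closes a
  trail.\<close>

lemma alternating_trail_exists:
  fixes \<delta> :: "'i \<times> 'i \<Rightarrow> int"
  assumes D: "finite D" "inj_on (\<lambda>(u, v). {u, v}) D"
    and sums: "\<And>u. (\<Sum>d | d \<in> D \<and> fst d = u. \<delta> d) = 0" "\<And>u. (\<Sum>d | d \<in> D \<and> snd d = u. \<delta> d) = 0"
    and "d0 \<in> D" "\<delta> d0 \<noteq> 0"
  shows "\<exists>w. alternating_closed_trail D w"
proof -
  define A where "A = {d \<in> D. \<delta> d \<noteq> 0}"
  have next_ex: "\<exists>d'\<in>A. d' \<noteq> d \<and> f d' = f d"
    if d: "d \<in> A" and s: "\<And>u. (\<Sum>d | d \<in> D \<and> f d = u. \<delta> d) = 0" for d and f :: "'i \<times> 'i \<Rightarrow> 'i"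
  proof (rule ccontr)
    assume neg: "\<not> ?thesis"
    have "(\<Sum>e | e \<in> D \<and> f e = f d. \<delta> e) = (\<Sum>e\<in>{d}. \<delta> e)"
      using D(1) d neg by (intro sum.mono_neutral_right) (auto simp: A_def)
    then show False using s d by (simp add: A_def)
  qed
  obtain nf where nf: "\<And>d. d \<in> A \<Longrightarrow> nf d \<in> A \<and> nf d \<noteq> d \<and> fst (nf d) = fst d"
    using next_ex[of _ fst, OF _ sums(1)] by metis
  obtain ns where ns: "\<And>d. d \<in> A \<Longrightarrow> ns d \<in> A \<and> ns d \<noteq> d \<and> snd (ns d) = snd d"
    using next_ex[of _ snd, OF _ sums(2)] by metis
  define d where "d = rec_nat d0 (\<lambda>i e. if even i then ns e else nf e)"
  have d_Suc: "d (Suc i) = (if even i then ns (d i) else nf (d i))" for i by (simp add: d_def)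
  have dA: "d i \<in> A" for i
    by (induction i) (use assms in \<open>auto simp: d_Suc nf ns\<close>, auto simp: d_def A_def)
  have d_neq: "d (Suc i) \<noteq> d i" for i using nf[OF dA] ns[OF dA] by (simp add: d_Suc)
  define v where "v i = (if even i then fst (d i) else snd (d i))" for i
  have d_even: "d i = (v i, v (Suc i))" if "even i" for i
    using that ns[OF dA, of i] by (simp add: v_def d_Suc)
  have d_odd: "d i = (v (Suc i), v i)" if "odd i" for i
    using that nf[OF dA, of i] by (simp add: v_def d_Suc)
  \<comment> \<open>Parity tells whether the vertex is visited as a tail or as a head: these are the
    nodes of the bipartite graph, where a vertex may occur once in each role.\<close>
  define node where "node i = (even i, v i)" for i :: nat
  have "finite (range node)"
  proof (rule finite_subset)
    show "range node \<subseteq> UNIV \<times> (fst ` A \<union> snd ` A)" using dA by (auto simp: node_def v_def)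
    show "finite (UNIV \<times> (fst ` A \<union> snd ` A) :: (bool \<times> 'i) set)" using D(1) by (simp add: A_def)
  qed
  then have "\<not> inj node" using finite_imageD infinite_UNIV_nat by blast
  then have "\<exists>j i. i < j \<and> node i = node j"
    unfolding inj_def by (metis linorder_neqE_nat)
  then obtain j where j: "\<exists>i. i < j \<and> node i = node j" "\<forall>j' < j. \<not> (\<exists>i. i < j' \<and> node i = node j')"
    unfolding exists_least_iff[of "\<lambda>j. \<exists>i. i < j \<and> node i = node j"] by metis
  then obtain i where i: "i < j" "node i = node j" by blast
  have node_inj: "m = m'" if "m < j" "m' < j" "node m = node m'" for m m'
    using j(2) that by (metis linorder_neqE_nat)
  have parity: "even i \<longleftrightarrow> even j" using i by (simp add: node_def)
  \<comment> \<open>Returning after two steps would traverse the same arc twice in a row.\<close>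
  have j2: "j \<noteq> Suc (Suc i)"
  proof
    assume "j = Suc (Suc i)"
    then have "v i = v (Suc (Suc i))" using i by (simp add: node_def)
    then have "d (Suc i) = d i"
      using d_even[of i] d_even[of "Suc i"] d_odd[of i] d_odd[of "Suc i"] by (cases "even i") simp_all
    then show False using d_neq by blast
  qed
  define k where "k = j - i"
  define w where "w = map v [i..<Suc j]"
  have len: "length w - 1 = k" using i by (simp add: w_def k_def)
  have w_nth: "w ! l = v (i + l)" if "l \<le> k" for l
    unfolding w_def using that i by (simp add: k_def nth_append del: upt_Suc)
  have k: "k \<ge> 1" "even k" using i parity by (auto simp: k_def)
  let ?fw = "\<lambda>l. (w ! l, w ! Suc l) \<in> D" and ?bw = "\<lambda>l. (w ! Suc l, w ! l) \<in> D"
  have dD: "d l \<in> D" for l using dA by (auto simp: A_def)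
  have fw: "?fw l" if "l < k" "even (i + l)" for l
    using that d_even[of "i + l"] dD[of "i + l"] by (simp add: w_nth)
  have bw: "?bw l" if "l < k" "odd (i + l)" for l
    using that d_odd[of "i + l"] dD[of "i + l"] by (simp add: w_nth)
  have alt: "?fw l \<and> ?bw (Suc l mod k) \<or> ?bw l \<and> ?fw (Suc l mod k)" if l: "l < k" for l
  proof -
    have "even (Suc l mod k) \<longleftrightarrow> odd l" using k by (simp add: dvd_mod_iff)
    moreover have "Suc l mod k < k" using k by simp
    ultimately show ?thesis using fw[of l] bw[of l] fw[of "Suc l mod k"] bw[of "Suc l mod k"] l
      by (cases "even (i + l)") auto
  qed
  have inj: "inj_on (\<lambda>l. {w ! l, w ! Suc l}) {..<k}"
  proof
    fix l l' assume l: "l \<in> {..<k}" "l' \<in> {..<k}" "{w ! l, w ! Suc l} = {w ! l', w ! Suc l'}"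
    define m m' where "m = i + l" and "m' = i + l'"
    have m: "i \<le> m" "m < j" "i \<le> m'" "m' < j" using l by (auto simp: m_def m'_def k_def)
    have edge: "(\<lambda>(u, v). {u, v}) (d m) = {v m, v (Suc m)}" for m
      using d_even[of m] d_odd[of m] by (cases "even m") (auto simp: insert_commute)
    have "(\<lambda>(u, v). {u, v}) (d m) = (\<lambda>(u, v). {u, v}) (d m')"
      unfolding edge using l by (simp add: w_nth m_def m'_def)
    then have dm: "d m = d m'" by (rule inj_onD[OF D(2) _ dD dD])
    have "m = m'"
    proof (cases "even m \<longleftrightarrow> even m'")
      case True
      then have "node m = node m'" using dm by (simp add: node_def v_def)
      then show ?thesis using node_inj m by blast
    next
      case False
      \<comment> \<open>The same arc used in opposite directions swaps its two nodes. As the nodes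
        before \<open>j\<close> are distinct, the two positions are neighbours on the cycle from
        both sides, which leaves only the excluded length 2.\<close>
      then have n: "node m = node (Suc m')" "node m' = node (Suc m)"
        using dm d_even[of m] d_even[of m'] d_odd[of m] d_odd[of m'] by (auto simp: node_def)
      have "m = Suc m' \<or> m = i \<and> Suc m' = j"
        using n(1) node_inj[of m "Suc m'"] node_inj[of m i] i m by (cases "Suc m' = j") auto
      moreover have "m' = Suc m \<or> m' = i \<and> Suc m = j"
        using n(2) node_inj[of m' "Suc m"] node_inj[of m' i] i m by (cases "Suc m = j") auto
      ultimately show ?thesis using j2 by auto
    qed
    then show "l = l'" by (simp add: m_def m'_def)
  qed
  have "w ! k = w ! 0" using i by (simp add: w_nth node_def) (simp add: k_def)
  then have "alternating_closed_trail D w"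
    unfolding alternating_closed_trail_def Let_def len
    using k(1) inj alt fw bw by blast
  then show ?thesis by blast
qed

section \<open>Weights and leading terms\<close>

definition wt :: "('x \<Rightarrow> nat) \<Rightarrow> ('x \<Rightarrow>\<^sub>0 nat) \<Rightarrow> nat" where
  "wt \<omega> m = (\<Sum>x\<in>keys m. \<omega> x * lookup m x)"

lemma wt_superset:
  "finite B \<Longrightarrow> keys m \<subseteq> B \<Longrightarrow> wt \<omega> m = (\<Sum>x\<in>B. \<omega> x * lookup m x)"
  unfolding wt_def by (intro sum.mono_neutral_left) (auto simp: in_keys_iff)

lemma wt_add: "wt \<omega> (m + m') = wt \<omega> m + wt \<omega> m'"
proof -
  let ?B = "keys m \<union> keys m'"
  have "keys (m + m') \<subseteq> ?B" by (rule keys_add)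
  then show ?thesis
    by (simp add: wt_superset[of ?B] lookup_add distrib_left sum.distrib)
qed

lemma wt_zero [simp]: "wt \<omega> 0 = 0"
  by (simp add: wt_def)

lemma wt_single [simp]: "wt \<omega> (single x k) = \<omega> x * k"
  by (cases "k = 0") (simp_all add: wt_def)

text \<open>A leading term for the weight alone: every other monomial is strictly lighter, so there
  are no ties to break.\<close>

definition leading :: "('x \<Rightarrow> nat) \<Rightarrow> ('x, 'a::comm_ring_1) mpoly \<Rightarrow> ('x \<Rightarrow>\<^sub>0 nat) \<Rightarrow> 'a \<Rightarrow> bool" where
  "leading \<omega> p \<mu> s \<longleftrightarrow> (\<forall>m \<in> keys (p - single \<mu> s). wt \<omega> m < wt \<omega> \<mu>)"

lemma leading_one: "leading \<omega> 1 0 1"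
  by (simp add: leading_def)

lemma leading_mult:
  assumes "leading \<omega> p \<mu> s" "leading \<omega> q \<nu> t"
  shows "leading \<omega> (p * q) (\<mu> + \<nu>) (s * t)"
  unfolding leading_def
proof
  define r r' where "r = p - single \<mu> s" and "r' = q - single \<nu> t"
  have r: "m \<in> keys r \<Longrightarrow> wt \<omega> m < wt \<omega> \<mu>" "m \<in> keys r' \<Longrightarrow> wt \<omega> m < wt \<omega> \<nu>" for m
    using assms by (auto simp: leading_def r_def r'_def)
  fix m assume m: "m \<in> keys (p * q - single (\<mu> + \<nu>) (s * t))"
  have "p * q - single (\<mu> + \<nu>) (s * t) =
      r * r' + (single \<mu> s * r' + r * single \<nu> t)"
    by (simp add: r_def r'_def algebra_simps mult_single)
  then have "m \<in> keys (r * r') \<or> m \<in> keys (single \<mu> s * r') \<or>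
      m \<in> keys (r * single \<nu> t)"
    using m subsetD[OF keys_add] by (metis UnE)
  then obtain a b where "m = a + b" "a \<in> keys r \<and> b \<in> keys r' \<or>
      a = \<mu> \<and> b \<in> keys r' \<or> a \<in> keys r \<and> b = \<nu>"
    using keys_mult[of r r'] keys_mult[of "single \<mu> s" r'] keys_mult[of r "single \<nu> t"]
    by (auto split: if_splits)
  then show "wt \<omega> m < wt \<omega> (\<mu> + \<nu>)" using r(1)[of a] r(2)[of b] by (auto simp: wt_add)
qed

lemma leading_power: "leading \<omega> p \<mu> s \<Longrightarrow> \<exists>\<mu>'. leading \<omega> (p ^ k) \<mu>' (s ^ k) \<and> (\<forall>x. lookup \<mu>' x = k * lookup \<mu> x)"
proof (induction k)
  case 0
  then show ?case by (intro exI[of _ 0]) (simp add: leading_one)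
next
  case (Suc k)
  then obtain \<mu>' where "leading \<omega> (p ^ k) \<mu>' (s ^ k)" "\<forall>x. lookup \<mu>' x = k * lookup \<mu> x" by blast
  then show ?case using Suc.prems
    by (intro exI[of _ "\<mu> + \<mu>'"]) (simp add: leading_mult lookup_add)
qed

lemma leading_monom_at:
  assumes "\<And>v. v \<in> B \<Longrightarrow> leading \<omega> (t v) (\<mu> v) (s v)" "finite B" "keys \<alpha> \<subseteq> B"
  shows "\<exists>\<mu>'. leading \<omega> (monom_at t \<alpha>) \<mu>' (\<Prod>v\<in>B. s v ^ lookup \<alpha> v) \<and>
    (\<forall>x. lookup \<mu>' x = (\<Sum>v\<in>B. lookup \<alpha> v * lookup (\<mu> v) x))"
proof -
  have "\<exists>\<mu>'. leading \<omega> (\<Prod>v\<in>C. t v ^ lookup \<alpha> v) \<mu>' (\<Prod>v\<in>C. s v ^ lookup \<alpha> v) \<and>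
    (\<forall>x. lookup \<mu>' x = (\<Sum>v\<in>C. lookup \<alpha> v * lookup (\<mu> v) x))"
    if "finite C" "C \<subseteq> B" for C
    using that
  proof (induction C)
    case empty
    then show ?case by (intro exI[of _ 0]) (simp add: leading_one)
  next
    case (insert v C)
    then obtain \<mu>' where 1: "leading \<omega> (\<Prod>v\<in>C. t v ^ lookup \<alpha> v) \<mu>' (\<Prod>v\<in>C. s v ^ lookup \<alpha> v)"
      "\<forall>x. lookup \<mu>' x = (\<Sum>v\<in>C. lookup \<alpha> v * lookup (\<mu> v) x)" by blast
    obtain \<nu> where 2: "leading \<omega> (t v ^ lookup \<alpha> v) \<nu> (s v ^ lookup \<alpha> v)"
      "\<forall>x. lookup \<nu> x = lookup \<alpha> v * lookup (\<mu> v) x"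
      using leading_power[OF assms(1)[of v]] insert.prems by blast
    show ?case using leading_mult[OF 2(1) 1(1)] insert.hyps 1(2) 2(2)
      by (intro exI[of _ "\<nu> + \<mu>'"]) (simp add: lookup_add)
  qed
  from this[OF assms(2) order_refl] show ?thesis
    by (simp add: monom_at_superset[OF assms(2,3)])
qed

text \<open>If the exponent vectors of the leading monomials are linearly independent over the
  integers, distinct monomials in the \<open>t v\<close> have distinct leading monomials, and the
  heaviest of these cannot cancel.\<close>

lemma independent_of_leading_monomials:
  fixes t :: "'v \<Rightarrow> ('x, 'a::field) mpoly"
  assumes lead: "\<And>v. v \<in> B \<Longrightarrow> leading \<omega> (t v) (\<mu> v) (s v)" "\<And>v. v \<in> B \<Longrightarrow> s v \<noteq> 0" and B: "finite B"
    and inj: "\<And>\<delta> :: 'v \<Rightarrow> int. (\<And>x. (\<Sum>v\<in>B. \<delta> v * int (lookup (\<mu> v) x)) = 0) \<Longrightarrow> \<forall>v\<in>B. \<delta> v = 0"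
    and p: "p \<in> polys B" "lin_ext const (monom_at t) p = 0"
  shows "p = 0"
proof (rule ccontr)
  assume "p \<noteq> 0"
  let ?K = "keys p"
  define S where "S \<alpha> = (\<Prod>v\<in>B. s v ^ lookup \<alpha> v)" for \<alpha>
  have S: "S \<alpha> \<noteq> 0" for \<alpha> using lead(2) B by (auto simp: S_def)
  have "\<forall>\<alpha>\<in>?K. \<exists>\<mu>'. leading \<omega> (monom_at t \<alpha>) \<mu>' (S \<alpha>) \<and>
      (\<forall>x. lookup \<mu>' x = (\<Sum>v\<in>B. lookup \<alpha> v * lookup (\<mu> v) x))"
    unfolding S_def using p(1) by (intro ballI leading_monom_at[OF lead(1) B]) (auto simp: polys_def)
  from bchoice[OF this] obtain M where "\<forall>\<alpha>\<in>?K. leading \<omega> (monom_at t \<alpha>) (M \<alpha>) (S \<alpha>) \<and>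
      (\<forall>x. lookup (M \<alpha>) x = (\<Sum>v\<in>B. lookup \<alpha> v * lookup (\<mu> v) x))" ..
  then have M: "\<And>\<alpha>. \<alpha> \<in> ?K \<Longrightarrow> leading \<omega> (monom_at t \<alpha>) (M \<alpha>) (S \<alpha>)"
    "\<And>\<alpha> x. \<alpha> \<in> ?K \<Longrightarrow> lookup (M \<alpha>) x = (\<Sum>v\<in>B. lookup \<alpha> v * lookup (\<mu> v) x)"
    by simp_all
  have M_inj: "\<alpha> = \<beta>" if \<alpha>: "\<alpha> \<in> ?K" and \<beta>: "\<beta> \<in> ?K" and eq: "M \<alpha> = M \<beta>" for \<alpha> \<beta>
  proof -
    let ?\<delta> = "\<lambda>v. int (lookup \<alpha> v) - int (lookup \<beta> v)"
    have "(\<Sum>v\<in>B. ?\<delta> v * int (lookup (\<mu> v) x)) =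
        int (lookup (M \<alpha>) x) - int (lookup (M \<beta>) x)" for x
      by (simp add: M(2)[OF \<alpha>] M(2)[OF \<beta>] left_diff_distrib sum_subtractf)
    then have "\<forall>v\<in>B. ?\<delta> v = 0" using eq by (intro inj) simp
    moreover have "lookup \<alpha> v = 0 \<and> lookup \<beta> v = 0" if "v \<notin> B" for v
    proof -
      have "v \<notin> keys \<alpha>" "v \<notin> keys \<beta>"
        using that \<alpha> \<beta> p(1) by (auto simp: polys_def)
      then show ?thesis by (simp add: in_keys_iff)
    qed
    ultimately have "lookup \<alpha> v = lookup \<beta> v" for v
      by (cases "v \<in> B") auto
    then show ?thesis by (rule poly_mapping_eqI)
  qed
  define W where "W = Max ((\<lambda>\<alpha>. wt \<omega> (M \<alpha>)) ` ?K)"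
  have "W \<in> (\<lambda>\<alpha>. wt \<omega> (M \<alpha>)) ` ?K" unfolding W_def using \<open>p \<noteq> 0\<close> by (intro Max_in) auto
  then obtain \<alpha> where \<alpha>: "\<alpha> \<in> ?K" "wt \<omega> (M \<alpha>) = W" by auto
  have le: "wt \<omega> (M \<beta>) \<le> W" if "\<beta> \<in> ?K" for \<beta> using that by (simp add: W_def)
  have lookup: "lookup (monom_at t \<beta>) (M \<alpha>) = (if \<beta> = \<alpha> then S \<alpha> else 0)" if \<beta>: "\<beta> \<in> ?K" for \<beta>
  proof -
    have "M \<alpha> \<notin> keys (monom_at t \<beta> - single (M \<beta>) (S \<beta>))"
      using M(1)[OF \<beta>] le[OF \<beta>] \<alpha>(2) by (force simp: leading_def)
    then have "lookup (monom_at t \<beta>) (M \<alpha>) = lookup (single (M \<beta>) (S \<beta>)) (M \<alpha>)"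
      by (simp add: in_keys_iff lookup_minus)
    then show ?thesis using M_inj[OF \<beta> \<alpha>(1)] by (auto simp: lookup_single when_def)
  qed
  have const_lookup: "lookup (const c * q) m = c * lookup q m" for c :: 'a and q :: "('x, 'a) mpoly" and m
    by (induction q rule: poly_mapping_single_induct)
      (simp_all add: mult_single lookup_single when_def lookup_add distrib_left)
  have "0 = lookup (lin_ext const (monom_at t) p) (M \<alpha>)" by (simp add: p(2))
  also have "\<dots> = (\<Sum>\<beta>\<in>?K. lookup p \<beta> * lookup (monom_at t \<beta>) (M \<alpha>))"
    by (simp add: lin_ext_def lookup_sum const_lookup)
  also have "\<dots> = lookup p \<alpha> * S \<alpha>"
    using \<alpha>(1) by (simp add: lookup if_distrib[of "\<lambda>x. _ * x"] cong: if_cong)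
  finally show False using S \<alpha>(1) by (simp add: in_keys_iff)
qed

text \<open>The coordinate of an exponent vector at \<open>X u\<close> counts arcs with tail
  \<open>u\<close>, and at \<open>Y u\<close> those with head \<open>u\<close>. An integer relation
  among the leading monomials thus satisfies the hypotheses of
  \<open>alternating_trail_exists\<close>. The scalars \<open>s v\<close> allow for the sign of an
  arc directed against the vertex order.\<close>

theorem orientation_independent:
  fixes arc :: "'v \<Rightarrow> nat \<times> nat" and t :: "'v \<Rightarrow> (xy_var, 'a::field) mpoly"
  assumes B: "finite B" and inj: "inj_on (\<lambda>v. (\<lambda>(i, j). {i, j}) (arc v)) B"
    and D: "acyclic (arc ` B)" "\<And>w. \<not> alternating_closed_trail (arc ` B) w"
    and t: "\<And>v. v \<in> B \<Longrightarrow> t v = const (s v) *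
      (mvar (X (fst (arc v))) * mvar (Y (snd (arc v))) - mvar (X (snd (arc v))) * mvar (Y (fst (arc v))))"
    and s: "\<And>v. v \<in> B \<Longrightarrow> s v \<noteq> 0"
    and p: "p \<in> polys B" "lin_ext const (monom_at t) p = 0"
  shows "p = 0"
proof -
  let ?D = "arc ` B"
  \<comment> \<open>The number of strict ancestors increases along arcs by acyclicity; as weight of
    \<open>Y\<close> it makes the monomial \<open>X\<close> of the tail times \<open>Y\<close> of
    the head the heavier one.\<close>
  define \<rho> where "\<rho> u = card {w. (w, u) \<in> ?D\<^sup>+}" for u
  define \<omega> where "\<omega> x = (case x of X i \<Rightarrow> 0 | Y j \<Rightarrow> \<rho> j)" for x
  define \<mu> where "\<mu> v = single (X (fst (arc v))) 1 + single (Y (snd (arc v))) (1::nat)" for v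
  have \<rho>_less: "\<rho> i < \<rho> j" if ij: "(i, j) \<in> ?D" for i j
    unfolding \<rho>_def
  proof (rule psubset_card_mono)
    have "{w. (w, j) \<in> ?D\<^sup>+} \<subseteq> Domain (?D\<^sup>+)" by blast
    then show "finite {w. (w, j) \<in> ?D\<^sup>+}"
      by (rule finite_subset) (use B in \<open>simp add: finite_Domain trancl_domain\<close>)
    have "(i, i) \<notin> ?D\<^sup>+" using D(1) by (simp add: acyclic_def)
    moreover have "(i, j) \<in> ?D\<^sup>+" "\<And>w. (w, i) \<in> ?D\<^sup>+ \<Longrightarrow> (w, j) \<in> ?D\<^sup>+"
      using ij by (blast intro: trancl_into_trancl)+
    ultimately show "{w. (w, i) \<in> ?D\<^sup>+} \<subset> {w. (w, j) \<in> ?D\<^sup>+}" by blast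
  qed
  have inj_arc: "inj_on arc B" using inj by (auto simp: inj_on_def)
  show ?thesis
  proof (rule independent_of_leading_monomials[of B \<omega> t \<mu> s])
    fix v assume v: "v \<in> B"
    obtain i j where ij: "arc v = (i, j)" by (cases "arc v")
    then have less: "\<rho> i < \<rho> j" using \<rho>_less v by force
    let ?m = "single (X j) 1 + single (Y i) (1::nat)"
    have "t v - single (\<mu> v) (s v) = single ?m (- s v)"
      using t[OF v] by (simp add: ij \<mu>_def mvar_def mult_single right_diff_distrib single_uminus)
    then show "leading \<omega> (t v) (\<mu> v) (s v)"
      using less s[OF v] by (simp add: leading_def wt_add \<mu>_def ij \<omega>_def)
  next
    fix \<delta> :: "'v \<Rightarrow> int"
    assume sums: "\<And>x. (\<Sum>v\<in>B. \<delta> v * int (lookup (\<mu> v) x)) = 0"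
    define \<delta>' where "\<delta>' d = \<delta> (the_inv_into B arc d)" for d
    have \<delta>': "\<delta>' (arc v) = \<delta> v" if "v \<in> B" for v
      using the_inv_into_f_f[OF inj_arc that] by (simp add: \<delta>'_def)
    have reindex: "(\<Sum>d | d \<in> ?D \<and> P d. \<delta>' d) = (\<Sum>v\<in>B. if P (arc v) then \<delta> v else 0)" for P
    proof -
      have "{d \<in> ?D. P d} = arc ` {v \<in> B. P (arc v)}" by auto
      then have "(\<Sum>d | d \<in> ?D \<and> P d. \<delta>' d) = (\<Sum>v | v \<in> B \<and> P (arc v). \<delta>' (arc v))"
        using inj_on_subset[OF inj_arc] by (simp add: sum.reindex)
      also have "\<dots> = (\<Sum>v\<in>B. if P (arc v) then \<delta> v else 0)"
        using B \<delta>' by (simp add: sum.If_cases Int_def)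
      finally show ?thesis .
    qed
    show "\<forall>v\<in>B. \<delta> v = 0"
    proof (rule ccontr)
      assume "\<not> ?thesis"
      then obtain v0 where v0: "v0 \<in> B" "\<delta> v0 \<noteq> 0" by blast
      have "\<exists>w. alternating_closed_trail ?D w"
      proof (rule alternating_trail_exists[of ?D \<delta>' "arc v0"])
        show "finite ?D" using B by simp
        show "inj_on (\<lambda>(u, v). {u, v}) ?D" using inj by (auto simp: inj_on_def)
        show "arc v0 \<in> ?D" "\<delta>' (arc v0) \<noteq> 0" using v0 \<delta>' by auto
        show "(\<Sum>d | d \<in> ?D \<and> fst d = u. \<delta>' d) = 0" for u
        proof -
          have "\<delta> v * int (lookup (\<mu> v) (X u)) = (if fst (arc v) = u then \<delta> v else 0)" for v
            by (simp add: \<mu>_def lookup_add lookup_single when_def)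
          then show ?thesis using sums[of "X u"] unfolding reindex by simp
        qed
        show "(\<Sum>d | d \<in> ?D \<and> snd d = u. \<delta>' d) = 0" for u
        proof -
          have "\<delta> v * int (lookup (\<mu> v) (Y u)) = (if snd (arc v) = u then \<delta> v else 0)" for v
            by (simp add: \<mu>_def lookup_add lookup_single when_def)
          then show ?thesis using sums[of "Y u"] unfolding reindex by simp
        qed
      qed
      then show False using D(2) by blast
    qed
  qed (use B s p in auto)
qed

section \<open>The special fiber ring\<close>

lemma mpoly_ring_ops [simp]:
  "p \<otimes>\<^bsub>mpoly_ring T\<^esub> q = p * q" "p \<oplus>\<^bsub>mpoly_ring T\<^esub> q = p + q"
  "\<zero>\<^bsub>mpoly_ring T\<^esub> = 0" "\<one>\<^bsub>mpoly_ring T\<^esub> = 1"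
  by (simp_all add: mpoly_ring_def)

lemma cring_mpoly_ring: "cring (mpoly_ring T)"
proof (rule cringI)
  show "abelian_group (mpoly_ring T)"
  proof (rule abelian_groupI)
    fix x assume "x \<in> carrier (mpoly_ring T)"
    then show "\<exists>y\<in>carrier (mpoly_ring T). y \<oplus>\<^bsub>mpoly_ring T\<^esub> x = \<zero>\<^bsub>mpoly_ring T\<^esub>"
      unfolding carrier_mpoly_ring by (intro bexI[of _ "- x"]) (simp_all add: polys_uminus)
  qed (simp_all add: carrier_mpoly_ring polys_add add.assoc add.commute)
  show "comm_monoid (mpoly_ring T)"
    by (rule comm_monoidI) (simp_all add: carrier_mpoly_ring polys_mult mult.assoc mult.commute)
qed (simp add: distrib_right)

text \<open>The ring axioms of \<open>R\<close> are transported along the surjection, so they need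
  no separate verification for \<open>special_fiber\<close>. Prime ideals of \<open>R\<close> then
  correspond to primes above the kernel.\<close>

lemma krull_dim_of_surjection:
  fixes h :: "('v, 'a::comm_ring_1) mpoly \<Rightarrow> 'b" and R (structure)
  assumes h: "h \<in> ring_hom (mpoly_ring UNIV) R" and surj: "range h = carrier R" and zero: "h 0 = \<zero>"
  shows "krull_dim R = Sup {enat d | d. \<exists>P. (\<forall>i\<le>d. prime_set (P i) \<and> {p. h p = \<zero>} \<subseteq> P i) \<and> (\<forall>i<d. P i \<subset> P (Suc i))}"
proof -
  interpret S: cring "mpoly_ring UNIV :: ('v, 'a) mpoly ring" by (rule cring_mpoly_ring)
  have hom: "h (p + q) = h p \<oplus> h q" "h (p * q) = h p \<otimes> h q" "h 1 = \<one>" for p q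
    using ring_hom_memE[OF h] by (simp_all add: carrier_mpoly_ring)
  have "ring (R \<lparr>carrier := h ` carrier (mpoly_ring UNIV), zero := h \<zero>\<^bsub>mpoly_ring UNIV\<^esub>\<rparr>)"
    by (rule S.ring_hom_imp_img_ring[OF h])
  then have "ring R" using surj zero by (simp add: carrier_mpoly_ring)
  then interpret ring R .
  have "cring R"
  proof (rule cring.intro[OF \<open>ring R\<close>], unfold_locales)
    fix x y assume "x \<in> carrier R" "y \<in> carrier R"
    then obtain p q where "x = h p" "y = h q" using surj by (metis imageE)
    then show "x \<otimes> y = y \<otimes> x" by (simp add: mult.commute flip: hom(2))
  qed
  have h_car: "h p \<in> carrier R" for p using surj by blast
  have car: "\<exists>p. x = h p" if "x \<in> carrier R" for x using that surj by (metis imageE)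
  let ?N = "{p. h p = \<zero>}"
  have diff: "p - q \<in> ?N" if "h p = h q" for p q
  proof -
    have "h q = h (p - q) \<oplus> h q" using hom(1)[of "p - q" q] that by simp
    then show ?thesis using add.r_cancel_one'[of "h q" "h (p - q)"] h_car by simp
  qed
  have pre: "prime_set (h -` P) \<and> ?N \<subseteq> h -` P" if P: "primeideal P R" for P
  proof -
    interpret P: primeideal P R by fact
    have z: "\<zero> \<in> P" by simp
    have "prime_set (h -` P)"
    proof
      show "1 \<notin> h -` P" using P.I_notcarr P.one_imp_carrier by (auto simp: hom)
      fix a b r
      show "a * b \<in> h -` P \<Longrightarrow> a \<in> h -` P \<or> b \<in> h -` P" using P.I_prime[of "h a" "h b"] h_car by (auto simp: hom)
      show "a \<in> h -` P \<Longrightarrow> r * a \<in> h -` P" using h_car by (auto simp: hom P.I_l_closed)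
    qed (auto simp: hom zero z)
    then show ?thesis using z by auto
  qed
  have img: "primeideal (h ` P) R \<and> h -` (h ` P) = P" if P: "prime_set P" "?N \<subseteq> P" for P
  proof -
    interpret P: prime_set P by fact
    have pre_img: "h -` (h ` P) = P"
    proof (intro equalityI subsetI)
      fix p assume "p \<in> h -` (h ` P)"
      then obtain q where q: "q \<in> P" "h p = h q" by auto
      then have "p - q \<in> P" using diff P(2) by blast
      then show "p \<in> P" using q P.mem_of_diff by blast
    qed auto
    have "primeideal (h ` P) R"
    proof (rule primeidealI)
      show "ideal (h ` P) R"
      proof (rule idealI[OF \<open>ring R\<close>])
        show "subgroup (h ` P) (add_monoid R)"
        proof (rule add.subgroupI)
          show "h ` P \<subseteq> carrier R" using h_car by blast
          show "h ` P \<noteq> {}" using P.zero_mem by blast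
          fix x assume "x \<in> h ` P"
          then obtain p where p: "p \<in> P" "x = h p" by blast
          have "h (- p) \<oplus> h p = \<zero>" by (simp add: zero flip: hom(1))
          then have "\<ominus> x = h (- p)" using p h_car by (metis minus_equality)
          then show "\<ominus> x \<in> h ` P" using P.uminus_mem p by blast
        next
          fix x y assume "x \<in> h ` P" "y \<in> h ` P"
          then show "x \<oplus> y \<in> h ` P" using P.add_mem by (auto simp flip: hom(1))
        qed
      next
        fix a x assume "a \<in> h ` P" "x \<in> carrier R"
        then obtain p q where "p \<in> P" "a = h p" "x = h q" using car by blast
        then show "x \<otimes> a \<in> h ` P" "a \<otimes> x \<in> h ` P"
          using P.mult_mem[of p q] P.mult_mem2[of p q] by (auto simp flip: hom(2))
      qed
      show "cring R" by fact
      show "carrier R \<noteq> h ` P"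
      proof
        assume "carrier R = h ` P"
        then have "1 \<in> h -` (h ` P)" using h_car by auto
        then show False using pre_img P.one_not_mem by simp
      qed
      fix a b assume "a \<in> carrier R" "b \<in> carrier R" and ab: "a \<otimes> b \<in> h ` P"
      then obtain p q where pq: "a = h p" "b = h q" using car by metis
      then have "p * q \<in> h -` (h ` P)" using ab by (simp add: hom)
      then have "p \<in> P \<or> q \<in> P" using pre_img P.prime_mem by simp
      then show "a \<in> h ` P \<or> b \<in> h ` P" using pq by blast
    qed
    then show ?thesis using pre_img by blast
  qed
  have "(\<exists>P :: nat \<Rightarrow> 'b set. (\<forall>i\<le>d. primeideal (P i) R) \<and> (\<forall>i<d. P i \<subset> P (Suc i))) \<longleftrightarrow>
      (\<exists>P. (\<forall>i\<le>d. prime_set (P i) \<and> ?N \<subseteq> P i) \<and> (\<forall>i<d. P i \<subset> P (Suc i)))" (is "?L \<longleftrightarrow> ?R") for d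
  proof
    assume ?L
    then obtain P :: "nat \<Rightarrow> 'b set" where P: "\<And>i. i \<le> d \<Longrightarrow> primeideal (P i) R" "\<And>i. i < d \<Longrightarrow> P i \<subset> P (Suc i)" by blast
    have "h -` P i \<subset> h -` P (Suc i)" if i: "i < d" for i
    proof -
      obtain x where x: "x \<in> P (Suc i)" "x \<notin> P i" using P(2)[OF i] by blast
      interpret Q: primeideal "P (Suc i)" R using P(1) i by simp
      obtain p where "x = h p" using car[OF Q.Icarr[OF x(1)]] by blast
      then show ?thesis using x P(2)[OF i] by blast
    qed
    then show ?R using pre P(1) by (intro exI[of _ "\<lambda>i. h -` P i"]) simp
  next
    assume ?R
    then obtain P where P: "\<And>i. i \<le> d \<Longrightarrow> prime_set (P i) \<and> ?N \<subseteq> P i" "\<And>i. i < d \<Longrightarrow> P i \<subset> P (Suc i)" by blast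
    have "h ` P i \<subset> h ` P (Suc i)" if "i < d" for i
    proof -
      have "h -` (h ` P i) = P i" "h -` (h ` P (Suc i)) = P (Suc i)" using img P(1) that by auto
      then show ?thesis using P(2)[OF that] by blast
    qed
    then show ?L using img P(1) by (intro exI[of _ "\<lambda>i. h ` P i"]) simp
  qed
  then show ?thesis by (simp add: krull_dim_def)
qed

section \<open>Grading by total degree\<close>

abbreviation tdeg :: "('x \<Rightarrow>\<^sub>0 nat) \<Rightarrow> nat" where "tdeg \<equiv> wt (\<lambda>_. 1)"

definition hom_comp :: "nat \<Rightarrow> ('v, 'a::comm_ring_1) mpoly \<Rightarrow> ('v, 'a) mpoly" where
  "hom_comp k p = (\<Sum>m\<in>keys p. if tdeg m = k then single m (lookup p m) else 0)"

lemma lookup_hom_comp: "lookup (hom_comp k p) m = (if tdeg m = k then lookup p m else 0)"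
proof -
  have "lookup (hom_comp k p) m =
      (\<Sum>m'\<in>keys p. if m' = m then (if tdeg m = k then lookup p m else 0) else 0)"
    unfolding hom_comp_def lookup_sum by (intro sum.cong) (auto simp: lookup_single when_def)
  then show ?thesis by (simp add: in_keys_iff)
qed

lemma hom_comp_add: "hom_comp k (p + q) = hom_comp k p + hom_comp k q"
  by (rule poly_mapping_eqI) (simp add: lookup_hom_comp lookup_add)

lemma hom_comp_zero [simp]: "hom_comp k 0 = 0"
  by (rule poly_mapping_eqI) (simp add: lookup_hom_comp)

lemma hom_comp_single: "hom_comp k (single m c) = (if tdeg m = k then single m c else 0)"
  by (rule poly_mapping_eqI) (auto simp: lookup_hom_comp lookup_single when_def)

text \<open>The same convolution as in the product of \<open>special_fiber\<close>.\<close>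

lemma hom_comp_mult: "hom_comp k (p * q) = (\<Sum>i\<le>k. hom_comp i p * hom_comp (k - i) q)"
proof (induction p rule: poly_mapping_single_induct)
  case (single m c)
  show ?case
  proof (induction q rule: poly_mapping_single_induct)
    case (single n d)
    have "(\<Sum>i\<le>k. hom_comp i (single m c) * hom_comp (k - i) (single n d)) =
        (\<Sum>i\<le>k. if i = tdeg m then (if tdeg m + tdeg n = k then single (m + n) (c * d) else 0) else 0)"
      by (intro sum.cong) (auto simp: hom_comp_single mult_single)
    then show ?case by (auto simp: hom_comp_single mult_single wt_add)
  qed (simp add: distrib_left hom_comp_add sum.distrib)
qed (simp add: distrib_right hom_comp_add sum.distrib)

definition homogeneous :: "nat \<Rightarrow> ('v, 'a::comm_ring_1) mpoly \<Rightarrow> bool" where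
  "homogeneous k p \<longleftrightarrow> (\<forall>m\<in>keys p. tdeg m = k)"

lemma homogeneous_hom_comp: "homogeneous k (hom_comp k p)"
  by (auto simp: homogeneous_def in_keys_iff lookup_hom_comp split: if_splits)

lemma hom_comp_homogeneous: "homogeneous k p \<Longrightarrow> hom_comp j p = (if j = k then p else 0)"
  by (rule poly_mapping_eqI) (auto simp: homogeneous_def lookup_hom_comp in_keys_iff)

lemma homogeneous_zero: "homogeneous k 0"
  by (simp add: homogeneous_def)

lemma homogeneous_add: "homogeneous k p \<Longrightarrow> homogeneous k q \<Longrightarrow> homogeneous k (p + q)"
  unfolding homogeneous_def using keys_add[of p q] by blast

lemma homogeneous_sum: "(\<And>i. i \<in> I \<Longrightarrow> homogeneous k (f i)) \<Longrightarrow> homogeneous k (sum f I)"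
  by (induction I rule: infinite_finite_induct) (simp_all add: homogeneous_zero homogeneous_add)

lemma homogeneous_mult: "homogeneous k p \<Longrightarrow> homogeneous l q \<Longrightarrow> homogeneous (k + l) (p * q)"
  unfolding homogeneous_def using keys_mult[of p q] by (force simp: wt_add)

lemma homogeneous_const: "homogeneous 0 (const c)"
  by (simp add: homogeneous_def)

lemma homogeneous_mvar: "homogeneous 1 (mvar v)"
  by (simp add: homogeneous_def mvar_def)

lemma hom_comp_eventually_zero: "finite {k. hom_comp k p \<noteq> 0}"
proof (rule finite_subset)
  show "{k. hom_comp k p \<noteq> 0} \<subseteq> tdeg ` keys p"
  proof
    fix k assume "k \<in> {k. hom_comp k p \<noteq> 0}"
    then have "keys (hom_comp k p) \<noteq> {}" by simp
    then obtain m where "m \<in> keys (hom_comp k p)" by blast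
    then have "lookup (hom_comp k p) m \<noteq> 0" by (simp add: in_keys_iff)
    then show "k \<in> tdeg ` keys p" by (auto simp: lookup_hom_comp in_keys_iff split: if_splits)
  qed
qed simp

section \<open>Ideals of \<open>mpoly_ring\<close> in terms of the type class operations\<close>

lemma ideal_mpoly_ringI:
  assumes "J \<subseteq> polys T" "0 \<in> J" "\<And>a b. a \<in> J \<Longrightarrow> b \<in> J \<Longrightarrow> a + b \<in> J"
    "\<And>r a. r \<in> polys T \<Longrightarrow> a \<in> J \<Longrightarrow> r * a \<in> J"
  shows "ideal J (mpoly_ring T)"
proof -
  interpret S: cring "mpoly_ring T" by (rule cring_mpoly_ring)
  have minus: "\<ominus>\<^bsub>mpoly_ring T\<^esub> a = - a" if "a \<in> polys T" for a
    using that by (intro S.minus_equality) (simp_all add: carrier_mpoly_ring polys_uminus)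
  show ?thesis
  proof (rule idealI[OF S.ring_axioms])
    show "subgroup J (add_monoid (mpoly_ring T))"
    proof (rule S.add.subgroupI)
      fix a assume a: "a \<in> J"
      have "(- 1) * a \<in> J" using a by (intro assms(4)) (simp_all add: polys_uminus)
      then show "\<ominus>\<^bsub>mpoly_ring T\<^esub> a \<in> J" using minus[of a] a assms(1) by auto
    qed (use assms in \<open>auto simp: carrier_mpoly_ring\<close>)
  next
    fix a x :: "('a, 'b) mpoly" assume "a \<in> J" "x \<in> carrier (mpoly_ring T)"
    then have "x * a \<in> J" by (simp add: carrier_mpoly_ring assms(4))
    then show "x \<otimes>\<^bsub>mpoly_ring T\<^esub> a \<in> J" "a \<otimes>\<^bsub>mpoly_ring T\<^esub> x \<in> J" by (simp_all add: mult.commute)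
  qed
qed

lemma ideal_mpoly_ringD:
  assumes "ideal J (mpoly_ring T)"
  shows "J \<subseteq> polys T" "0 \<in> J" "a \<in> J \<Longrightarrow> b \<in> J \<Longrightarrow> a + b \<in> J" "r \<in> polys T \<Longrightarrow> a \<in> J \<Longrightarrow> r * a \<in> J"
    "a \<in> J \<Longrightarrow> - a \<in> J"
proof -
  interpret J: ideal J "mpoly_ring T" by fact
  show "J \<subseteq> polys T" using J.a_subset by (simp add: carrier_mpoly_ring)
  show "0 \<in> J" using additive_subgroup.zero_closed[OF ideal.axioms(1)[OF assms]] by simp
  show "a \<in> J \<Longrightarrow> b \<in> J \<Longrightarrow> a + b \<in> J"
    using additive_subgroup.a_closed[OF ideal.axioms(1)[OF assms]] by simp
  show mult: "r \<in> polys T \<Longrightarrow> a \<in> J \<Longrightarrow> r * a \<in> J" for r using J.I_l_closed[of a r] by (simp add: carrier_mpoly_ring)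
  show "a \<in> J \<Longrightarrow> - a \<in> J" using mult[of "- 1"] by (simp add: polys_uminus)
qed

text \<open>The family is indexed by a whole type; a finite family can be padded with zeros, which
  are homogeneous of every degree.\<close>

locale homogeneous_generators =
  fixes T :: "'x set" and g :: "'v \<Rightarrow> ('x, 'a::field) mpoly" and d :: nat
  assumes g_polys: "g v \<in> polys T" and g_hom: "homogeneous d (g v)" and d_pos: "d \<ge> 1"
begin

abbreviation "S \<equiv> mpoly_ring T"

sublocale S: cring S by (rule cring_mpoly_ring)
sublocale ev: character_ext "const :: 'a \<Rightarrow> ('x, 'a) mpoly" "monom_at g"
  by unfold_locales (simp_all add: monom_at_add single_add mult_single)

abbreviation "ev \<equiv> lin_ext const (monom_at g)"

definition mm where "mm = Idl\<^bsub>S\<^esub> (mvar ` T)"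
definition I where "I = Idl\<^bsub>S\<^esub> (range g)"
definition J where "J k = ideal_power S I k"
definition Q where "Q k = ideal_prod S mm (J k)"

text \<open>The filtration by lowest degree separates forms of degree \<open>d * k\<close> from
  \<open>Q k\<close>, which starts in degree \<open>d * k + 1\<close>.\<close>

definition low :: "nat \<Rightarrow> ('x, 'a) mpoly set" where
  "low n = {p \<in> polys T. \<forall>m \<in> keys p. n \<le> tdeg m}"

lemma ideal_low: "ideal (low n) S"
proof (rule ideal_mpoly_ringI)
  show "a + b \<in> low n" if "a \<in> low n" "b \<in> low n" for a b
    using that keys_add[of a b] by (auto simp: low_def polys_add)
  show "r * a \<in> low n" if "r \<in> polys T" "a \<in> low n" for r a
    using that keys_mult[of r a] by (force simp: low_def polys_mult wt_add)
qed (auto simp: low_def)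

lemma low_mult: "a \<in> low i \<Longrightarrow> b \<in> low j \<Longrightarrow> a * b \<in> low (i + j)"
  using keys_mult[of a b] by (fastforce simp: low_def polys_mult wt_add intro: add_mono)

lemma ideal_prod_low: "A \<subseteq> low i \<Longrightarrow> B \<subseteq> low j \<Longrightarrow> ideal_prod S A B \<subseteq> low (i + j)"
proof
  fix x assume AB: "A \<subseteq> low i" "B \<subseteq> low j" and "x \<in> ideal_prod S A B"
  from this(3) show "x \<in> low (i + j)"
  proof (induction rule: ideal_prod.induct)
    case (prod a b)
    then show ?case using AB low_mult[of a i b j] by auto
  next
    case (sum a b)
    then show ?case using ideal_mpoly_ringD(3)[OF ideal_low] by simp
  qed
qed

lemma mm_ideal: "ideal mm S"
  unfolding mm_def by (rule S.genideal_ideal) (auto simp: carrier_mpoly_ring polys_mvar)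

lemma mvar_in_mm: "x \<in> T \<Longrightarrow> mvar x \<in> mm"
  unfolding mm_def by (rule subsetD[OF S.genideal_self]) (auto simp: carrier_mpoly_ring polys_mvar)

lemma mm_low: "mm \<subseteq> low 1"
  unfolding mm_def by (rule S.genideal_minimal[OF ideal_low]) (auto simp: low_def polys_mvar, simp add: mvar_def)

text \<open>Allows polynomial coefficients to be replaced by scalars modulo \<open>mm\<close>, so
  that elements of \<open>J k\<close> are represented by values of forms with scalar
  coefficients.\<close>

lemma constant_part: "p \<in> polys T \<Longrightarrow> p - const (lookup p 0) \<in> mm"
proof (induction p rule: polys_induct)
  case (single m c)
  show ?case
  proof (cases "m = 0")
    case True
    then show ?thesis using ideal_mpoly_ringD(2)[OF mm_ideal] by simp
  next
    case False
    then have "keys m \<noteq> {}" by simp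
    then obtain x where x: "x \<in> keys m" by blast
    define m' where "m' = m - single x 1"
    have m: "m = m' + single x 1"
      using x by (intro poly_mapping_eqI) (auto simp: m'_def lookup_add lookup_minus lookup_single when_def in_keys_iff)
    have "keys m' \<subseteq> keys m" by (auto simp: m'_def in_keys_iff lookup_minus)
    then have "single m' c * mvar x \<in> mm"
      using x single by (intro ideal_mpoly_ringD(4)[OF mm_ideal] mvar_in_mm polys_single) auto
    moreover have "single m' c * mvar x = single m c"
      by (subst m) (simp add: mvar_def mult_single)
    ultimately show ?thesis using False by (simp add: lookup_single when_def)
  qed
next
  case (add p q)
  then show ?case
    using ideal_mpoly_ringD(3)[OF mm_ideal add] by (simp add: lookup_add single_add algebra_simps)
qed

lemma I_ideal: "ideal I S"
  unfolding I_def by (rule S.genideal_ideal) (auto simp: carrier_mpoly_ring g_polys)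

lemma g_in_I: "g v \<in> I"
  unfolding I_def by (rule subsetD[OF S.genideal_self]) (auto simp: carrier_mpoly_ring g_polys)

sublocale ideals: comm_monoid "ideals_set S" by (rule S.ideals_set_is_comm_monoid)

lemma J_ideal: "ideal (J k) S"
  using ideals.nat_pow_closed[of I k] I_ideal by (simp add: J_def ideals_set_def)

lemma J_0: "J 0 = polys T"
  by (simp add: J_def) (simp add: ideals_set_def carrier_mpoly_ring)

lemma J_add: "J (i + j) = ideal_prod S (J i) (J j)"
  using ideals.nat_pow_mult[of I i j] I_ideal by (simp add: J_def) (simp add: ideals_set_def)

lemma J_1: "J 1 = I"
proof -
  have "I \<in> carrier (ideals_set S)" using I_ideal by (simp add: ideals_set_def)
  then show ?thesis by (simp add: J_def)
qed

lemma J_mult: "a \<in> J i \<Longrightarrow> b \<in> J j \<Longrightarrow> a * b \<in> J (i + j)"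
  using ideal_prod.prod[of a "J i" b "J j" S] by (simp add: J_add)

lemma Q_ideal: "ideal (Q k) S"
  unfolding Q_def by (rule S.ideal_prod_is_ideal[OF mm_ideal J_ideal])

lemma Q_0: "Q 0 = mm"
  unfolding Q_def J_0 using S.ideal_prod_one[OF mm_ideal] by (simp add: carrier_mpoly_ring)

lemma mm_mult_J: "r \<in> mm \<Longrightarrow> a \<in> J k \<Longrightarrow> r * a \<in> Q k"
  using ideal_prod.prod[of r mm a "J k" S] by (simp add: Q_def)

lemma Q_mult_J: "a \<in> Q i \<Longrightarrow> b \<in> J j \<Longrightarrow> a * b \<in> Q (i + j)"
proof -
  assume "a \<in> Q i" and b: "b \<in> J j"
  then show ?thesis unfolding Q_def[of i]
  proof (induction a rule: ideal_prod.induct)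
    case (prod r a)
    then show ?case using mm_mult_J[OF prod(1) J_mult[OF prod(2) b]] by (simp add: mult.assoc)
  next
    case (sum s t)
    then show ?case using ideal_mpoly_ringD(3)[OF Q_ideal] by (simp add: distrib_right)
  qed
qed

lemma J_mult_Q: "a \<in> J i \<Longrightarrow> b \<in> Q j \<Longrightarrow> a * b \<in> Q (i + j)"
  using Q_mult_J[of b j a i] by (simp add: mult.commute add.commute)

lemma Q_subset_J: "Q k \<subseteq> J k"
  unfolding Q_def using S.ideal_prod_inter[OF mm_ideal J_ideal] by blast

lemma J_low: "J k \<subseteq> low (d * k)"
proof (induction k)
  case 0
  show ?case by (auto simp: J_0 low_def)
next
  case (Suc k)
  have "I \<subseteq> low d"
    unfolding I_def using g_polys g_hom
    by (intro S.genideal_minimal[OF ideal_low]) (auto simp: low_def homogeneous_def)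
  then have "J (k + 1) \<subseteq> low (d * k + d)" unfolding J_add J_1 by (rule ideal_prod_low[OF Suc])
  then show ?case by (simp add: add.commute)
qed

lemma Q_low: "Q k \<subseteq> low (Suc (d * k))"
  using ideal_prod_low[OF mm_low J_low[of k]] by (simp add: Q_def)

lemma ev_mvar: "ev (mvar v) = g v"
  by (simp add: mvar_def ev.ev_single)

lemma ev_const: "ev (const c) = const c"
  by (simp add: ev.ev_single)

lemma monom_at_J: "monom_at g m \<in> J (tdeg m)"
proof -
  have pow: "g v ^ k \<in> J k" for v k
  proof (induction k)
    case (Suc k)
    have "g v ^ k * g v \<in> J (k + 1)" using g_in_I[of v] Suc by (intro J_mult) (simp_all add: J_1[simplified])
    then show ?case by (simp add: mult.commute)
  qed (simp add: J_0)
  have "(\<Prod>v\<in>B. g v ^ lookup m v) \<in> J (\<Sum>v\<in>B. lookup m v)" if "finite B" for B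
    using that by (induction B) (simp_all add: J_0 J_mult pow)
  then show ?thesis by (simp add: monom_at_def wt_def)
qed

lemma ev_J: "homogeneous k p \<Longrightarrow> ev p \<in> J k"
proof -
  assume p: "homogeneous k p"
  have "(\<Sum>m\<in>M. const (lookup p m) * monom_at g m) \<in> J k"
    if "finite M" "M \<subseteq> keys p" for M
    using that
  proof (induction M)
    case (insert m M)
    then have "monom_at g m \<in> J k" using monom_at_J[of m] p by (auto simp: homogeneous_def)
    then show ?case using insert
      by (auto intro!: ideal_mpoly_ringD(3)[OF J_ideal] ideal_mpoly_ringD(4)[OF J_ideal])
  qed (simp add: ideal_mpoly_ringD(2)[OF J_ideal])
  then show ?thesis unfolding lin_ext_def by simp
qed

text \<open>The elements with such a representation form an ideal that contains every
  \<open>g v\<close>, hence \<open>I\<close>.\<close>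

lemma J_1_representation: "a \<in> J 1 \<Longrightarrow> \<exists>p. homogeneous 1 p \<and> a - ev p \<in> Q 1"
proof -
  define A where "A = {a \<in> J 1. \<exists>p. homogeneous 1 p \<and> a - ev p \<in> Q 1}"
  have "ideal A S"
  proof (rule ideal_mpoly_ringI)
    show "A \<subseteq> polys T" using ideal_mpoly_ringD(1)[OF J_ideal] by (auto simp: A_def)
    show "0 \<in> A"
      using ideal_mpoly_ringD(2)[OF J_ideal] ideal_mpoly_ringD(2)[OF Q_ideal]
      by (auto simp: A_def homogeneous_zero ev.ev_zero intro!: exI[of _ 0])
  next
    fix a b assume "a \<in> A" "b \<in> A"
    then obtain p q where *: "a \<in> J 1" "b \<in> J 1" "homogeneous 1 p" "homogeneous 1 q" "a - ev p \<in> Q 1" "b - ev q \<in> Q 1"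
      by (auto simp: A_def)
    have "a + b - ev (p + q) = (a - ev p) + (b - ev q)" by (simp add: ev.ev_add)
    also have "\<dots> \<in> Q 1" using * by (intro ideal_mpoly_ringD(3)[OF Q_ideal])
    finally have "a + b - ev (p + q) \<in> Q 1" .
    then show "a + b \<in> A"
      unfolding A_def using * ideal_mpoly_ringD(3)[OF J_ideal] homogeneous_add by blast
  next
    fix r a :: "('x, 'a) mpoly" assume r: "r \<in> polys T" and "a \<in> A"
    then obtain p where *: "a \<in> J 1" "homogeneous 1 p" "a - ev p \<in> Q 1" by (auto simp: A_def)
    let ?c = "lookup r 0"
    have "r * a - ev (const ?c * p) = const ?c * (a - ev p) + (r - const ?c) * a"
      by (simp add: ev.ev_mult ev_const algebra_simps)
    also have "\<dots> \<in> Q 1" using * constant_part[OF r]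
      by (intro ideal_mpoly_ringD(3)[OF Q_ideal] ideal_mpoly_ringD(4)[OF Q_ideal] mm_mult_J) simp_all
    finally have "r * a - ev (const ?c * p) \<in> Q 1" .
    moreover have "homogeneous 1 (const ?c * p)" using homogeneous_mult[OF homogeneous_const *(2)] by simp
    moreover have "r * a \<in> J 1" using ideal_mpoly_ringD(4)[OF J_ideal] r * by blast
    ultimately show "r * a \<in> A" by (auto simp: A_def)
  qed
  moreover have "range g \<subseteq> A"
  proof
    fix x assume "x \<in> range g"
    then obtain v where v: "x = g v" by blast
    have "x - ev (mvar v) \<in> Q 1" using ideal_mpoly_ringD(2)[OF Q_ideal] by (simp add: v ev_mvar)
    then show "x \<in> A" using g_in_I[of v] homogeneous_mvar[of v] unfolding A_def J_1 v by blast
  qed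
  ultimately have "I \<subseteq> A" unfolding I_def by (rule S.genideal_minimal)
  then show "a \<in> J 1 \<Longrightarrow> ?thesis" unfolding J_1 A_def by blast
qed

lemma J_representation: "a \<in> J k \<Longrightarrow> \<exists>p. homogeneous k p \<and> a - ev p \<in> Q k"
proof (induction k arbitrary: a)
  case 0
  then have "a - ev (const (lookup a 0)) \<in> Q 0"
    using constant_part by (simp add: J_0 Q_0 ev_const)
  then show ?case using homogeneous_const by blast
next
  case (Suc k)
  have "a \<in> ideal_prod S (J k) (J 1)" using Suc.prems J_add[of k 1] by simp
  then show ?case
  proof (induction a rule: ideal_prod.induct)
    case (prod b c)
    obtain p where p: "homogeneous k p" "b - ev p \<in> Q k" using Suc.IH[OF prod(1)] by blast
    obtain q where q: "homogeneous 1 q" "c - ev q \<in> Q 1" using J_1_representation[OF prod(2)] by blast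
    have "b * c - ev (p * q) = (b - ev p) * c + ev p * (c - ev q)"
      by (simp add: ev.ev_mult algebra_simps)
    also have "\<dots> \<in> Q (k + 1)"
      using Q_mult_J[OF p(2) prod(2)] J_mult_Q[OF ev_J[OF p(1)] q(2)] by (rule ideal_mpoly_ringD(3)[OF Q_ideal])
    finally show ?case using homogeneous_mult[OF p(1) q(1)] by auto
  next
    case (sum s t)
    then obtain p q where "homogeneous (Suc k) p" "s - ev p \<in> Q (Suc k)"
      "homogeneous (Suc k) q" "t - ev q \<in> Q (Suc k)" by blast
    then have "homogeneous (Suc k) (p + q)" "(s - ev p) + (t - ev q) \<in> Q (Suc k)"
      by (simp_all add: homogeneous_add ideal_mpoly_ringD(3)[OF Q_ideal])
    then show ?case by (intro exI[of _ "p + q"]) (simp add: ev.ev_add algebra_simps)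
  qed
qed

lemma homogeneous_ev: "homogeneous k p \<Longrightarrow> homogeneous (d * k) (ev p)"
proof -
  assume p: "homogeneous k p"
  have pow: "homogeneous (d * j) (g v ^ j)" for v j
    by (induction j) (use homogeneous_mult[OF g_hom] homogeneous_const[of 1] in auto)
  have prod: "homogeneous (d * (\<Sum>v\<in>B. lookup m v)) (\<Prod>v\<in>B. g v ^ lookup m v)" if "finite B" for B m
    using that
    by (induction B) (use homogeneous_mult[OF pow] homogeneous_const[of 1] in \<open>auto simp: distrib_left\<close>)
  have "homogeneous (d * tdeg m) (monom_at g m)" for m
    using prod[of "keys m" m] by (simp add: monom_at_def wt_def)
  then have "homogeneous (d * k) (monom_at g m)" if "m \<in> keys p" for m
    using p that by (metis homogeneous_def)
  then show ?thesis unfolding lin_ext_def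
    using homogeneous_mult[OF homogeneous_const] by (intro homogeneous_sum) fastforce
qed

text \<open>\<open>ev p\<close> is homogeneous of degree \<open>d * k\<close>, but every term of an
  element of \<open>Q k\<close> has larger degree. This gives injectivity of the presentation of the
  special fiber.\<close>

lemma ev_in_Q: "homogeneous k p \<Longrightarrow> ev p \<in> Q k \<longleftrightarrow> ev p = 0"
proof
  assume p: "homogeneous k p" and "ev p \<in> Q k"
  then have "\<forall>m\<in>keys (ev p). tdeg m = d * k \<and> Suc (d * k) \<le> tdeg m"
    using Q_low[of k] homogeneous_ev[OF p] by (auto simp: low_def homogeneous_def)
  then have "m \<notin> keys (ev p)" for m by fastforce
  then have "keys (ev p) = {}" by blast
  then show "ev p = 0" by simp
qed (simp add: ideal_mpoly_ringD(2)[OF Q_ideal])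

text \<open>Evaluation multiplies degrees by \<open>d\<close>, and \<open>d \<ge> 1\<close> keeps
  distinct degrees apart, so components cannot cancel each other.\<close>

lemma ev_eq_zero_iff: "ev p = 0 \<longleftrightarrow> (\<forall>k. ev (hom_comp k p) = 0)"
proof
  assume 0: "ev p = 0"
  have sum: "ev (hom_comp k p) = hom_comp (d * k) (ev p)" for k
  proof (induction p rule: poly_mapping_single_induct)
    case (single m c)
    have "homogeneous (d * tdeg m) (ev (single m c))"
      by (intro homogeneous_ev) (simp add: homogeneous_def)
    then show ?case using d_pos by (auto simp: hom_comp_single hom_comp_homogeneous ev.ev_zero)
  qed (simp add: hom_comp_add ev.ev_add)
  show "\<forall>k. ev (hom_comp k p) = 0" by (simp add: sum 0)
next
  assume *: "\<forall>k. ev (hom_comp k p) = 0"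
  define K where "K = tdeg ` keys p"
  have "p = (\<Sum>k\<in>K. hom_comp k p)"
    by (rule poly_mapping_eqI) (auto simp: lookup_sum lookup_hom_comp K_def in_keys_iff)
  then have "ev p = (\<Sum>k\<in>K. ev (hom_comp k p))" using ev.ev_sum by metis
  then show "ev p = 0" using * by simp
qed

section \<open>Cosets and the map onto the special fiber\<close>

abbreviation coset :: "nat \<Rightarrow> ('x, 'a) mpoly \<Rightarrow> ('x, 'a) mpoly set" where
  "coset k a \<equiv> Q k +>\<^bsub>S\<^esub> a"

lemma coset_eq: "coset k a = {q + a | q. q \<in> Q k}"
  by (auto simp: a_r_coset_def')

lemma coset_eq_iff: "coset k a = coset k b \<longleftrightarrow> a - b \<in> Q k"
proof
  assume "coset k a = coset k b"
  moreover have "a \<in> coset k a" using ideal_mpoly_ringD(2)[OF Q_ideal] by (force simp: coset_eq)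
  ultimately show "a - b \<in> Q k" by (auto simp: coset_eq)
next
  assume ab: "a - b \<in> Q k"
  have "coset k x \<subseteq> coset k y" if "x - y \<in> Q k" for x y
  proof
    fix z assume "z \<in> coset k x"
    then obtain q where "z = q + x" "q \<in> Q k" by (auto simp: coset_eq)
    then have "z = (q + (x - y)) + y" "q + (x - y) \<in> Q k"
      using ideal_mpoly_ringD(3)[OF Q_ideal _ that] by auto
    then show "z \<in> coset k y" unfolding coset_eq by blast
  qed
  from this[OF ab] this[of b a] show "coset k a = coset k b"
    using ideal_mpoly_ringD(5)[OF Q_ideal ab] by auto
qed

lemma coset_zero: "coset k 0 = Q k"
  by (simp add: coset_eq)

text \<open>\<open>rcoset_mult\<close> is a union over all representatives. Their products agree
  modulo \<open>Q (i + j)\<close>, because the correction terms are products of \<open>Q i\<close>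
  with \<open>J j\<close> and of \<open>J i\<close> with \<open>Q j\<close>.\<close>

lemma coset_mult:
  assumes "a \<in> J i" "b \<in> J j"
  shows "rcoset_mult S (Q (i + j)) (coset i a) (coset j b) = coset (i + j) (a * b)"
proof -
  have "coset (i + j) (x * y) = coset (i + j) (a * b)" if x: "x \<in> coset i a" and y: "y \<in> coset j b" for x y
  proof -
    obtain q r where q: "x = q + a" "q \<in> Q i" "y = r + b" "r \<in> Q j" using x y by (auto simp: coset_eq)
    have "x * y - a * b = q * y + a * r" by (simp add: q algebra_simps)
    moreover have "y \<in> J j" using q assms Q_subset_J ideal_mpoly_ringD(3)[OF J_ideal] by blast
    then have "q * y + a * r \<in> Q (i + j)"
      using q assms by (intro ideal_mpoly_ringD(3)[OF Q_ideal] Q_mult_J J_mult_Q)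
    ultimately show ?thesis by (simp add: coset_eq_iff)
  qed
  moreover have "coset i a \<noteq> {}" "coset j b \<noteq> {}"
    using ideal_mpoly_ringD(2)[OF Q_ideal] by (auto simp: coset_eq)
  ultimately show ?thesis unfolding rcoset_mult_def by auto
qed

lemma coset_add:
  assumes "a \<in> polys T" "b \<in> polys T"
  shows "coset k a <+>\<^bsub>S\<^esub> coset k b = coset k (a + b)"
proof -
  interpret Q: ideal "Q k" S by (rule Q_ideal)
  show ?thesis using Q.a_rcos_sum[of a b] assms by (simp add: carrier_mpoly_ring)
qed

lemma coset_carrier: "a \<in> polys T \<Longrightarrow> coset k a \<in> carrier (S Quot Q k)"
  using S.a_rcosetsI[OF ideal_mpoly_ringD(1)[OF Q_ideal, folded carrier_mpoly_ring], of a k]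
  by (simp add: FactRing_def carrier_mpoly_ring)

lemma coset_sum:
  assumes "finite A" "\<And>i. i \<in> A \<Longrightarrow> c i \<in> polys T"
  shows "(\<Oplus>\<^bsub>S Quot Q k\<^esub>i\<in>A. coset k (c i)) = coset k (\<Sum>i\<in>A. c i)"
proof -
  interpret Q: ideal "Q k" S by (rule Q_ideal)
  interpret quot: ring "S Quot Q k" by (rule Q.quotient_is_ring)
  show ?thesis using assms
  proof (induction A)
    case empty
    have "(\<Oplus>\<^bsub>S Quot Q k\<^esub>i\<in>{}. coset k (c i)) = \<zero>\<^bsub>S Quot Q k\<^esub>" by (rule quot.finsum_empty)
    then show ?case by (simp add: FactRing_def coset_zero)
  next
    case (insert i A)
    then have "(\<Oplus>\<^bsub>S Quot Q k\<^esub>j\<in>insert i A. coset k (c j)) = coset k (c i) \<oplus>\<^bsub>S Quot Q k\<^esub> (\<Oplus>\<^bsub>S Quot Q k\<^esub>j\<in>A. coset k (c j))"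
      by (intro quot.finsum_insert) (auto intro: coset_carrier)
    also have "\<dots> = coset k (c i) <+>\<^bsub>S\<^esub> coset k (\<Sum>j\<in>A. c j)"
      using insert by (simp add: FactRing_def)
    also have "\<dots> = coset k (c i + (\<Sum>j\<in>A. c j))"
      using insert by (intro coset_add) (auto intro: polys_sum)
    finally show ?case using insert by simp
  qed
qed

text \<open>The graded presentation of the special fiber with one variable per generator; its kernel
  is the ideal of polynomial relations among the \<open>g v\<close>.\<close>

definition fib :: "('v, 'a) mpoly \<Rightarrow> nat \<Rightarrow> ('x, 'a) mpoly set" where
  "fib p = (\<lambda>k. coset k (ev (hom_comp k p)))"

lemma fib_zero_iff: "fib p = Q \<longleftrightarrow> ev p = 0"
proof -
  have "fib p = Q \<longleftrightarrow> (\<forall>k. coset k (ev (hom_comp k p)) = coset k 0)"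
    unfolding fib_def fun_eq_iff coset_zero by (rule refl)
  also have "\<dots> \<longleftrightarrow> (\<forall>k. ev (hom_comp k p) = 0)"
    unfolding coset_eq_iff diff_zero ev_in_Q[OF homogeneous_hom_comp] by (rule refl)
  finally show ?thesis unfolding ev_eq_zero_iff[of p] .
qed

lemma special_fiber_simps:
  "carrier (special_fiber S mm I) = {f. (\<forall>k. f k \<in> {coset k a | a. a \<in> J k}) \<and> finite {k. f k \<noteq> Q k}}"
  "f \<otimes>\<^bsub>special_fiber S mm I\<^esub> f' = (\<lambda>k. \<Oplus>\<^bsub>S Quot Q k\<^esub>i\<in>{..k}. rcoset_mult S (Q k) (f i) (f' (k - i)))"
  "\<one>\<^bsub>special_fiber S mm I\<^esub> = (\<lambda>k. if k = 0 then coset 0 1 else Q k)"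
  "\<zero>\<^bsub>special_fiber S mm I\<^esub> = Q"
  "f \<oplus>\<^bsub>special_fiber S mm I\<^esub> f' = (\<lambda>k. f k <+>\<^bsub>S\<^esub> f' k)"
  by (simp_all add: special_fiber_def Let_def Q_def[abs_def] J_def cong: if_cong)

lemma ev_polys: "homogeneous k p \<Longrightarrow> ev p \<in> polys T"
  using ev_J ideal_mpoly_ringD(1)[OF J_ideal] by blast

lemma fib_hom: "fib \<in> ring_hom (mpoly_ring UNIV) (special_fiber S mm I)"
proof (rule ring_hom_memI)
  fix p q :: "('v, 'a) mpoly"
  show "fib p \<in> carrier (special_fiber S mm I)"
  proof -
    have "{k. fib p k \<noteq> Q k} \<subseteq> {k. hom_comp k p \<noteq> 0}" by (auto simp: fib_def ev.ev_zero coset_zero)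
    then show ?thesis using hom_comp_eventually_zero ev_J[OF homogeneous_hom_comp]
      by (auto simp: special_fiber_simps fib_def intro: finite_subset)
  qed
  show "fib (p \<otimes>\<^bsub>mpoly_ring UNIV\<^esub> q) = fib p \<otimes>\<^bsub>special_fiber S mm I\<^esub> fib q"
  proof
    fix k
    have "(fib p \<otimes>\<^bsub>special_fiber S mm I\<^esub> fib q) k =
        (\<Oplus>\<^bsub>S Quot Q k\<^esub>i\<in>{..k}. coset k (ev (hom_comp i p) * ev (hom_comp (k - i) q)))"
    proof -
      have "rcoset_mult S (Q k) (fib p i) (fib q (k - i)) = coset k (ev (hom_comp i p) * ev (hom_comp (k - i) q))" if "i \<le> k" for i
        using coset_mult[OF ev_J[OF homogeneous_hom_comp[of i p]] ev_J[OF homogeneous_hom_comp[of "k - i" q]]] that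
        by (simp add: fib_def)
      moreover have "coset k (ev (hom_comp i p) * ev (hom_comp (k - i) q)) \<in> carrier (S Quot Q k)" for i
        by (intro coset_carrier polys_mult ev_polys[OF homogeneous_hom_comp])
      ultimately show ?thesis
        unfolding special_fiber_simps
        by (intro abelian_monoid.finsum_cong'[OF abelian_group.axioms(1)[OF ring.is_abelian_group[OF ideal.quotient_is_ring[OF Q_ideal]]]]) auto
    qed
    also have "\<dots> = coset k (\<Sum>i\<le>k. ev (hom_comp i p) * ev (hom_comp (k - i) q))"
      by (rule coset_sum) (auto intro!: polys_mult ev_polys[OF homogeneous_hom_comp])
    also have "\<dots> = fib (p * q) k" by (simp add: fib_def hom_comp_mult ev.ev_sum ev.ev_mult)
    finally show "fib (p \<otimes>\<^bsub>mpoly_ring UNIV\<^esub> q) k = (fib p \<otimes>\<^bsub>special_fiber S mm I\<^esub> fib q) k" by simp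
  qed
  show "fib (p \<oplus>\<^bsub>mpoly_ring UNIV\<^esub> q) = fib p \<oplus>\<^bsub>special_fiber S mm I\<^esub> fib q"
    using coset_add[OF ev_polys[OF homogeneous_hom_comp] ev_polys[OF homogeneous_hom_comp]]
    by (simp add: special_fiber_simps fib_def hom_comp_add ev.ev_add)
  have "hom_comp k 1 = (if k = 0 then 1 else 0 :: ('v, 'a) mpoly)" for k
    using hom_comp_single[of k 0 1] by (auto simp del: One_nat_def)
  then show "fib \<one>\<^bsub>mpoly_ring UNIV\<^esub> = \<one>\<^bsub>special_fiber S mm I\<^esub>"
    by (auto simp: special_fiber_simps fib_def ev.ev_one ev.ev_zero coset_zero fun_eq_iff)
qed

lemma fib_surj: "range fib = carrier (special_fiber S mm I)"
proof (intro equalityI subsetI)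
  fix f assume "f \<in> range fib"
  then obtain p where "f = fib p" by blast
  then show "f \<in> carrier (special_fiber S mm I)"
    using ring_hom_closed[OF fib_hom, of p] by (simp add: carrier_mpoly_ring)
next
  fix f assume "f \<in> carrier (special_fiber S mm I)"
  then have f: "\<And>k. \<exists>a. a \<in> J k \<and> f k = coset k a" and fin: "finite {k. f k \<noteq> Q k}"
    by (auto simp: special_fiber_simps)
  define K where "K = {k. f k \<noteq> Q k}"
  have "\<exists>p. homogeneous k p \<and> f k = coset k (ev p)" for k
  proof -
    obtain a where a: "a \<in> J k" "f k = coset k a" using f by blast
    obtain p where "homogeneous k p" "a - ev p \<in> Q k" using J_representation[OF a(1)] by blast
    then show ?thesis using a(2) coset_eq_iff by blast
  qed
  then obtain p where p: "\<And>k. homogeneous k (p k)" "\<And>k. f k = coset k (ev (p k))" by metis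
  define P where "P = (\<Sum>k\<in>K. p k)"
  have "hom_comp j P = (if j \<in> K then p j else 0)" for j
  proof -
    have "hom_comp j P = (\<Sum>k\<in>K. hom_comp j (p k))"
      unfolding P_def by (induction K rule: infinite_finite_induct) (simp_all add: hom_comp_add)
    also have "\<dots> = (\<Sum>k\<in>K. if j = k then p k else 0)"
      using hom_comp_homogeneous[OF p(1)] by simp
    also have "\<dots> = (if j \<in> K then p j else 0)" using fin by (simp add: K_def)
    finally show ?thesis .
  qed
  then have "fib P = f"
    using p(2) by (auto simp: fib_def fun_eq_iff K_def ev.ev_zero coset_zero)
  then show "f \<in> range fib" by blast
qed

theorem krull_dim_special_fiber:
  "krull_dim (special_fiber S mm I) =
     Sup {enat e | e. \<exists>P. (\<forall>i\<le>e. prime_set (P i) \<and> {p. ev p = 0} \<subseteq> P i) \<and> (\<forall>i<e. P i \<subset> P (Suc i))}"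
proof -
  have "fib 0 = Q" using fib_zero_iff[of 0] ev.ev_zero by simp
  then show ?thesis
    using krull_dim_of_surjection[OF fib_hom fib_surj] fib_zero_iff by (simp add: special_fiber_simps)
qed

end

section \<open>Binomial edge ideals\<close>

fun xy_code :: "xy_var \<Rightarrow> nat" where
  "xy_code (X i) = 2 * i"
| "xy_code (Y i) = Suc (2 * i)"

lemma xy_code_inj: "xy_code a = xy_code b \<Longrightarrow> a = b"
  by (cases a; cases b) (simp_all, presburger+)

text \<open>Any linear order on the variables makes the polynomial ring an instance of \<^class>\<open>idom\<close>.\<close>

instantiation xy_var :: linorder
begin

definition less_eq_xy_var :: "xy_var \<Rightarrow> xy_var \<Rightarrow> bool" where
  "less_eq_xy_var a b \<longleftrightarrow> xy_code a \<le> xy_code b"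

definition less_xy_var :: "xy_var \<Rightarrow> xy_var \<Rightarrow> bool" where
  "less_xy_var a b \<longleftrightarrow> xy_code a < xy_code b"

instance
  by standard (auto simp: less_eq_xy_var_def less_xy_var_def intro: xy_code_inj)

end

section \<open>Binomials in the fraction field and orientations\<close>

lemma to_fract_sum: "to_fract (sum f I) = (\<Sum>i\<in>I. to_fract (f i))"
  by (induction I rule: infinite_finite_induct) simp_all

lemma to_fract_prod: "to_fract (prod f I) = (\<Prod>i\<in>I. to_fract (f i))"
  by (induction I rule: infinite_finite_induct) simp_all

lemma to_fract_power: "to_fract (a ^ k) = to_fract a ^ k"
  by (induction k) simp_all

text \<open>\<open>Min\<close> and \<open>Max\<close> fix the sign, so that the binomial is a
  function of the edge as a set.\<close>

definition edge_binomial :: "nat set \<Rightarrow> (xy_var, 'a::field) mpoly" where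
  "edge_binomial e = mvar (X (Min e)) * mvar (Y (Max e)) - mvar (X (Max e)) * mvar (Y (Min e))"

lemma edge_binomial_pair:
  "i \<noteq> j \<Longrightarrow> edge_binomial {i, j} = const (if i < j then 1 else - 1) * (mvar (X i) * mvar (Y j) - mvar (X j) * mvar (Y i))"
proof -
  assume "i \<noteq> j"
  have "const (- 1) * p = - p" for p :: "(xy_var, 'a) mpoly"
    by (simp add: single_uminus)
  then show ?thesis using \<open>i \<noteq> j\<close> by (auto simp: edge_binomial_def)
qed

lemma mvar_product_eq_iff:
  "mvar (X i) * mvar (Y j) = (mvar (X k) * mvar (Y l) :: (xy_var, 'a::field) mpoly) \<longleftrightarrow> i = k \<and> j = l"
proof
  assume "mvar (X i) * mvar (Y j) = (mvar (X k) * mvar (Y l) :: (xy_var, 'a) mpoly)"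
  then have eq: "single (X i) 1 + single (Y j) 1 =
      single (X k) 1 + single (Y l) (1::nat)"
    by (simp add: mvar_def mult_single) (metis lookup_single_eq lookup_single_not_eq zero_neq_one)
  have "lookup (single (X i) 1 + single (Y j) (1::nat)) (X i) = 1"
    "lookup (single (X i) 1 + single (Y j) (1::nat)) (Y j) = 1"
    by (simp_all add: lookup_add lookup_single when_def)
  then show "i = k \<and> j = l"
    unfolding eq by (auto simp: lookup_add lookup_single when_def split: if_splits)
qed simp

lemma edge_binomial_nonzero: "card e = 2 \<Longrightarrow> edge_binomial e \<noteq> (0 :: (xy_var, 'a::field) mpoly)"
proof -
  assume "card e = 2"
  then obtain i j where "e = {i, j}" "i \<noteq> j" by (auto simp: card_2_iff)
  then have "Min e \<noteq> Max e" by (auto simp: min_def max_def)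
  then show ?thesis by (simp add: edge_binomial_def mvar_product_eq_iff)
qed

lemma independent_binomials_orientation:
  fixes e :: "nat \<Rightarrow> nat set"
  assumes B: "finite B" and e: "inj_on e B" "\<And>v. v \<in> B \<Longrightarrow> e v \<subseteq> W \<and> card (e v) = 2" and W: "finite W"
    and g: "\<And>v. v \<in> B \<Longrightarrow> g v = (edge_binomial (e v) :: (xy_var, 'a::field) mpoly)"
    and indep: "\<And>p. p \<in> polys B \<Longrightarrow> lin_ext const (monom_at g) p = 0 \<Longrightarrow> p = 0"
  shows "\<exists>D. bij_betw (\<lambda>(u, v). {u, v}) D (e ` B) \<and> acyclic D \<and> \<not> (\<exists>w. alternating_closed_trail D w)"
proof -
  define h where "h c = to_fract (const c :: (xy_var, 'a) mpoly)" for c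
  \<comment> \<open>\<open>independent_valuation\<close> asks for \<open>t v \<noteq> 0\<close> at
    every index; the value 1 secures this outside \<open>B\<close>.\<close>
  define t where "t v = (if v \<in> B then to_fract (g v) else 1)" for v
  have t0: "t v \<noteq> 0" for v
    using e(2) g edge_binomial_nonzero[of "e v"] by (auto simp: t_def)
  have ev: "lin_ext h (monom_at t) p = to_fract (lin_ext const (monom_at g) p)" if p: "p \<in> polys B" for p
  proof -
    have "monom_at t m = to_fract (monom_at g m)" if "m \<in> keys p" for m
    proof -
      have "keys m \<subseteq> B" using p that by (auto simp: polys_def)
      then show ?thesis
        unfolding monom_at_def to_fract_prod by (intro prod.cong) (auto simp: t_def to_fract_power)
    qed
    then show ?thesis by (simp add: lin_ext_def to_fract_sum h_def)
  qed
  have hom: "h 0 = 0" "h 1 = 1" "h (a + b) = h a + h b" "h (a * b) = h a * h b" for a b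
    by (simp_all add: h_def single_add mult_single flip: to_fract_mult)
  obtain V where V: "valuation_set V"
    "\<And>m. keys m \<subseteq> B \<Longrightarrow> m \<noteq> 0 \<Longrightarrow> \<not> valuation_set.unit V (laurent_at t m)"
  proof (rule independent_valuation[of h t B])
    show "p = 0" if "p \<in> polys B" "lin_ext h (monom_at t) p = 0" for p
      using that ev indep by simp
  qed (use hom t0 in auto)
  interpret valuation_set V by fact
  have "independent B t"
    unfolding independent_def
  proof (intro conjI allI impI)
    fix a :: "nat \<Rightarrow> int" assume u: "unit (\<Prod>v\<in>B. t v powi a v)"
    define m where "m = (\<Sum>v\<in>B. single v (a v))"
    have lookup: "lookup m v = (if v \<in> B then a v else 0)" for v
      using B by (simp add: m_def lookup_sum lookup_single when_def)
    then have keys: "keys m \<subseteq> B" by (auto simp: in_keys_iff split: if_splits)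
    have "laurent_at t m = (\<Prod>v\<in>B. t v powi a v)"
      unfolding laurent_at_superset[OF B keys] using lookup by (intro prod.cong) auto
    then have "m = 0" using u V(2)[OF keys] by auto
    then show "\<forall>v\<in>B. a v = 0" using lookup by (metis lookup_zero)
  qed (use B t0 in auto)
  define x where "x i = to_fract (mvar (X i) :: (xy_var, 'a) mpoly)" for i
  define a where "a i = to_fract (mvar (Y i) :: (xy_var, 'a) mpoly) / x i" for i
  have x0: "x i \<noteq> 0" for i by (simp add: x_def mvar_def single_zero_eq_iff)
  have xa: "x i * x j * (a i - a j) =
      to_fract (mvar (X j) * mvar (Y i) - mvar (X i) * mvar (Y j) :: (xy_var, 'a) mpoly)" for i j
    using x0[of i] x0[of j] by (simp add: a_def field_simps flip: x_def)
  have inj_a: "inj a"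
  proof
    fix i j assume "a i = a j"
    then have "to_fract (mvar (X j) * mvar (Y i) - mvar (X i) * mvar (Y j) :: (xy_var, 'a) mpoly) = 0"
      using xa[of i j] by simp
    then have "mvar (X j) * mvar (Y i) = (mvar (X i) * mvar (Y j) :: (xy_var, 'a) mpoly)"
      by (simp only: to_fract_eq_0_iff right_minus_eq)
    then show "i = j" unfolding mvar_product_eq_iff by blast
  qed
  define f where "f v = (Min (e v), Max (e v))" for v
  have pair: "(\<lambda>(u, v). {u, v}) (f v) = e v" if v: "v \<in> B" for v
  proof -
    have "card (e v) = 2" using e(2)[OF v] by blast
    then obtain i j where "e v = {i, j}" unfolding card_2_iff by blast
    then show ?thesis by (auto simp: f_def min_def max_def)
  qed
  have inj_f: "inj_on f B"
  proof
    fix v w assume "v \<in> B" "w \<in> B" "f v = f w"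
    then show "v = w" using inj_onD[OF e(1), of v w] pair[of v] pair[of w] by simp
  qed
  have inj_edge: "inj_on (\<lambda>(u, v). {u, v}) (f ` B)"
  proof
    fix d d' assume "d \<in> f ` B" "d' \<in> f ` B" and eq: "(\<lambda>(u, v). {u, v}) d = (\<lambda>(u, v). {u, v}) d'"
    then obtain v w where "v \<in> B" "d = f v" "w \<in> B" "d' = f w" by blast
    then show "d = d'" using eq pair inj_onD[OF e(1), of v w] by metis
  qed
  have "independent B ((\<lambda>(i, j). x i * x j * (a i - a j)) \<circ> f)"
  \<comment> \<open>For \<open>i = Min\<close> and \<open>j = Max\<close> the product
    \<open>x i * x j * (a i - a j)\<close> is the negative of the edge binomial, and -1 is a
    unit.\<close>
  proof (rule independent_unit_factor[OF \<open>independent B t\<close>, where w = "\<lambda>_. - 1"])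
    fix v assume v: "v \<in> B"
    show "unit (- 1)" using one_in uminus_in by (simp add: unit_def)
    show "((\<lambda>(i, j). x i * x j * (a i - a j)) \<circ> f) v = - 1 * t v"
      using v by (simp add: f_def xa t_def g edge_binomial_def)
  qed
  from independent_reindex[OF this inj_f]
  have "independent (f ` B) (\<lambda>(i, j). x i * x j * (a i - a j))" .
  moreover have "f ` B \<subseteq> W \<times> W"
  proof
    fix d assume "d \<in> f ` B"
    then obtain v where v: "v \<in> B" "d = f v" by blast
    then show "d \<in> W \<times> W" using pair[OF v(1)] e(2)[OF v(1)] by (cases "f v") auto
  qed
  ultimately obtain D where "bij_betw (\<lambda>(u, v). {u, v}) D ((\<lambda>(u, v). {u, v}) ` f ` B)" "acyclic D"
    "\<not> (\<exists>w. alternating_closed_trail D w)"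
    using independent_differences_orientation[OF W inj_on_subset[OF inj_a subset_UNIV] _ inj_edge] by blast
  moreover have "(\<lambda>(u, v). {u, v}) ` f ` B = e ` B"
    unfolding image_image using pair by (intro image_cong) auto
  ultimately show ?thesis by auto
qed

lemma orientation_independent_binomials:
  fixes e :: "nat \<Rightarrow> nat set"
  assumes B: "finite B" and e: "inj_on e B" "\<And>v. v \<in> B \<Longrightarrow> card (e v) = 2"
    and g: "\<And>v. v \<in> B \<Longrightarrow> g v = (edge_binomial (e v) :: (xy_var, 'a::field) mpoly)"
    and D: "bij_betw (\<lambda>(u, v). {u, v}) D (e ` B)" "acyclic D" "\<not> (\<exists>w. alternating_closed_trail D w)"
    and p: "p \<in> polys B" "lin_ext const (monom_at g) p = 0"
  shows "p = 0"
proof -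
  define arc where "arc v = the_inv_into D (\<lambda>(u, v). {u, v}) (e v)" for v
  have inj: "inj_on (\<lambda>(u, v). {u, v}) D" and img: "(\<lambda>(u, v). {u, v}) ` D = e ` B"
    using D(1) by (auto simp: bij_betw_def)
  have edge: "(\<lambda>(u, v). {u, v}) (arc v) = e v" if "v \<in> B" for v
    unfolding arc_def by (rule f_the_inv_into_f[OF inj]) (use img that in blast)
  have arcD: "arc ` B = D"
  proof
    show "arc ` B \<subseteq> D"
    proof
      fix d assume "d \<in> arc ` B"
      then obtain v where v: "v \<in> B" "d = arc v" by blast
      from v(1) have "e v \<in> (\<lambda>(u, v). {u, v}) ` D" unfolding img by (rule imageI)
      then show "d \<in> D" unfolding v arc_def by (rule the_inv_into_into[OF inj _ order_refl])
    qed
    show "D \<subseteq> arc ` B"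
    proof
      fix d assume d: "d \<in> D"
      then have "(\<lambda>(u, v). {u, v}) d \<in> e ` B" unfolding img[symmetric] by (rule imageI)
      then obtain v where v: "(\<lambda>(u, v). {u, v}) d = e v" "v \<in> B" by (rule imageE)
      have "arc v = d" unfolding arc_def v(1)[symmetric] by (rule the_inv_into_f_f[OF inj d])
      then show "d \<in> arc ` B" using v(2) by blast
    qed
  qed
  show ?thesis
  proof (rule orientation_independent[of B arc])
    show "inj_on (\<lambda>v. (\<lambda>(i, j). {i, j}) (arc v)) B" using e(1) edge by (auto simp: inj_on_def)
    show "acyclic (arc ` B)" "\<not> alternating_closed_trail (arc ` B) w" for w using D by (auto simp: arcD)
    fix v assume v: "v \<in> B"
    have "{fst (arc v), snd (arc v)} = e v" using edge[OF v] by (simp add: case_prod_beta)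
    moreover from this have "fst (arc v) \<noteq> snd (arc v)" using e(2)[OF v] by (metis card_2_iff doubleton_eq_iff insert_absorb2)
    ultimately show "g v = const (if fst (arc v) < snd (arc v) then 1 else - 1) *
        (mvar (X (fst (arc v))) * mvar (Y (snd (arc v))) - mvar (X (snd (arc v))) * mvar (Y (fst (arc v))))"
      using g[OF v] edge_binomial_pair by metis
  qed (use B p in auto)
qed

lemma empty_orientation:
  "bij_betw (\<lambda>(u, v). {u, v}) {} {} \<and> acyclic {} \<and> \<not> (\<exists>w. alternating_closed_trail {} w)"
  by (auto simp: bij_betw_def acyclic_def alternating_closed_trail_def Let_def) (metis Suc_le_eq)

lemma analytic_spread_binomial_edge_ideal:
  fixes n :: nat and G :: "nat graph"
  assumes G: "simple_graph G" "verts G = {1..n}"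
  shows "analytic_spread (xy_vars n) (binomial_edge_ideal n G :: (xy_var, 'a::field) mpoly set) =
    enat (Max {card (edges H) | H. subgraph H G \<and>
      (\<exists>D. orientation H D \<and> acyclic D \<and> \<not> (\<exists>w. alternating_closed_trail D w))})"
proof -
  have edgeG: "E \<subseteq> {1..n} \<and> card E = 2" if "E \<in> edges G" for E
    using G that by (auto simp: simple_graph_def)
  have "finite (edges G)"
    by (rule finite_subset[of _ "Pow {1..n}"]) (use edgeG in auto)
  define s where "s = card (edges G)"
  obtain e where e: "bij_betw e {..<s} (edges G)"
    using ex_bij_betw_nat_finite[OF \<open>finite (edges G)\<close>] by (auto simp: s_def atLeast0LessThan)
  have inj_e: "inj_on e {..<s}" and img_e: "e ` {..<s} = edges G" using e by (auto simp: bij_betw_def)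
  \<comment> \<open>Padding with 0 puts all variables from \<open>s\<close> on into the kernel,
    which gives the finiteness required of the prime chains.\<close>
  define g :: "nat \<Rightarrow> (xy_var, 'a) mpoly" where "g k = (if k < s then edge_binomial (e k) else 0)" for k
  have e_k: "e k \<subseteq> {1..n} \<and> card (e k) = 2" if "k < s" for k
    using img_e that by (intro edgeG) auto
  interpret homogeneous_generators "xy_vars n" g 2
  proof
    fix k
    show "g k \<in> polys (xy_vars n)"
    proof (cases "k < s")
      case True
      have "finite (e k)" "e k \<noteq> {}" using e_k[OF True] by (auto intro: card_ge_0_finite)
      then have "Min (e k) \<in> {1..n}" "Max (e k) \<in> {1..n}" using e_k[OF True] Min_in Max_in by blast+
      then show ?thesis
        using True by (auto simp: g_def edge_binomial_def xy_vars_def intro!: polys_diff polys_mult polys_mvar)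
    qed (simp add: g_def)
    have mono: "homogeneous 2 (mvar x * mvar y)" for x y :: xy_var
      using homogeneous_mult[OF homogeneous_mvar homogeneous_mvar, of x y] by (simp add: numeral_2_eq_2)
    have neg: "homogeneous 2 (- p)" if "homogeneous 2 p" for p :: "(xy_var, 'a) mpoly"
      using that by (simp add: homogeneous_def in_keys_iff)
    have "homogeneous 2 (mvar x * mvar y - mvar x' * mvar y' :: (xy_var, 'a) mpoly)" for x y x' y'
      using homogeneous_add[OF mono neg[OF mono]] by simp
    then show "homogeneous 2 (g k)" by (simp add: g_def edge_binomial_def homogeneous_zero)
  qed simp
  have gens: "{mvar (X i) * mvar (Y j) - mvar (X j) * mvar (Y i) | i j. {i, j} \<in> edges G \<and> i < j} = g ` {..<s}"
  proof -
    have "{mvar (X i) * mvar (Y j) - mvar (X j) * mvar (Y i) | i j. {i, j} \<in> edges G \<and> i < j} =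
        (edge_binomial ` edges G :: (xy_var, 'a) mpoly set)"
    proof (intro equalityI subsetI)
      fix q assume "q \<in> (edge_binomial ` edges G :: (xy_var, 'a) mpoly set)"
      then obtain E where E: "E \<in> edges G" "q = edge_binomial E" by blast
      then have "card E = 2" using edgeG by blast
      then obtain i j where "E = {i, j}" "i \<noteq> j" unfolding card_2_iff by blast
      then obtain i j where "E = {i, j}" "i < j" by (metis insert_commute linorder_neqE_nat)
      then have "q = mvar (X i) * mvar (Y j) - mvar (X j) * mvar (Y i)" "{i, j} \<in> edges G" "i < j"
        using E by (simp_all add: edge_binomial_def)
      then show "q \<in> {mvar (X i) * mvar (Y j) - mvar (X j) * mvar (Y i) | i j. {i, j} \<in> edges G \<and> i < j}"
        by blast
    next
      fix q :: "(xy_var, 'a) mpoly"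
      assume "q \<in> {mvar (X i) * mvar (Y j) - mvar (X j) * mvar (Y i) | i j. {i, j} \<in> edges G \<and> i < j}"
      then obtain i j where "q = mvar (X i) * mvar (Y j) - mvar (X j) * mvar (Y i)" "{i, j} \<in> edges G" "i < j" by blast
      then show "q \<in> edge_binomial ` edges G"
        by (intro image_eqI[of _ _ "{i, j}"]) (simp_all add: edge_binomial_def)
    qed
    also have "\<dots> = g ` {..<s}" by (simp add: g_def image_image flip: img_e)
    finally show ?thesis .
  qed
  have "Idl\<^bsub>S\<^esub> (g ` {..<s}) = Idl\<^bsub>S\<^esub> (range g)"
  proof
    have car: "g ` {..<s} \<subseteq> carrier S" using g_polys by (auto simp: carrier_mpoly_ring)
    have ideal: "ideal (Idl\<^bsub>S\<^esub> (g ` {..<s})) S" by (rule S.genideal_ideal[OF car])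
    have "g k \<in> Idl\<^bsub>S\<^esub> (g ` {..<s})" for k
    proof (cases "k < s")
      case True
      then show ?thesis using S.genideal_self[OF car] by blast
    next
      case False
      then show ?thesis using ideal_mpoly_ringD(2)[OF ideal] by (simp add: g_def)
    qed
    then show "Idl\<^bsub>S\<^esub> (range g) \<subseteq> Idl\<^bsub>S\<^esub> (g ` {..<s})" by (intro S.genideal_minimal[OF ideal]) blast
    show "Idl\<^bsub>S\<^esub> (g ` {..<s}) \<subseteq> Idl\<^bsub>S\<^esub> (range g)"
      using S.genideal_minimal[OF I_ideal, of "g ` {..<s}"] g_in_I unfolding I_def by blast
  qed
  then have I_eq: "binomial_edge_ideal n G = I" by (simp add: binomial_edge_ideal_def gens I_def)
  define N where "N = {p. ev p = 0}"
  interpret N: prime_set N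
    by unfold_locales (auto simp: N_def ev.ev_zero ev.ev_one ev.ev_add ev.ev_mult)
  have mvarN: "{v. mvar v \<notin> N} \<subseteq> {..<s}"
  proof
    fix v assume "v \<in> {v. mvar v \<notin> N}"
    then have "g v \<noteq> 0" by (simp add: N_def ev_mvar)
    then show "v \<in> {..<s}" by (auto simp: g_def split: if_splits)
  qed
  then have finN: "finite {v. mvar v \<notin> N}" using finite_subset by blast
  define orientable where "orientable F \<longleftrightarrow> (\<exists>D. bij_betw (\<lambda>(u, v). {u, v}) D F \<and> acyclic D \<and>
      \<not> (\<exists>w. alternating_closed_trail D w))" for F :: "nat set set"
  \<comment> \<open>The two directions of the combinatorial argument meet here: independence of the
    variables in \<open>B\<close> modulo \<open>N\<close> is orientability of the corresponding
    edges.\<close>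
  have trans: "polys B \<inter> N = {0} \<longleftrightarrow> orientable (e ` B)" if B: "B \<subseteq> {..<s}" for B
  proof -
    have B': "finite B" "inj_on e B" "\<And>v. v \<in> B \<Longrightarrow> e v \<subseteq> {1..n} \<and> card (e v) = 2"
      "\<And>v. v \<in> B \<Longrightarrow> g v = edge_binomial (e v)"
    proof -
      have lt: "v < s" if "v \<in> B" for v using that B by blast
      show "finite B" "inj_on e B" using B finite_subset inj_on_subset[OF inj_e B] by blast+
      show "e v \<subseteq> {1..n} \<and> card (e v) = 2" "g v = edge_binomial (e v)" if "v \<in> B" for v
        using e_k[OF lt[OF that]] lt[OF that] by (simp_all add: g_def)
    qed
    have "polys B \<inter> N = {0} \<longleftrightarrow> (\<forall>p\<in>polys B. ev p = 0 \<longrightarrow> p = 0)"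
      by (auto simp: N_def ev.ev_zero)
    also have "\<dots> \<longleftrightarrow> orientable (e ` B)"
    proof
      assume "\<forall>p\<in>polys B. ev p = 0 \<longrightarrow> p = 0"
      then show "orientable (e ` B)" unfolding orientable_def
        by (intro independent_binomials_orientation[OF B'(1,2,3) _ B'(4)]) auto
    next
      assume "orientable (e ` B)"
      then show "\<forall>p\<in>polys B. ev p = 0 \<longrightarrow> p = 0" unfolding orientable_def
        using orientation_independent_binomials[OF B'(1,2) _ B'(4)] B'(3) by blast
    qed
    finally show ?thesis .
  qed
  define C where "C = {card B | B. B \<subseteq> {..<s} \<and> polys B \<inter> N = {0}}"
  have C_eq: "{card (edges H) | H. subgraph H G \<and> (\<exists>D. orientation H D \<and> acyclic D \<and> \<not> (\<exists>w. alternating_closed_trail D w))} = C"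
  proof (intro equalityI subsetI)
    fix c assume "c \<in> {card (edges H) | H. subgraph H G \<and> (\<exists>D. orientation H D \<and> acyclic D \<and> \<not> (\<exists>w. alternating_closed_trail D w))}"
    then obtain H where H: "c = card (edges H)" "subgraph H G" "orientable (edges H)"
      unfolding orientation_def orientable_def by blast
    define B where "B = {k. k < s \<and> e k \<in> edges H}"
    have B: "B \<subseteq> {..<s}" by (auto simp: B_def)
    moreover have "e ` B = edges H"
    proof
      show "e ` B \<subseteq> edges H" by (auto simp: B_def)
      show "edges H \<subseteq> e ` B"
      proof
        fix E assume E: "E \<in> edges H"
        then have "E \<in> e ` {..<s}" using H(2) by (auto simp: subgraph_def img_e)
        then obtain k where "E = e k" "k \<in> {..<s}" by (rule imageE)
        then show "E \<in> e ` B" using E by (simp add: B_def)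
      qed
    qed
    moreover from this have "c = card B" using card_image[OF inj_on_subset[OF inj_e B]] H(1) by simp
    ultimately show "c \<in> C" using trans[OF B] H(3) by (auto simp: C_def)
  next
    fix c assume "c \<in> C"
    then obtain B where B: "c = card B" "B \<subseteq> {..<s}" "polys B \<inter> N = {0}" by (auto simp: C_def)
    \<comment> \<open>The vertex set is the union of the chosen edges, so that no vertex is
      isolated.\<close>
    define H where "H = (\<Union>(e ` B), e ` B)"
    have sub: "E \<in> e ` B \<Longrightarrow> E \<subseteq> {1..n} \<and> card E = 2" for E using B(2) e_k by auto
    have union: "\<Union>(e ` B) \<subseteq> {1..n}" using sub by blast
    then have "finite (\<Union>(e ` B))" by (rule finite_subset) simp
    moreover have "e ` B \<subseteq> edges G" using B(2) img_e by blast
    moreover have "e ` B \<subseteq> {E. E \<subseteq> \<Union>(e ` B) \<and> card E = 2}" using sub by blast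
    ultimately have "subgraph H G"
      unfolding subgraph_def simple_graph_def H_def using union G(2) by simp
    moreover have "orientable (edges H)" using trans[OF B(2)] B(3) by (simp add: H_def)
    moreover have "c = card (edges H)" using card_image[OF inj_on_subset[OF inj_e B(2)]] B(1) by (simp add: H_def)
    ultimately show "c \<in> {card (edges H) | H. subgraph H G \<and> (\<exists>D. orientation H D \<and> acyclic D \<and> \<not> (\<exists>w. alternating_closed_trail D w))}"
      unfolding orientable_def orientation_def by blast
  qed
  have C_fin: "finite C"
    by (rule finite_subset[of _ "card ` Pow {..<s}"]) (auto simp: C_def)
  have "orientable {}" unfolding orientable_def by (rule exI[of _ "{}"]) (rule empty_orientation)
  then have "polys {} \<inter> N = {0}" using trans[of "{}"] by simp
  then have "0 \<in> C" unfolding C_def by (intro CollectI exI[of _ "{}"]) simp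
  then have "Max C \<in> C" using C_fin by (intro Max_in) auto
  then obtain B where B: "Max C = card B" "B \<subseteq> {..<s}" "polys B \<inter> N = {0}" by (auto simp: C_def)
  let ?chains = "{enat k | k. \<exists>P. (\<forall>i\<le>k. prime_set (P i) \<and> N \<subseteq> P i) \<and> (\<forall>i<k. P i \<subset> P (Suc i))}"
  have "analytic_spread (xy_vars n) (binomial_edge_ideal n G :: (xy_var, 'a) mpoly set) = Sup ?chains"
    unfolding analytic_spread_def Let_def I_eq using krull_dim_special_fiber by (simp add: mm_def N_def)
  also have "Sup ?chains = enat (Max C)"
  proof (rule antisym)
    show "Sup ?chains \<le> enat (Max C)"
    proof (rule Sup_least)
      fix x assume "x \<in> ?chains"
      then obtain k P where k: "x = enat k" "\<And>i. i \<le> k \<Longrightarrow> prime_set (P i)" "\<And>i. i \<le> k \<Longrightarrow> N \<subseteq> P i"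
        "\<And>i. i < k \<Longrightarrow> P i \<subset> P (Suc i)" by blast
      \<comment> \<open>Upper bound: a chain above \<open>N\<close> yields variables independent
        modulo its first prime, hence modulo \<open>N\<close>.\<close>
      have NP: "N \<subseteq> P 0" using k(3) by simp
      have "finite {v. mvar v \<notin> P 0}" by (rule finite_subset[OF _ finN]) (use NP in auto)
      then obtain B' where B': "k \<le> card B'" "polys B' \<inter> P 0 = {0}"
        using prime_chain_independent_variables[of k P] k(2,4) by blast
      have B'N: "polys B' \<inter> N = {0}" using B'(2) NP N.zero_mem by auto
      have "B' \<subseteq> {..<s}"
        using transversal_subset[OF N.prime_set_axioms B'N] mvarN by (rule subset_trans)
      then have "card B' \<in> C" unfolding C_def using B'N by blast
      then show "x \<le> enat (Max C)" using B'(1) C_fin k(1) by (auto intro: order_trans Max_ge)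
    qed
    \<comment> \<open>Lower bound: an independent set of maximum size yields a chain that starts at
      \<open>N\<close>.\<close>
    have "finite B" using B(2) finite_subset by blast
    from independent_variables_prime_chain[OF N.prime_set_axioms finN this B(3)]
    obtain P where P: "P 0 = N" "\<forall>i. i \<le> card B \<longrightarrow> prime_set (P i)" "\<forall>i. i < card B \<longrightarrow> P i \<subset> P (Suc i)"
      by (elim exE conjE)
    have "N \<subseteq> P i" if "i \<le> card B" for i
      using that
    proof (induction i)
      case (Suc i)
      then have "P i \<subset> P (Suc i)" "N \<subseteq> P i" using P(3) by simp_all
      then show ?case by blast
    qed (simp add: P)
    then have "\<exists>P. (\<forall>i\<le>card B. prime_set (P i) \<and> N \<subseteq> P i) \<and> (\<forall>i<card B. P i \<subset> P (Suc i))"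
      using P(2,3) by (intro exI[of _ P]) simp
    then have "enat (card B) \<in> ?chains" by blast
    then show "enat (Max C) \<le> Sup ?chains" unfolding B(1) by (rule Sup_upper)
  qed
  finally show ?thesis unfolding C_eq .
qed

theorem corollary1p2:
  fixes n :: nat and G :: "nat graph"
  assumes "n \<ge> 2"
    and "CHAR('a::field) = 0 \<or> CHAR('a) > 2 ^ n"
    and "simple_graph G" and "verts G = {1..n}"
  shows "analytic_spread (xy_vars n) (binomial_edge_ideal n G :: (xy_var, 'a) mpoly set) =
           enat (Max {card (edges H) | H. subgraph H G \<and>
             (\<exists>D. orientation H D \<and> acyclic D \<and> \<not> (\<exists>w. alternating_closed_trail D w))}) \<and>
         (analytic_spread (xy_vars n) (binomial_edge_ideal n G :: (xy_var, 'a) mpoly set) =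
            enat (card (edges G)) \<longleftrightarrow>
           (\<exists>D. orientation G D \<and> acyclic D \<and> \<not> (\<exists>w. alternating_closed_trail D w)))"
proof -
  define good where "good H \<longleftrightarrow> (\<exists>D. orientation H D \<and> acyclic D \<and> \<not> (\<exists>w. alternating_closed_trail D w))"
    for H :: "nat graph"
  let ?C = "{card (edges H) | H. subgraph H G \<and> good H}"
  have spread: "analytic_spread (xy_vars n) (binomial_edge_ideal n G :: (xy_var, 'a) mpoly set) = enat (Max ?C)"
    unfolding good_def by (rule analytic_spread_binomial_edge_ideal) fact+
  have finG: "finite (edges G)"
    by (rule finite_subset[of _ "Pow (verts G)"]) (use assms(3) in \<open>auto simp: simple_graph_def\<close>)
  have le: "c \<le> card (edges G)" if "c \<in> ?C" for c
    using that card_mono[OF finG] by (auto simp: subgraph_def)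
  then have finC: "finite ?C" by (meson finite_nat_set_iff_bounded_le)
  \<comment> \<open>The empty graph ensures that the maximum is taken over a nonempty set.\<close>
  have "good ({}, {})" unfolding good_def
    using empty_orientation by (intro exI[of _ "{}"]) (simp add: orientation_def)
  moreover have "subgraph ({}, {}) G" by (simp add: subgraph_def simple_graph_def)
  ultimately have "?C \<noteq> {}" by blast
  then have max: "Max ?C \<in> ?C" using finC by (rule Max_in[rotated])
  have "Max ?C = card (edges G) \<longleftrightarrow> good G"
  proof
    assume "Max ?C = card (edges G)"
    then obtain H where H: "card (edges H) = card (edges G)" "subgraph H G" "good H" using max by auto
    \<comment> \<open>A subgraph with as many edges as \<open>G\<close> has the same edge set, and
      orientations depend on the edges alone.\<close>
    then have "edges H = edges G" using finG by (intro card_subset_eq) (auto simp: subgraph_def)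
    then show "good G" using H(3) by (simp add: good_def orientation_def)
  next
    assume "good G"
    moreover have "subgraph G G" using assms(3) by (simp add: subgraph_def)
    ultimately have "card (edges G) \<in> ?C" by blast
    then show "Max ?C = card (edges G)" using le finC by (intro Max_eqI)
  qed
  then show ?thesis using spread unfolding good_def by simp
qed

end
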